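(* Let $M$ be a space-like surface in the Robertson-Walker space-time $L^4_1(f,c)$, and let $\{e_1,e_2;e_3,e_4\}$ be a (local) orthonormal frame field along $M$, with $e_1,e_2$ tangent and $e_3,e_4$ normal to $M$, and $\theta$ a function, such that $$\left.\frac{\partial}{\partial t}\right|_M=\sinh\theta\, e_1+\cosh\theta\, e_3 .$$ Then $M$ has positive relative nullity if and only if \begin{align*} \widetilde\nabla_{e_1}e_1&=0, & \widetilde\nabla_{e_2}e_1&=\omega e_2,\\ \widetilde\nabla_{e_1}e_2&=0, & \widetilde\nabla_{e_2}e_2&=-\omega e_1-h^3_{22}e_3+h^4_{22}e_4,\\ \widetilde\nabla_{e_1}e_3&=0, & \widetilde\nabla_{e_2}e_3&=-h^3_{22}e_2,\\ \widetilde\nabla_{e_1}e_4&=0, & \widetilde\nabla_{e_2}e_4&=-h^4_{22}e_2,\\ e_1(\theta)&=\frac{f'}{f}\cosh\theta, & e_2(\theta)&=0 \end{align*} for some smooth functions $\omega$, $h^3_{22}$ and $h^4_{22}$.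
   Context: For $c\in\{-1,0,1\}$ let $R^3(c)$ be $\mathbb H^3,\mathbb E^3,\mathbb S^3$ respectively with metric $g_c$. Let $I$ be an open interval and $f:I\to\mathbb R$ a smooth nowhere vanishing function. The Robertson-Walker space-time $L^4_1(f,c)$ is $I\times R^3(c)$ with metric $\langle\cdot,\cdot\rangle=-dt^2+f(t)^2g_c$; $\widetilde\nabla$ is its Levi-Civita connection. On a surface, $f$ and $f'$ are evaluated at the $t$-coordinate of the point. A surface $M$ in $L^4_1(f,c)$ is space-like if its induced metric is Riemannian; $h$ is its second fundamental form. Write $\frac{\partial}{\partial t}|_M=T+\eta$ with $T$ tangent and $\eta$ normal to $M$. (Thus $e_1$ is proportional to $T$ and $e_3$ is the time-like unit normal proportional to $\eta$.) The relative null space at $p\in M$ is $\mathcal N_p=\{X\in T_pM: h_p(X,Y)=0\ \text{for all } Y\in T_pM\}$; $M$ has positive relative nullity if $\dim\mathcal N_p>0$ for all $p\in M$. Standing assumptions: (i) $\frac{f''(t)}{f(t)}-\frac{f'(t)^2+c}{f(t)^2}\neq0$ for all $t\in I$; (ii) $T$ does not vanish on $M$; (iii) when $M$ has positive relative nullity, the spaces $\mathcal N_p$ form a smooth 1-dimensional distribution; (iv) $M$ is connected and no open part of $M$ lies in a 3-dimensional totally geodesic hypersurface of $L^4_1(f,c)$. *)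

theory Defs
  imports "HOL-Analysis.Analysis"
begin

section \<open>Smooth maps on open sets\<close>

fun Ck_on :: "nat \<Rightarrow> 'a::real_normed_vector set \<Rightarrow> ('a \<Rightarrow> 'b::real_normed_vector) \<Rightarrow> bool" where
  "Ck_on 0 S f \<longleftrightarrow> continuous_on S f"
| "Ck_on (Suc k) S f \<longleftrightarrow> (\<forall>x\<in>S. f differentiable (at x)) \<and>
     (\<forall>v. Ck_on k S (\<lambda>x. frechet_derivative f (at x) v))"

text \<open>Only meant for open \<open>S\<close>.\<close>
definition smooth_on :: "'a::real_normed_vector set \<Rightarrow> ('a \<Rightarrow> 'b::real_normed_vector) \<Rightarrow> bool" where
  "smooth_on S f \<longleftrightarrow> (\<forall>k. Ck_on k S f)"

section \<open>Semi-Riemannian submanifolds of a vector space\<close>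

text \<open>A manifold \<open>S\<close> is given as an embedded submanifold of a Euclidean space, used only as a
  vector space; its metric \<open>g p v w\<close> need not be related to the inner product. Tangent
  vectors are velocities of curves in \<open>S\<close>. Fields and functions on \<open>S\<close> are represented by maps
  that are smooth on an open neighbourhood of \<open>S\<close>; only their values on \<open>S\<close> matter.\<close>

definition tangent_space :: "'a::euclidean_space set \<Rightarrow> 'a \<Rightarrow> 'a set" where
  "tangent_space S p = {v. \<exists>\<gamma>::real \<Rightarrow> 'a. \<gamma> 0 = p \<and> (\<forall>\<^sub>F s in nhds 0. \<gamma> s \<in> S) \<and>
     (\<gamma> has_vector_derivative v) (at 0)}"

definition smooth_functions :: "'a::euclidean_space set \<Rightarrow> ('a \<Rightarrow> real) set" where
  "smooth_functions S = {u. \<exists>W. open W \<and> S \<subseteq> W \<and> smooth_on W u}"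

definition vector_fields :: "'a::euclidean_space set \<Rightarrow> ('a \<Rightarrow> 'a) set" where
  "vector_fields S =
     {Y. (\<exists>W. open W \<and> S \<subseteq> W \<and> smooth_on W Y) \<and> (\<forall>p\<in>S. Y p \<in> tangent_space S p)}"

text \<open>\<open>D p v Y\<close> is the covariant derivative at \<open>p\<close> of the field \<open>Y\<close> in the direction of the tangent
  vector \<open>v\<close>. The conditions are, in order: smoothness, the three axioms of an affine connection,
  compatibility with the metric, and vanishing torsion
  (the Lie bracket is \<open>[X, Y] = dY(X) - dX(Y)\<close>).\<close>
definition levi_civita ::
  "'a::euclidean_space set \<Rightarrow> ('a \<Rightarrow> 'a \<Rightarrow> 'a \<Rightarrow> real) \<Rightarrow> ('a \<Rightarrow> 'a \<Rightarrow> ('a \<Rightarrow> 'a) \<Rightarrow> 'a) \<Rightarrow> bool" where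
  "levi_civita S g D \<longleftrightarrow>
     (\<forall>X\<in>vector_fields S. \<forall>Y\<in>vector_fields S. \<exists>Z\<in>vector_fields S. \<forall>p\<in>S. Z p = D p (X p) Y) \<and>
     (\<forall>p\<in>S. \<forall>Y\<in>vector_fields S. \<forall>v\<in>tangent_space S p. \<forall>w\<in>tangent_space S p. \<forall>a b.
        D p (a *\<^sub>R v + b *\<^sub>R w) Y = a *\<^sub>R D p v Y + b *\<^sub>R D p w Y) \<and>
     (\<forall>p\<in>S. \<forall>v\<in>tangent_space S p. \<forall>Y\<in>vector_fields S. \<forall>Z\<in>vector_fields S.
        D p v (\<lambda>q. Y q + Z q) = D p v Y + D p v Z) \<and>
     (\<forall>p\<in>S. \<forall>v\<in>tangent_space S p. \<forall>Y\<in>vector_fields S. \<forall>u\<in>smooth_functions S.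
        D p v (\<lambda>q. u q *\<^sub>R Y q) = frechet_derivative u (at p) v *\<^sub>R Y p + u p *\<^sub>R D p v Y) \<and>
     (\<forall>p\<in>S. \<forall>v\<in>tangent_space S p. \<forall>Y\<in>vector_fields S. \<forall>Z\<in>vector_fields S.
        frechet_derivative (\<lambda>q. g q (Y q) (Z q)) (at p) v = g p (D p v Y) (Z p) + g p (Y p) (D p v Z)) \<and>
     (\<forall>p\<in>S. \<forall>X\<in>vector_fields S. \<forall>Y\<in>vector_fields S.
        D p (X p) Y - D p (Y p) X
          = frechet_derivative Y (at p) (X p) - frechet_derivative X (at p) (Y p))"

text \<open>Embedded submanifolds of \<open>S\<close> of codimension one, by local defining functions.\<close>
definition hypersurface :: "'a::euclidean_space set \<Rightarrow> 'a set \<Rightarrow> bool" where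
  "hypersurface S N \<longleftrightarrow> N \<subseteq> S \<and>
     (\<forall>p\<in>N. \<exists>W (F::'a \<Rightarrow> real). open W \<and> p \<in> W \<and> smooth_on W F \<and> N \<inter> W = {q \<in> S \<inter> W. F q = 0} \<and>
        (\<exists>v\<in>tangent_space S p. frechet_derivative F (at p) v \<noteq> 0))"

text \<open>The induced metric of a totally geodesic hypersurface is required to be nondegenerate, as the
  second fundamental form is only defined in that case; it vanishes iff covariant derivatives of
  fields tangent to \<open>N\<close> in directions tangent to \<open>N\<close> are tangent to \<open>N\<close>.\<close>
definition totally_geodesic_hypersurface ::
  "'a::euclidean_space set \<Rightarrow> ('a \<Rightarrow> 'a \<Rightarrow> 'a \<Rightarrow> real) \<Rightarrow> ('a \<Rightarrow> 'a \<Rightarrow> ('a \<Rightarrow> 'a) \<Rightarrow> 'a) \<Rightarrow> 'a set \<Rightarrow> bool" where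
  "totally_geodesic_hypersurface S g D N \<longleftrightarrow> hypersurface S N \<and>
     (\<forall>p\<in>N. \<forall>v\<in>tangent_space N p. (\<forall>w\<in>tangent_space N p. g p v w = 0) \<longrightarrow> v = 0) \<and>
     (\<forall>Y\<in>vector_fields S. (\<forall>q\<in>N. Y q \<in> tangent_space N q) \<longrightarrow>
        (\<forall>p\<in>N. \<forall>v\<in>tangent_space N p. D p v Y \<in> tangent_space N p))"

section \<open>Abstract surfaces\<close>

text \<open>A surface is a topological space (the type \<open>'m\<close>) with an atlas of charts \<open>(D, x)\<close>,
  \<open>x\<close> being the coordinate map on the open set \<open>D\<close>.\<close>

definition smooth_atlas :: "('m::topological_space set \<times> ('m \<Rightarrow> real^2)) set \<Rightarrow> bool" where
  "smooth_atlas A \<longleftrightarrow> \<Union>(fst ` A) = UNIV \<and>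
     (\<forall>(D, x)\<in>A. open D \<and> open (x ` D) \<and> homeomorphism D (x ` D) x (inv_into D x)) \<and>
     (\<forall>(D, x)\<in>A. \<forall>(D', x')\<in>A. smooth_on (x ` (D \<inter> D')) (x' \<circ> inv_into D x))"

definition msmooth_on ::
  "('m::topological_space set \<times> ('m \<Rightarrow> real^2)) set \<Rightarrow> 'm set \<Rightarrow> ('m \<Rightarrow> 'b::real_normed_vector) \<Rightarrow> bool" where
  "msmooth_on A U F \<longleftrightarrow> (\<forall>(D, x)\<in>A. smooth_on (x ` (D \<inter> U)) (F \<circ> inv_into D x))"

definition chart_at :: "('m set \<times> ('m \<Rightarrow> real^2)) set \<Rightarrow> 'm \<Rightarrow> 'm set \<times> ('m \<Rightarrow> real^2)" where
  "chart_at A p = (SOME ch. ch \<in> A \<and> p \<in> fst ch)"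

text \<open>The differential of \<open>F\<close> at \<open>p\<close>, the abstract tangent space at \<open>p\<close> being identified with
  \<open>real^2\<close> by means of \<open>chart_at A p\<close>.\<close>
definition mdiff ::
  "('m set \<times> ('m \<Rightarrow> real^2)) set \<Rightarrow> ('m \<Rightarrow> 'b::real_normed_vector) \<Rightarrow> 'm \<Rightarrow> real^2 \<Rightarrow> 'b" where
  "mdiff A F p = (case chart_at A p of (D, x) \<Rightarrow> frechet_derivative (F \<circ> inv_into D x) (at (x p)))"

section \<open>Immersed surfaces\<close>

definition immersion ::
  "('m::topological_space set \<times> ('m \<Rightarrow> real^2)) set \<Rightarrow> ('m \<Rightarrow> 'a::euclidean_space) \<Rightarrow> bool" where
  "immersion A \<phi> \<longleftrightarrow> msmooth_on A UNIV \<phi> \<and> (\<forall>p. inj (mdiff A \<phi> p))"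

text \<open>Tangent vectors of an immersed surface are identified with their images under the
  differential of the immersion \<open>\<phi>\<close>.\<close>
definition tangent_plane ::
  "('m set \<times> ('m \<Rightarrow> real^2)) set \<Rightarrow> ('m \<Rightarrow> 'a::euclidean_space) \<Rightarrow> 'm \<Rightarrow> 'a set" where
  "tangent_plane A \<phi> p = range (mdiff A \<phi> p)"

definition dir_deriv ::
  "('m set \<times> ('m \<Rightarrow> real^2)) set \<Rightarrow> ('m \<Rightarrow> 'a::euclidean_space) \<Rightarrow> 'm \<Rightarrow> 'a \<Rightarrow> ('m \<Rightarrow> 'b::real_normed_vector) \<Rightarrow> 'b" where
  "dir_deriv A \<phi> p X F = mdiff A F p (inv (mdiff A \<phi> p) X)"

text \<open>The connection \<open>D\<close> of \<open>S\<close> differentiates vector fields \<open>V\<close> of \<open>S\<close> along \<open>\<phi>\<close> through the pullback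
  connection: if \<open>V = (\<Sum>i. v\<^sub>i *\<^sub>R E\<^sub>i \<circ> \<phi>)\<close> near \<open>p\<close>, with smooth functions \<open>v\<^sub>i\<close> on the surface and
  fields \<open>E\<^sub>i\<close> on \<open>S\<close>, then \<open>D\<^sub>X V = (\<Sum>i. X(v\<^sub>i) *\<^sub>R E\<^sub>i + v\<^sub>i *\<^sub>R D\<^sub>X E\<^sub>i)\<close>.\<close>
definition cov_deriv ::
  "'a::euclidean_space set \<Rightarrow> ('a \<Rightarrow> 'a \<Rightarrow> ('a \<Rightarrow> 'a) \<Rightarrow> 'a) \<Rightarrow>
   ('m::topological_space set \<times> ('m \<Rightarrow> real^2)) set \<Rightarrow> ('m \<Rightarrow> 'a) \<Rightarrow> 'm \<Rightarrow> 'a \<Rightarrow> ('m \<Rightarrow> 'a) \<Rightarrow> 'a" where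
  "cov_deriv S D A \<phi> p X V = (THE Z. \<exists>U (n::nat) v E. open U \<and> p \<in> U \<and>
     (\<forall>i<n. msmooth_on A U (v i) \<and> E i \<in> vector_fields S) \<and>
     (\<forall>q\<in>U. V q = (\<Sum>i<n. v i q *\<^sub>R E i (\<phi> q))) \<and>
     Z = (\<Sum>i<n. dir_deriv A \<phi> p X (v i) *\<^sub>R E i (\<phi> p) + v i p *\<^sub>R D (\<phi> p) X (E i)))"

definition spacelike ::
  "('a::euclidean_space \<Rightarrow> 'a \<Rightarrow> 'a \<Rightarrow> real) \<Rightarrow> ('m set \<times> ('m \<Rightarrow> real^2)) set \<Rightarrow> ('m \<Rightarrow> 'a) \<Rightarrow> bool" where
  "spacelike g A \<phi> \<longleftrightarrow> (\<forall>p. \<forall>X\<in>tangent_plane A \<phi> p. X \<noteq> 0 \<longrightarrow> g (\<phi> p) X X > 0)"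

definition normal_space ::
  "'a::euclidean_space set \<Rightarrow> ('a \<Rightarrow> 'a \<Rightarrow> 'a \<Rightarrow> real) \<Rightarrow> ('m set \<times> ('m \<Rightarrow> real^2)) set \<Rightarrow> ('m \<Rightarrow> 'a) \<Rightarrow> 'm \<Rightarrow> 'a set" where
  "normal_space S g A \<phi> p =
     {w \<in> tangent_space S (\<phi> p). \<forall>X\<in>tangent_plane A \<phi> p. g (\<phi> p) w X = 0}"

definition normal_part ::
  "'a::euclidean_space set \<Rightarrow> ('a \<Rightarrow> 'a \<Rightarrow> 'a \<Rightarrow> real) \<Rightarrow> ('m set \<times> ('m \<Rightarrow> real^2)) set \<Rightarrow> ('m \<Rightarrow> 'a) \<Rightarrow> 'm \<Rightarrow> 'a \<Rightarrow> 'a" where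
  "normal_part S g A \<phi> p w =
     (THE n. n \<in> normal_space S g A \<phi> p \<and> w - n \<in> tangent_plane A \<phi> p)"

definition tangential_part ::
  "'a::euclidean_space set \<Rightarrow> ('a \<Rightarrow> 'a \<Rightarrow> 'a \<Rightarrow> real) \<Rightarrow> ('m set \<times> ('m \<Rightarrow> real^2)) set \<Rightarrow> ('m \<Rightarrow> 'a) \<Rightarrow> 'm \<Rightarrow> 'a \<Rightarrow> 'a" where
  "tangential_part S g A \<phi> p w = w - normal_part S g A \<phi> p w"

definition tangent_field_on ::
  "('m::topological_space set \<times> ('m \<Rightarrow> real^2)) set \<Rightarrow> ('m \<Rightarrow> 'a::euclidean_space) \<Rightarrow> 'm set \<Rightarrow> ('m \<Rightarrow> 'a) \<Rightarrow> bool" where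
  "tangent_field_on A \<phi> U Y \<longleftrightarrow> msmooth_on A U Y \<and> (\<forall>q\<in>U. Y q \<in> tangent_plane A \<phi> q)"

text \<open>\<open>h(X, Y)\<close> is the normal part of \<open>D\<^sub>X Y'\<close>, where \<open>Y'\<close> is any local tangent field extending
  the tangent vector \<open>Y\<close> at \<open>p\<close>.\<close>
definition second_ff ::
  "'a::euclidean_space set \<Rightarrow> ('a \<Rightarrow> 'a \<Rightarrow> 'a \<Rightarrow> real) \<Rightarrow> ('a \<Rightarrow> 'a \<Rightarrow> ('a \<Rightarrow> 'a) \<Rightarrow> 'a) \<Rightarrow>
   ('m::topological_space set \<times> ('m \<Rightarrow> real^2)) set \<Rightarrow> ('m \<Rightarrow> 'a) \<Rightarrow> 'm \<Rightarrow> 'a \<Rightarrow> 'a \<Rightarrow> 'a" where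
  "second_ff S g D A \<phi> p X Y = (THE h. \<exists>U Y'. open U \<and> p \<in> U \<and> tangent_field_on A \<phi> U Y' \<and>
     Y' p = Y \<and> h = normal_part S g A \<phi> p (cov_deriv S D A \<phi> p X Y'))"

definition rel_null_space ::
  "'a::euclidean_space set \<Rightarrow> ('a \<Rightarrow> 'a \<Rightarrow> 'a \<Rightarrow> real) \<Rightarrow> ('a \<Rightarrow> 'a \<Rightarrow> ('a \<Rightarrow> 'a) \<Rightarrow> 'a) \<Rightarrow>
   ('m::topological_space set \<times> ('m \<Rightarrow> real^2)) set \<Rightarrow> ('m \<Rightarrow> 'a) \<Rightarrow> 'm \<Rightarrow> 'a set" where
  "rel_null_space S g D A \<phi> p =
     {X \<in> tangent_plane A \<phi> p. \<forall>Y\<in>tangent_plane A \<phi> p. second_ff S g D A \<phi> p X Y = 0}"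

definition positive_relative_nullity ::
  "'a::euclidean_space set \<Rightarrow> ('a \<Rightarrow> 'a \<Rightarrow> 'a \<Rightarrow> real) \<Rightarrow> ('a \<Rightarrow> 'a \<Rightarrow> ('a \<Rightarrow> 'a) \<Rightarrow> 'a) \<Rightarrow>
   ('m::topological_space set \<times> ('m \<Rightarrow> real^2)) set \<Rightarrow> ('m \<Rightarrow> 'a) \<Rightarrow> bool" where
  "positive_relative_nullity S g D A \<phi> \<longleftrightarrow> (\<forall>p. dim (rel_null_space S g D A \<phi> p) > 0)"

definition smooth_line_distribution ::
  "('m::topological_space set \<times> ('m \<Rightarrow> real^2)) set \<Rightarrow> ('m \<Rightarrow> 'a::euclidean_space) \<Rightarrow> ('m \<Rightarrow> 'a set) \<Rightarrow> bool" where
  "smooth_line_distribution A \<phi> N \<longleftrightarrow> (\<forall>p. \<exists>U X. open U \<and> p \<in> U \<and> tangent_field_on A \<phi> U X \<and>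
     (\<forall>q\<in>U. X q \<noteq> 0 \<and> N q = span {X q}))"

section \<open>Robertson-Walker space-times\<close>

text \<open>The space form of curvature \<open>c\<close> in \<open>R \<times> R\<^sup>3\<close> carries the metric induced by
  \<open>c a b + x \<bullet> y\<close>. This is the unit sphere with the Euclidean metric for \<open>c = 1\<close>, the affine
  hyperplane \<open>{1} \<times> R\<^sup>3\<close> for \<open>c = 0\<close> and the upper sheet of the hyperboloid in Minkowski
  space for \<open>c = -1\<close>.\<close>
definition space_form :: "real \<Rightarrow> (real \<times> (real^3)) set" where
  "space_form c = {(a, x). a\<^sup>2 + c * (x \<bullet> x) = 1 \<and> (c \<le> 0 \<longrightarrow> a > 0)}"

definition space_form_metric :: "real \<Rightarrow> real \<times> (real^3) \<Rightarrow> real \<times> (real^3) \<Rightarrow> real" where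
  "space_form_metric c v w = c * fst v * fst w + snd v \<bullet> snd w"

lemma space_form_sphere: "space_form 1 = sphere 0 1"
  by (auto simp: space_form_def norm_Pair power2_norm_eq_inner)

lemma space_form_metric_sphere: "space_form_metric 1 v w = v \<bullet> w"
  by (simp add: space_form_metric_def inner_prod_def)

lemma space_form_flat: "space_form 0 = {1} \<times> UNIV"
  by (auto simp: space_form_def power2_eq_1_iff)

lemma space_form_hyperbolic:
  "space_form (-1) = {v. space_form_metric (-1) v v = -1 \<and> fst v > 0}"
  by (auto simp: space_form_def space_form_metric_def power2_eq_square)

text \<open>A point of the space-time is a triple \<open>(t, a, x)\<close> with \<open>(a, x)\<close> in the space form.\<close>
type_synonym rw_point = "real \<times> real \<times> (real^3)"

definition rw_space :: "real set \<Rightarrow> real \<Rightarrow> rw_point set" where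
  "rw_space I c = I \<times> space_form c"

definition rw_metric ::
  "(real \<Rightarrow> real) \<Rightarrow> real \<Rightarrow> rw_point \<Rightarrow> rw_point \<Rightarrow> rw_point \<Rightarrow> real" where
  "rw_metric f c p v w =
     - (fst v * fst w) + (f (fst p))\<^sup>2 * space_form_metric c (snd v) (snd w)"

definition ddt :: "rw_point" where
  "ddt = (1, 0)"

definition orthonormal_frame_on ::
  "'a::euclidean_space set \<Rightarrow> ('a \<Rightarrow> 'a \<Rightarrow> 'a \<Rightarrow> real) \<Rightarrow>
   ('m::topological_space set \<times> ('m \<Rightarrow> real^2)) set \<Rightarrow> ('m \<Rightarrow> 'a) \<Rightarrow> 'm set \<Rightarrow>
   ('m \<Rightarrow> 'a) \<Rightarrow> ('m \<Rightarrow> 'a) \<Rightarrow> ('m \<Rightarrow> 'a) \<Rightarrow> ('m \<Rightarrow> 'a) \<Rightarrow> bool" where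
  "orthonormal_frame_on S g A \<phi> U e1 e2 e3 e4 \<longleftrightarrow>
     tangent_field_on A \<phi> U e1 \<and> tangent_field_on A \<phi> U e2 \<and>
     msmooth_on A U e3 \<and> msmooth_on A U e4 \<and>
     (\<forall>p\<in>U. e3 p \<in> normal_space S g A \<phi> p \<and> e4 p \<in> normal_space S g A \<phi> p \<and>
        g (\<phi> p) (e1 p) (e1 p) = 1 \<and> g (\<phi> p) (e2 p) (e2 p) = 1 \<and> g (\<phi> p) (e1 p) (e2 p) = 0 \<and>
        g (\<phi> p) (e3 p) (e3 p) = -1 \<and> g (\<phi> p) (e4 p) (e4 p) = 1 \<and> g (\<phi> p) (e3 p) (e4 p) = 0)"

end

theory Submission
  imports Defs
begin

text \<open>
  Koszul's argument identifies the given connection with explicit Christoffel symbols, so that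
  covariant derivatives along the surface and the curvature of the space-time become formulas in the
  ambient vector space. Write \<open>h(X, Y) = -h\<^sup>3(X, Y) e\<^sub>3 + h\<^sup>4(X, Y) e\<^sub>4\<close>.

  Let \<open>Z\<close> span the relative null spaces and let \<open>Y\<close> be tangent and orthogonal to \<open>Z\<close>. The Codazzi equation for
  \<open>(R(Z, Y)Z)\<^sup>\<bottom>\<close> says that \<open>\<langle>\<nabla>\<^sub>Z Z, Y\<rangle> h(Y, Y)\<close> is proportional to \<open>\<langle>Y, T\<rangle> e\<^sub>3\<close>, the factor being nonzero by assumption (i).
  If \<open>\<langle>Y, T\<rangle> \<noteq> 0\<close> at a point, then \<open>h\<^sup>4 = 0\<close> near it; differentiating \<open>\<langle>e\<^sub>4, \<partial>\<^sub>t\<rangle> = 0\<close> shows that \<open>e\<^sub>4\<close> is then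
  parallel, so \<open>f e\<^sub>4\<close> is a constant vector \<open>\<zeta>\<close> of the ambient space and the surface lies in a totally
  geodesic hypersurface \<open>\<langle>\<zeta>, x\<rangle> = k\<close>, against assumption (iv). So \<open>T\<close> is a null direction, and the equations
  follow by differentiating \<open>\<partial>\<^sub>t = sinh \<theta> e\<^sub>1 + cosh \<theta> e\<^sub>3\<close>.
\<close>

section \<open>Calculus of smooth maps\<close>

text \<open>The quantity in assumption (i) is the difference of the curvatures of planes containing
  \<open>ddt\<close> and planes orthogonal to it, so the assumption excludes constant curvature. In
  the Codazzi equation it multiplies the time components of \<open>Y\<close> and of the normal
  vector. Since \<open>e4\<close> is orthogonal to \<open>ddt\<close> and \<open>e3\<close> is not,
  the \<open>e3\<close> component shows that the derivative of \<open>Z\<close> along itself has a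
  nonzero component along \<open>Y\<close>, and the \<open>e4\<close> component can then be divided
  by it. Smoothness of the null distribution is what allows \<open>Z\<close> to be differentiated.
  That \<open>e1\<close> is null does not yet make its integral curves geodesic: the missing
  coefficient comes from \<open>e2\<close> being orthogonal to \<open>ddt\<close>, divided by
  \<open>sinh \<theta>\<close>. Conversely, the equations for \<open>e3\<close> and
  \<open>e4\<close> along \<open>e1\<close> say that both shape operators annihilate
  \<open>e1\<close>. \<open>cov_deriv\<close> and \<open>second_ff\<close> are definite
  descriptions, so independence of the choices in them has to be proved. The space form involves two
  bilinear forms, \<open>quadric\<close> for tangency and \<open>space_form_metric\<close> for
  lengths, which are proportional only for nonzero \<open>c\<close>; the flat case is carried along
  by factors \<open>c\<close>.\<close>

lemma frechet_derivative_cong_open: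
  assumes "open S" "x \<in> S" "\<And>y. y \<in> S \<Longrightarrow> f y = g y"
  shows "frechet_derivative f (at x) = frechet_derivative g (at x)"
proof -
  have "(f has_derivative F) (at x) \<longleftrightarrow> (g has_derivative F) (at x)" for F
    using has_derivative_transform_within_open[OF _ assms(1,2)] assms(3) by metis
  then show ?thesis by (simp add: frechet_derivative_def)
qed

lemma differentiable_cong_open:
  assumes "open S" "x \<in> S" "\<And>y. y \<in> S \<Longrightarrow> f y = g y"
  shows "f differentiable (at x) \<longleftrightarrow> g differentiable (at x)"
proof -
  have "(f has_derivative F) (at x) \<longleftrightarrow> (g has_derivative F) (at x)" for F
    using has_derivative_transform_within_open[OF _ assms(1,2)] assms(3) by metis
  then show ?thesis by (simp add: differentiable_def)
qed

lemma Ck_on_cong: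
  assumes "open S" "\<And>x. x \<in> S \<Longrightarrow> f x = g x"
  shows "Ck_on k S f \<longleftrightarrow> Ck_on k S g"
  using assms(2)
proof (induction k arbitrary: f g)
  case 0
  then show ?case by (simp cong: continuous_on_cong)
next
  case (Suc k)
  have "Ck_on k S (\<lambda>x. frechet_derivative f (at x) v) \<longleftrightarrow> Ck_on k S (\<lambda>x. frechet_derivative g (at x) v)" for v
    by (intro Suc.IH) (simp add: frechet_derivative_cong_open[OF assms(1) _ Suc.prems])
  then show ?case
    using differentiable_cong_open[OF assms(1) _ Suc.prems] by auto
qed

lemma smooth_on_cong:
  assumes "open S" "\<And>x. x \<in> S \<Longrightarrow> f x = g x"
  shows "smooth_on S f \<longleftrightarrow> smooth_on S g"
  using Ck_on_cong[OF assms] by (simp add: smooth_on_def)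

lemma Ck_on_subset: "Ck_on k S f \<Longrightarrow> T \<subseteq> S \<Longrightarrow> Ck_on k T f"
  by (induction k arbitrary: f) (auto intro: continuous_on_subset)

lemma smooth_on_subset: "smooth_on S f \<Longrightarrow> T \<subseteq> S \<Longrightarrow> smooth_on T f"
  by (simp add: smooth_on_def Ck_on_subset[of _ S f T])

lemma Ck_on_Suc_imp: "Ck_on (Suc k) S f \<Longrightarrow> Ck_on k S f"
proof (induction k arbitrary: f)
  case 0
  then show ?case
    by (auto intro!: differentiable_imp_continuous_on differentiable_at_imp_differentiable_on)
next
  case (Suc k)
  then show ?case by simp
qed

lemma smooth_on_differentiable: "smooth_on S f \<Longrightarrow> x \<in> S \<Longrightarrow> f differentiable (at x)"
  unfolding smooth_on_def using Ck_on.simps(2) by blast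

lemma smooth_on_has_derivative:
  "smooth_on S f \<Longrightarrow> x \<in> S \<Longrightarrow> (f has_derivative frechet_derivative f (at x)) (at x)"
  using smooth_on_differentiable frechet_derivative_works by blast

lemma smooth_on_continuous_on: "smooth_on S f \<Longrightarrow> continuous_on S f"
  unfolding smooth_on_def using Ck_on.simps(1) by blast

lemma smooth_on_frechet_derivative:
  "smooth_on S f \<Longrightarrow> smooth_on S (\<lambda>x. frechet_derivative f (at x) v)"
  unfolding smooth_on_def using Ck_on.simps(2) by blast

text \<open>Inductions can thus offer an explicit derivative; it agrees with the one chosen by
  \<open>frechet_derivative\<close> by uniqueness, and openness of \<open>S\<close> lets the
  agreement carry over to higher derivatives.\<close>

lemma Ck_on_SucI:
  assumes "open S" "\<And>x. x \<in> S \<Longrightarrow> (f has_derivative f' x) (at x)" "\<And>v. Ck_on k S (\<lambda>x. f' x v)"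
  shows "Ck_on (Suc k) S f"
proof -
  have "f' x = frechet_derivative f (at x)" if "x \<in> S" for x
    using assms(2)[OF that] frechet_derivative_at by blast
  then have "Ck_on k S (\<lambda>x. frechet_derivative f (at x) v)" for v
    using assms(3)[of v] Ck_on_cong[OF assms(1), of "\<lambda>x. f' x v"] by simp
  then show ?thesis using assms(2) by (auto simp: differentiable_def)
qed

lemma Ck_on_const: "Ck_on k S (\<lambda>x. a)"
  by (induction k arbitrary: a) (auto simp: frechet_derivative_const)

lemma Ck_on_has_derivative:
  "Ck_on (Suc k) S f \<Longrightarrow> x \<in> S \<Longrightarrow> (f has_derivative frechet_derivative f (at x)) (at x)"
  using frechet_derivative_works by auto

lemma Ck_on_bounded_linear:
  assumes "open S" "bounded_linear L" "Ck_on k S f"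
  shows "Ck_on k S (\<lambda>x. L (f x))"
  using assms(3)
proof (induction k arbitrary: f)
  case 0
  then show ?case
    by (simp add: bounded_linear.continuous_on[OF assms(2)])
next
  case (Suc k)
  show ?case
  proof (rule Ck_on_SucI[OF assms(1)])
    show "((\<lambda>x. L (f x)) has_derivative (\<lambda>v. L (frechet_derivative f (at x) v))) (at x)" if "x \<in> S" for x
      by (rule bounded_linear.has_derivative[OF assms(2) Ck_on_has_derivative[OF Suc.prems that]])
    show "Ck_on k S (\<lambda>x. L (frechet_derivative f (at x) v))" for v
      using Suc by simp
  qed
qed

lemma Ck_on_add:
  assumes "open S" "Ck_on k S f" "Ck_on k S g"
  shows "Ck_on k S (\<lambda>x. f x + g x)"
  using assms(2,3)
proof (induction k arbitrary: f g)
  case 0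
  then show ?case by (simp add: continuous_on_add)
next
  case (Suc k)
  show ?case
  proof (rule Ck_on_SucI[OF assms(1)])
    show "((\<lambda>x. f x + g x) has_derivative
        (\<lambda>v. frechet_derivative f (at x) v + frechet_derivative g (at x) v)) (at x)" if "x \<in> S" for x
      by (intro has_derivative_add Ck_on_has_derivative[OF Suc.prems(1) that] Ck_on_has_derivative[OF Suc.prems(2) that])
    show "Ck_on k S (\<lambda>x. frechet_derivative f (at x) v + frechet_derivative g (at x) v)" for v
      using Suc by simp
  qed
qed

lemma Ck_on_sum:
  assumes "open S" "\<And>i. i \<in> B \<Longrightarrow> Ck_on k S (f i)"
  shows "Ck_on k S (\<lambda>x. \<Sum>i\<in>B. f i x)"
  using assms(2)
  by (induction B rule: infinite_finite_induct) (auto intro!: Ck_on_const Ck_on_add assms(1))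

lemma Ck_on_bilinear:
  assumes "open S" "bounded_bilinear pr" "Ck_on k S f" "Ck_on k S g"
  shows "Ck_on k S (\<lambda>x. pr (f x) (g x))"
  using assms(3,4)
proof (induction k arbitrary: f g)
  case 0
  then show ?case by (simp add: bounded_bilinear.continuous_on[OF assms(2)])
next
  case (Suc k)
  show ?case
  proof (rule Ck_on_SucI[OF assms(1)])
    show "((\<lambda>x. pr (f x) (g x)) has_derivative
        (\<lambda>v. pr (f x) (frechet_derivative g (at x) v) + pr (frechet_derivative f (at x) v) (g x))) (at x)"
      if "x \<in> S" for x
      by (intro bounded_bilinear.FDERIV[OF assms(2)] Ck_on_has_derivative[OF Suc.prems(1) that]
          Ck_on_has_derivative[OF Suc.prems(2) that])
    show "Ck_on k S (\<lambda>x. pr (f x) (frechet_derivative g (at x) v) + pr (frechet_derivative f (at x) v) (g x))" for v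
      using Suc.prems Ck_on_Suc_imp[OF Suc.prems(1)] Ck_on_Suc_imp[OF Suc.prems(2)]
      by (intro Ck_on_add[OF assms(1)] Suc.IH) simp_all
  qed
qed

text \<open>By the chain rule the derivative is that of \<open>g\<close> at \<open>f x\<close> in a
  direction which itself depends on \<open>x\<close>, whereas \<open>Ck_on\<close> only speaks of
  fixed directions. Expanding the direction in the finite basis of the middle space gives a sum of
  products, each with a derivative of \<open>g\<close> composed with \<open>f\<close>, which the
  induction hypothesis covers.\<close>

lemma Ck_on_compose:
  fixes f :: "'a::real_normed_vector \<Rightarrow> 'b::euclidean_space"
  assumes "open S" "open T" "f ` S \<subseteq> T" "Ck_on k S f" "Ck_on k T g"
  shows "Ck_on k S (\<lambda>x. g (f x))"
  using assms(4,5)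
proof (induction k arbitrary: g)
  case 0
  then show ?case using assms(3) by (auto intro: continuous_on_compose2)
next
  case (Suc k)
  show ?case
  proof (rule Ck_on_SucI[OF assms(1)])
    let ?F = "\<lambda>x v. \<Sum>b\<in>Basis. (frechet_derivative f (at x) v \<bullet> b) *\<^sub>R frechet_derivative g (at (f x)) b"
    show "((\<lambda>x. g (f x)) has_derivative ?F x) (at x)" if "x \<in> S" for x
    proof -
      have f: "(f has_derivative frechet_derivative f (at x)) (at x)"
        by (rule Ck_on_has_derivative[OF Suc.prems(1) that])
      have g: "(g has_derivative frechet_derivative g (at (f x))) (at (f x))"
        using Ck_on_has_derivative[OF Suc.prems(2)] that assms(3) by blast
      interpret g: bounded_linear "frechet_derivative g (at (f x))"
        by (rule has_derivative_bounded_linear[OF g])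
      have "(\<Sum>b\<in>Basis. (w \<bullet> b) *\<^sub>R frechet_derivative g (at (f x)) b) = frechet_derivative g (at (f x)) w" for w
        using g.sum[of "\<lambda>b. (w \<bullet> b) *\<^sub>R b" Basis] by (simp add: g.scaleR euclidean_representation)
      then show ?thesis
        using has_derivative_compose[OF f g] by simp
    qed
    have "Ck_on k S (\<lambda>x. frechet_derivative g (at (f x)) b)" for b
      by (rule Suc.IH[OF Ck_on_Suc_imp[OF Suc.prems(1)]]) (use Suc.prems(2) in simp)
    then show "Ck_on k S (\<lambda>x. ?F x v)" for v
      using Suc.prems
      by (intro Ck_on_sum Ck_on_bilinear[OF assms(1) bounded_bilinear_scaleR]
            Ck_on_bounded_linear[OF assms(1) bounded_linear_inner_left] assms(1)) simp_all
  qed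
qed

text \<open>The derivative is a polynomial in \<open>inverse\<close> itself, so the induction
  hypothesis applies to it directly.\<close>

lemma Ck_on_inverse: "Ck_on k (-{0::real}) inverse"
proof (induction k)
  case 0
  then show ?case by (simp add: continuous_on_inverse)
next
  case (Suc k)
  have S: "open (-{0::real})" by (simp add: open_Compl)
  show ?case
  proof (rule Ck_on_SucI[OF S])
    show "(inverse has_derivative (\<lambda>v. - (inverse x * v * inverse x))) (at x)" if "x \<in> -{0::real}" for x
      using that by (intro has_derivative_inverse') simp
    show "Ck_on k (-{0::real}) (\<lambda>x. - (inverse x * v * inverse x))" for v
      by (intro Ck_on_bounded_linear[OF S bounded_linear_minus[OF bounded_linear_ident]]
          Ck_on_bilinear[OF S bounded_bilinear_mult] Ck_on_const Suc)
  qed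
qed

lemma smooth_on_const: "smooth_on S (\<lambda>x. a)"
  by (simp add: smooth_on_def Ck_on_const)

lemma smooth_on_bounded_linear:
  "open S \<Longrightarrow> bounded_linear L \<Longrightarrow> smooth_on S f \<Longrightarrow> smooth_on S (\<lambda>x. L (f x))"
  by (simp add: smooth_on_def Ck_on_bounded_linear)

lemma smooth_on_add: "open S \<Longrightarrow> smooth_on S f \<Longrightarrow> smooth_on S g \<Longrightarrow> smooth_on S (\<lambda>x. f x + g x)"
  by (simp add: smooth_on_def Ck_on_add)

lemma smooth_on_bilinear:
  "open S \<Longrightarrow> bounded_bilinear pr \<Longrightarrow> smooth_on S f \<Longrightarrow> smooth_on S g \<Longrightarrow> smooth_on S (\<lambda>x. pr (f x) (g x))"
  by (simp add: smooth_on_def Ck_on_bilinear)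

lemma smooth_on_compose:
  fixes f :: "'a::real_normed_vector \<Rightarrow> 'b::euclidean_space"
  shows "open S \<Longrightarrow> open T \<Longrightarrow> f ` S \<subseteq> T \<Longrightarrow> smooth_on S f \<Longrightarrow> smooth_on T g \<Longrightarrow> smooth_on S (\<lambda>x. g (f x))"
  by (simp add: smooth_on_def Ck_on_compose)

lemma smooth_on_inverse:
  fixes f :: "'a::real_normed_vector \<Rightarrow> real"
  assumes "open S" "smooth_on S f" "\<And>x. x \<in> S \<Longrightarrow> f x \<noteq> 0"
  shows "smooth_on S (\<lambda>x. inverse (f x))"
proof (rule smooth_on_compose[OF assms(1) _ _ assms(2)])
  show "open (-{0::real})" by (simp add: open_Compl)
  show "smooth_on (-{0::real}) inverse" by (simp add: smooth_on_def Ck_on_inverse)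
qed (use assms(3) in auto)

lemma smooth_on_ident: "open S \<Longrightarrow> smooth_on S (\<lambda>x. x)"
proof -
  assume S: "open S"
  have "Ck_on k S (\<lambda>x. x)" for k
  proof (cases k)
    case (Suc n)
    show ?thesis unfolding Suc
      by (rule Ck_on_SucI[OF S, where f' = "\<lambda>x v. v"]) (auto intro: Ck_on_const)
  qed (simp add: continuous_on_id)
  then show ?thesis by (simp add: smooth_on_def)
qed

lemma smooth_on_deriv:
  assumes "open S" "smooth_on S (f :: real \<Rightarrow> real)"
  shows "smooth_on S (deriv f)"
proof -
  have "frechet_derivative f (at x) 1 = deriv f x" if "x \<in> S" for x
  proof -
    have "f field_differentiable (at x)"
      using smooth_on_differentiable[OF assms(2) that] real_differentiable_def field_differentiable_def by blast
    then have "(f has_field_derivative deriv f x) (at x)"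
      by (simp add: field_differentiable_derivI)
    then have "(f has_derivative (\<lambda>h. h * deriv f x)) (at x)"
      by (simp add: has_field_derivative_def mult_commute_abs)
    then have "frechet_derivative f (at x) = (\<lambda>h. h * deriv f x)"
      using frechet_derivative_at by metis
    then show ?thesis by simp
  qed
  from smooth_on_cong[OF assms(1) this] show ?thesis
    using smooth_on_frechet_derivative[OF assms(2), of 1] by simp
qed

lemma smooth_on_has_real_derivative:
  assumes "smooth_on S (f :: real \<Rightarrow> real)" "x \<in> S"
  shows "(f has_real_derivative deriv f x) (at x)"
  using smooth_on_differentiable[OF assms] DERIV_deriv_iff_real_differentiable by blast

section \<open>Symmetry of the second derivative\<close>

lemma second_difference_mean_value:
  fixes f :: "'a::real_normed_vector \<Rightarrow> real"
  assumes "open S" "Ck_on (Suc (Suc 0)) S f" "s > 0"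
    and seg: "\<And>a b. 0 \<le> a \<Longrightarrow> a \<le> s \<Longrightarrow> 0 \<le> b \<Longrightarrow> b \<le> s \<Longrightarrow> x + a *\<^sub>R v + b *\<^sub>R w \<in> S"
  shows "\<exists>a b. 0 < a \<and> a < s \<and> 0 < b \<and> b < s \<and>
    f (x + s *\<^sub>R v + s *\<^sub>R w) - f (x + s *\<^sub>R v) - f (x + s *\<^sub>R w) + f x =
      s * s * frechet_derivative (\<lambda>y. frechet_derivative f (at y) v) (at (x + a *\<^sub>R v + b *\<^sub>R w)) w"
proof -
  let ?fv = "\<lambda>y. frechet_derivative f (at y) v"
  have df: "(f has_derivative frechet_derivative f (at y)) (at y)" if "y \<in> S" for y
    by (rule Ck_on_has_derivative[OF assms(2) that])
  have fv: "Ck_on (Suc 0) S ?fv" using assms(2) Ck_on.simps(2) by blast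
  have dfv: "(?fv has_derivative frechet_derivative ?fv (at y)) (at y)" if "y \<in> S" for y
    by (rule Ck_on_has_derivative[OF fv that])
  have d1: "((\<lambda>a. f (x + a *\<^sub>R v + b *\<^sub>R w)) has_real_derivative ?fv (x + a *\<^sub>R v + b *\<^sub>R w)) (at a)"
    if "0 \<le> a" "a \<le> s" "0 \<le> b" "b \<le> s" for a b
  proof -
    interpret F: bounded_linear "frechet_derivative f (at (x + a *\<^sub>R v + b *\<^sub>R w))"
      by (rule has_derivative_bounded_linear[OF df[OF seg[OF that]]])
    have "((\<lambda>a. x + a *\<^sub>R v + b *\<^sub>R w) has_derivative (\<lambda>h. h *\<^sub>R v)) (at a)"
      by (auto intro!: derivative_eq_intros)
    from has_derivative_compose[OF this df[OF seg[OF that]]]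
    show ?thesis by (simp add: has_field_derivative_def F.scaleR mult_commute_abs)
  qed
  have d2: "((\<lambda>b. ?fv (x + a *\<^sub>R v + b *\<^sub>R w)) has_real_derivative
      frechet_derivative ?fv (at (x + a *\<^sub>R v + b *\<^sub>R w)) w) (at b)"
    if "0 \<le> a" "a \<le> s" "0 \<le> b" "b \<le> s" for a b
  proof -
    interpret F: bounded_linear "frechet_derivative ?fv (at (x + a *\<^sub>R v + b *\<^sub>R w))"
      by (rule has_derivative_bounded_linear[OF dfv[OF seg[OF that]]])
    have "((\<lambda>b. x + a *\<^sub>R v + b *\<^sub>R w) has_derivative (\<lambda>h. h *\<^sub>R w)) (at b)"
      by (auto intro!: derivative_eq_intros)
    from has_derivative_compose[OF this dfv[OF seg[OF that]]]
    show ?thesis by (simp add: has_field_derivative_def F.scaleR mult_commute_abs)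
  qed
  \<comment> \<open>The difference in direction \<open>w\<close> as a function of the coefficient of
    \<open>v\<close>. The summand \<open>0 *\<^sub>R w\<close> is kept, and its simplification
    switched off below, so that both terms are instances of \<open>d1\<close>.\<close>
  let ?G = "\<lambda>a. f (x + a *\<^sub>R v + s *\<^sub>R w) - f (x + a *\<^sub>R v + 0 *\<^sub>R w)"
  have "\<exists>a. 0 < a \<and> a < s \<and> ?G s - ?G 0 = (s - 0) *
      (?fv (x + a *\<^sub>R v + s *\<^sub>R w) - ?fv (x + a *\<^sub>R v + 0 *\<^sub>R w))"
    using assms(3) by (intro MVT2) (auto intro!: DERIV_diff d1 simp del: scale_zero_left)
  then obtain a where a: "0 < a" "a < s" "?G s - ?G 0 = s *
      (?fv (x + a *\<^sub>R v + s *\<^sub>R w) - ?fv (x + a *\<^sub>R v + 0 *\<^sub>R w))" by auto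
  have "\<exists>b. 0 < b \<and> b < s \<and> ?fv (x + a *\<^sub>R v + s *\<^sub>R w) - ?fv (x + a *\<^sub>R v + 0 *\<^sub>R w) = (s - 0) *
      frechet_derivative ?fv (at (x + a *\<^sub>R v + b *\<^sub>R w)) w"
    using assms(3) a by (intro MVT2) (auto intro!: d2 simp del: scale_zero_left)
  then obtain b where b: "0 < b" "b < s" "?fv (x + a *\<^sub>R v + s *\<^sub>R w) - ?fv (x + a *\<^sub>R v + 0 *\<^sub>R w) = s *
      frechet_derivative ?fv (at (x + a *\<^sub>R v + b *\<^sub>R w)) w" by auto
  show ?thesis
  proof (intro exI conjI)
    show "f (x + s *\<^sub>R v + s *\<^sub>R w) - f (x + s *\<^sub>R v) - f (x + s *\<^sub>R w) + f x =
      s * s * frechet_derivative ?fv (at (x + a *\<^sub>R v + b *\<^sub>R w)) w"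
      using a(3) unfolding b(3) by (simp add: algebra_simps)
  qed (use a b in auto)
qed

text \<open>The second difference over the parallelogram with sides \<open>s *\<^sub>R v\<close> and
  \<open>s *\<^sub>R w\<close> is symmetric in the two vectors. Two uses of the mean value theorem
  write it as \<open>s * s\<close> times either mixed derivative at some point of the parallelogram;
  by continuity the mixed derivatives at \<open>x\<close> differ by at most any given
  \<open>e\<close>.\<close>

lemma symmetric_second_derivative_real:
  fixes f :: "'a::real_normed_vector \<Rightarrow> real"
  assumes S: "open S" "x \<in> S" and f: "smooth_on S f"
  shows "frechet_derivative (\<lambda>y. frechet_derivative f (at y) v) (at x) w =
    frechet_derivative (\<lambda>y. frechet_derivative f (at y) w) (at x) v"
proof -
  let ?F = "\<lambda>v w x. frechet_derivative (\<lambda>y. frechet_derivative f (at y) v) (at x) w"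
  have cont: "continuous_on S (?F v w)" for v w
    by (intro smooth_on_continuous_on smooth_on_frechet_derivative f)
  have ck: "Ck_on (Suc (Suc 0)) S f" using f by (simp only: smooth_on_def)
  have "\<bar>?F v w x - ?F w v x\<bar> \<le> e" if "e > 0" for e
  proof -
    have "\<exists>d>0. \<forall>y. dist y x < d \<longrightarrow> y \<in> S \<and> dist (?F v w y) (?F v w x) < e/2 \<and> dist (?F w v y) (?F w v x) < e/2"
    proof -
      have "\<forall>\<^sub>F y in nhds x. y \<in> S"
        using S by (simp add: eventually_nhds_in_open)
      moreover have "\<forall>\<^sub>F y in nhds x. dist (?F v w y) (?F v w x) < e/2" for v w
      proof -
        have "isCont (?F v w) x" using cont S continuous_on_eq_continuous_at by blast
        then have "filterlim (?F v w) (nhds (?F v w x)) (nhds x)"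
          unfolding isCont_def by (rule tendsto_at_iff_tendsto_nhds[THEN iffD1])
        then show ?thesis using that by (intro tendstoD) auto
      qed
      ultimately have "\<forall>\<^sub>F y in nhds x. y \<in> S \<and> dist (?F v w y) (?F v w x) < e/2 \<and> dist (?F w v y) (?F w v x) < e/2"
        by (intro eventually_conj)
      then show ?thesis by (simp add: eventually_nhds_metric)
    qed
    then obtain d where d: "d > 0" "\<And>y. dist y x < d \<Longrightarrow> y \<in> S"
      "\<And>y. dist y x < d \<Longrightarrow> dist (?F v w y) (?F v w x) < e/2"
      "\<And>y. dist y x < d \<Longrightarrow> dist (?F w v y) (?F w v x) < e/2" by blast
    \<comment> \<open>The summand 1 makes \<open>m\<close> positive also for
      \<open>v = w = 0\<close>; with this \<open>s\<close> the whole parallelogram stays within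
      distance \<open>d\<close> of \<open>x\<close>.\<close>
    define m where "m = norm v + norm w + 1"
    define s where "s = d / (2 * m)"
    have n: "m > 0" by (simp add: m_def add_nonneg_pos)
    have s: "s > 0" using d(1) n by (simp add: s_def)
    have sd: "s * (norm v + norm w) < d"
    proof -
      have "s * (norm v + norm w) \<le> s * m" using s by (intro mult_left_mono) (auto simp: m_def)
      also have "\<dots> = d / 2" using n by (simp add: s_def)
      finally show ?thesis using d(1) by simp
    qed
    have seg: "dist (x + a *\<^sub>R v + b *\<^sub>R w) x < d" if "0 \<le> a" "a \<le> s" "0 \<le> b" "b \<le> s" for a b
    proof -
      have "dist (x + a *\<^sub>R v + b *\<^sub>R w) x = norm (a *\<^sub>R v + b *\<^sub>R w)" by (simp add: dist_norm)
      also have "\<dots> \<le> a * norm v + b * norm w"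
        using that norm_triangle_ineq[of "a *\<^sub>R v" "b *\<^sub>R w"] by simp
      also have "\<dots> \<le> s * norm v + s * norm w"
        using that by (intro add_mono mult_right_mono) auto
      also have "\<dots> < d" using sd by (simp add: algebra_simps)
      finally show ?thesis .
    qed
    let ?\<Delta> = "f (x + s *\<^sub>R v + s *\<^sub>R w) - f (x + s *\<^sub>R v) - f (x + s *\<^sub>R w) + f x"
    obtain a b where ab: "0 < a" "a < s" "0 < b" "b < s" "?\<Delta> = s * s * ?F v w (x + a *\<^sub>R v + b *\<^sub>R w)"
      using second_difference_mean_value[OF S(1) ck s, of x v w] seg d(2) by blast
    have "x + a *\<^sub>R w + b *\<^sub>R v \<in> S" if "0 \<le> a" "a \<le> s" "0 \<le> b" "b \<le> s" for a b
      using d(2)[OF seg[OF that(3,4,1,2)]] by (simp add: algebra_simps)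
    then obtain a' b' where ab': "0 < a'" "a' < s" "0 < b'" "b' < s"
      "f (x + s *\<^sub>R w + s *\<^sub>R v) - f (x + s *\<^sub>R w) - f (x + s *\<^sub>R v) + f x = s * s * ?F w v (x + a' *\<^sub>R w + b' *\<^sub>R v)"
      using second_difference_mean_value[OF S(1) ck s, of x w v] by blast
    have "?F v w (x + a *\<^sub>R v + b *\<^sub>R w) = ?F w v (x + a' *\<^sub>R w + b' *\<^sub>R v)"
      using ab(5) ab'(5) s by (simp add: algebra_simps)
    moreover have "dist (?F v w (x + a *\<^sub>R v + b *\<^sub>R w)) (?F v w x) < e/2"
      by (rule d(3)[OF seg]) (use ab in auto)
    moreover have "dist (?F w v (x + a' *\<^sub>R w + b' *\<^sub>R v)) (?F w v x) < e/2"
      using d(4)[OF seg[of b' a']] ab' by (simp add: algebra_simps)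
    ultimately show ?thesis unfolding dist_real_def by linarith
  qed
  then have "\<bar>?F v w x - ?F w v x\<bar> \<le> 0" by (rule field_le_epsilon[of _ 0, simplified])
  then show ?thesis by simp
qed

lemma symmetric_second_derivative:
  fixes f :: "'a::real_normed_vector \<Rightarrow> 'b::euclidean_space"
  assumes S: "open S" "x \<in> S" and f: "smooth_on S f"
  shows "frechet_derivative (\<lambda>y. frechet_derivative f (at y) v) (at x) w =
    frechet_derivative (\<lambda>y. frechet_derivative f (at y) w) (at x) v"
proof (rule euclidean_eqI)
  fix b :: 'b
  have fd: "frechet_derivative (\<lambda>y. h y \<bullet> b) (at y) = (\<lambda>v. frechet_derivative h (at y) v \<bullet> b)"
    if "smooth_on S h" "y \<in> S" for h y
    using has_derivative_inner_left[OF smooth_on_has_derivative[OF that]] frechet_derivative_at by metis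
  have 2: "frechet_derivative (\<lambda>y. frechet_derivative f (at y) v) (at x) w \<bullet> b
    = frechet_derivative (\<lambda>y. frechet_derivative (\<lambda>y. f y \<bullet> b) (at y) v) (at x) w" for v w
  proof -
    have "frechet_derivative (\<lambda>y. frechet_derivative (\<lambda>y. f y \<bullet> b) (at y) v) (at x)
      = frechet_derivative (\<lambda>y. frechet_derivative f (at y) v \<bullet> b) (at x)"
      by (rule frechet_derivative_cong_open[OF S]) (simp add: fd[OF f])
    then show ?thesis by (simp add: fd[OF smooth_on_frechet_derivative[OF f] S(2)])
  qed
  show "frechet_derivative (\<lambda>y. frechet_derivative f (at y) v) (at x) w \<bullet> b =
    frechet_derivative (\<lambda>y. frechet_derivative f (at y) w) (at x) v \<bullet> b"
    unfolding 2
    by (intro symmetric_second_derivative_real[OF S] smooth_on_bounded_linear[OF S(1) bounded_linear_inner_left] f)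
qed

section \<open>Differentiation along an immersed surface\<close>

lemma real2_expansion: "(v :: real^2) = v $ 1 *\<^sub>R axis 1 1 + v $ 2 *\<^sub>R axis 2 1"
  by (simp add: vec_eq_iff forall_2 axis_def)

text \<open>Written with \<open>+ -\<close> and \<open>inverse\<close> because smoothness of these
  very expressions is later derived from the rules for sums, negation, products and
  inverses.\<close>

lemma cramer_2:
  fixes s t g11 g12 g22 :: real
  assumes "g11 * g22 + - (g12 * g12) \<noteq> 0"
  shows "(g22 * (s * g11 + t * g12) + - (g12 * (s * g12 + t * g22))) * inverse (g11 * g22 + - (g12 * g12)) = s"
    and "(g11 * (s * g12 + t * g22) + - (g12 * (s * g11 + t * g12))) * inverse (g11 * g22 + - (g12 * g12)) = t"
proof -
  have "g22 * (s * g11 + t * g12) + - (g12 * (s * g12 + t * g22)) = s * (g11 * g22 + - (g12 * g12))"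
    "g11 * (s * g12 + t * g22) + - (g12 * (s * g11 + t * g12)) = t * (g11 * g22 + - (g12 * g12))"
    by (simp_all add: algebra_simps)
  then show "(g22 * (s * g11 + t * g12) + - (g12 * (s * g12 + t * g22))) * inverse (g11 * g22 + - (g12 * g12)) = s"
    "(g11 * (s * g12 + t * g22) + - (g12 * (s * g11 + t * g12))) * inverse (g11 * g22 + - (g12 * g12)) = t"
    using assms by (simp_all only: mult.assoc right_inverse mult_1_right not_False_eq_True)
qed

lemma gram_determinant_neq_0:
  fixes d :: "real^2 \<Rightarrow> 'a::euclidean_space"
  assumes lin: "linear d" and inj: "inj d"
  shows "(d (axis 1 1) \<bullet> d (axis 1 1)) * (d (axis 2 1) \<bullet> d (axis 2 1))
    + - ((d (axis 1 1) \<bullet> d (axis 2 1)) * (d (axis 1 1) \<bullet> d (axis 2 1))) \<noteq> 0"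
proof
  define P where "P = d (axis 1 1)"
  define Q where "Q = d (axis 2 1)"
  \<comment> \<open>The image of \<open>w\<close> is \<open>Q \<bullet> Q\<close> times the part of
    \<open>P\<close> orthogonal to \<open>Q\<close>; its squared length is
    \<open>Q \<bullet> Q\<close> times the determinant.\<close>
  define w :: "real^2" where "w = (Q \<bullet> Q) *\<^sub>R axis 1 1 - (P \<bullet> Q) *\<^sub>R axis 2 1"
  assume "(d (axis 1 1) \<bullet> d (axis 1 1)) * (d (axis 2 1) \<bullet> d (axis 2 1))
    + - ((d (axis 1 1) \<bullet> d (axis 2 1)) * (d (axis 1 1) \<bullet> d (axis 2 1))) = 0"
  then have 0: "(P \<bullet> P) * (Q \<bullet> Q) = (P \<bullet> Q) * (P \<bullet> Q)" by (simp add: P_def Q_def)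
  have dw: "d w = (Q \<bullet> Q) *\<^sub>R P - (P \<bullet> Q) *\<^sub>R Q"
    by (simp only: w_def P_def Q_def linear_diff[OF lin] linear_scale[OF lin])
  have "d w \<bullet> d w = (Q \<bullet> Q) * ((P \<bullet> P) * (Q \<bullet> Q) - (P \<bullet> Q) * (P \<bullet> Q))"
    unfolding dw by (simp add: inner_diff_left inner_diff_right inner_commute[of Q P] algebra_simps)
  then have "d w = d 0" using 0 linear_0[OF lin] by simp
  then have "w = 0" by (rule injD[OF inj])
  then have "w $ 1 = 0" by simp
  then have "Q \<bullet> Q = 0" by (simp add: w_def axis_def)
  then have "d (axis 2 1) = d 0" using linear_0[OF lin] by (simp add: Q_def)
  then have "axis 2 1 = (0::real^2)" by (rule injD[OF inj])
  then show False by (simp add: axis_eq_0_iff)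
qed

locale immersed_surface =
  fixes A :: "('m::t2_space set \<times> ('m \<Rightarrow> real^2)) set"
    and \<phi> :: "'m \<Rightarrow> 'a::euclidean_space"
  assumes atlas: "smooth_atlas A" and immersion: "immersion A \<phi>"
begin

abbreviation dir :: "'m \<Rightarrow> 'a \<Rightarrow> ('m \<Rightarrow> 'b::real_normed_vector) \<Rightarrow> 'b" where
  "dir \<equiv> dir_deriv A \<phi>"

lemma chart_open:
  assumes "(D, x) \<in> A"
  shows "open D" "open (x ` D)" "inj_on x D"
proof -
  have h: "open D" "open (x ` D)" "homeomorphism D (x ` D) x (inv_into D x)"
    using atlas assms by (auto simp: smooth_atlas_def)
  then show "open D" "open (x ` D)" "inj_on x D"
    by (auto simp: homeomorphism_def intro: inj_on_inverseI)
qed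

lemma chart_open_image:
  assumes "(D, x) \<in> A" "open U"
  shows "open (x ` (D \<inter> U))"
proof -
  have h: "homeomorphism D (x ` D) x (inv_into D x)"
    using atlas assms by (auto simp: smooth_atlas_def)
  have "openin (top_of_set (x ` D)) (x ` (D \<inter> U))"
    by (rule homeomorphism_imp_open_map[OF h]) (use assms(2) openin_open in blast)
  then show ?thesis
    using chart_open(2)[OF assms(1)] openin_open_trans by blast
qed

lemma chart_inv [simp]: "(D, x) \<in> A \<Longrightarrow> p \<in> D \<Longrightarrow> inv_into D x (x p) = p"
  by (simp add: chart_open(3))

lemma chart_at:
  assumes "chart_at A p = (D, x)"
  shows "(D, x) \<in> A" "p \<in> D"
proof -
  have "\<exists>ch. ch \<in> A \<and> p \<in> fst ch"
    using atlas unfolding smooth_atlas_def by blast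
  then have "chart_at A p \<in> A \<and> p \<in> fst (chart_at A p)"
    unfolding chart_at_def by (rule someI_ex)
  then show "(D, x) \<in> A" "p \<in> D" using assms by auto
qed

lemma msmooth_smooth_on:
  "msmooth_on A U F \<Longrightarrow> (D, x) \<in> A \<Longrightarrow> smooth_on (x ` (D \<inter> U)) (\<lambda>u. F (inv_into D x u))"
  by (auto simp: msmooth_on_def o_def)

lemma msmooth_onI:
  "(\<And>D x. (D, x) \<in> A \<Longrightarrow> smooth_on (x ` (D \<inter> U)) (\<lambda>u. F (inv_into D x u))) \<Longrightarrow> msmooth_on A U F"
  by (auto simp: msmooth_on_def o_def)

lemma msmooth_subset: "msmooth_on A U F \<Longrightarrow> V \<subseteq> U \<Longrightarrow> msmooth_on A V F"
  unfolding msmooth_on_def by (fast intro: smooth_on_subset)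

lemma msmooth_const: "msmooth_on A U (\<lambda>p. a)"
  by (intro msmooth_onI smooth_on_const)

lemma msmooth_immersion: "msmooth_on A U \<phi>"
  using immersion msmooth_subset unfolding immersion_def by blast

lemma msmooth_bounded_linear:
  assumes "open U" "bounded_linear h" "msmooth_on A U F"
  shows "msmooth_on A U (\<lambda>p. h (F p))"
  by (rule msmooth_onI, rule smooth_on_bounded_linear[OF chart_open_image[OF _ assms(1)] assms(2)
        msmooth_smooth_on[OF assms(3)]])

lemma msmooth_add:
  assumes "open U" "msmooth_on A U F" "msmooth_on A U G"
  shows "msmooth_on A U (\<lambda>p. F p + G p)"
  by (rule msmooth_onI, rule smooth_on_add[OF chart_open_image[OF _ assms(1)]
        msmooth_smooth_on[OF assms(2)] msmooth_smooth_on[OF assms(3)]])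

lemma msmooth_minus: "open U \<Longrightarrow> msmooth_on A U F \<Longrightarrow> msmooth_on A U (\<lambda>p. - F p)"
  by (rule msmooth_bounded_linear[OF _ bounded_linear_minus[OF bounded_linear_ident]])

lemma msmooth_diff:
  "open U \<Longrightarrow> msmooth_on A U F \<Longrightarrow> msmooth_on A U G \<Longrightarrow> msmooth_on A U (\<lambda>p. F p - G p)"
  using msmooth_add[of U F "\<lambda>p. - G p"] msmooth_minus[of U G] by simp

lemma msmooth_bilinear:
  assumes "open U" "bounded_bilinear pr" "msmooth_on A U F" "msmooth_on A U G"
  shows "msmooth_on A U (\<lambda>p. pr (F p) (G p))"
  by (rule msmooth_onI, rule smooth_on_bilinear[OF chart_open_image[OF _ assms(1)] assms(2)
        msmooth_smooth_on[OF assms(3)] msmooth_smooth_on[OF assms(4)]])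

lemmas msmooth_scaleR = msmooth_bilinear[OF _ bounded_bilinear_scaleR]
lemmas msmooth_mult = msmooth_bilinear[OF _ bounded_bilinear_mult]
lemmas msmooth_fst = msmooth_bounded_linear[OF _ bounded_linear_fst]
lemmas msmooth_snd = msmooth_bounded_linear[OF _ bounded_linear_snd]

lemma msmooth_compose:
  fixes F :: "'m \<Rightarrow> 'b::euclidean_space"
  assumes "open U" "msmooth_on A U F" "open T" "smooth_on T h" "\<And>p. p \<in> U \<Longrightarrow> F p \<in> T"
  shows "msmooth_on A U (\<lambda>p. h (F p))"
proof (rule msmooth_onI)
  fix D x assume D: "(D, x) \<in> A"
  show "smooth_on (x ` (D \<inter> U)) (\<lambda>u. h (F (inv_into D x u)))"
    by (rule smooth_on_compose[OF chart_open_image[OF D assms(1)] assms(3) _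
        msmooth_smooth_on[OF assms(2) D] assms(4)]) (use D assms(5) in auto)
qed

lemma mdiff_eqI:
  assumes "chart_at A p = (D, x)" "((\<lambda>u. F (inv_into D x u)) has_derivative F') (at (x p))"
  shows "mdiff A F p = F'"
  unfolding mdiff_def assms(1) using frechet_derivative_at[OF assms(2)] by (simp add: o_def)

lemma msmooth_has_derivative:
  assumes "open U" "p \<in> U" "msmooth_on A U F" "(D, x) \<in> A" "p \<in> D"
  shows "((\<lambda>u. F (inv_into D x u)) has_derivative frechet_derivative (\<lambda>u. F (inv_into D x u)) (at (x p))) (at (x p))"
  using smooth_on_has_derivative[OF msmooth_smooth_on[OF assms(3,4)]] assms(2,5) by (simp add: o_def)

lemma mdiff_has_derivative:
  assumes "open U" "p \<in> U" "msmooth_on A U F" "chart_at A p = (D, x)"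
  shows "((\<lambda>u. F (inv_into D x u)) has_derivative mdiff A F p) (at (x p))"
  using msmooth_has_derivative[OF assms(1-3) chart_at[OF assms(4)]]
  by (simp add: mdiff_def assms(4) o_def)

lemma mdiff_cong:
  assumes "open U" "p \<in> U" "\<And>q. q \<in> U \<Longrightarrow> F q = G q"
  shows "mdiff A F p = mdiff A G p"
proof -
  obtain D x where ch: "chart_at A p = (D, x)" by fastforce
  note D = chart_at[OF ch]
  have "frechet_derivative (F \<circ> inv_into D x) (at (x p)) = frechet_derivative (G \<circ> inv_into D x) (at (x p))"
    by (rule frechet_derivative_cong_open[OF chart_open_image[OF D(1) assms(1)]])
      (use assms D in auto)
  then show ?thesis by (simp add: mdiff_def ch)
qed

lemma mdiff_compose:
  assumes "open U" "p \<in> U" "msmooth_on A U F" "(h has_derivative h') (at (F p))"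
  shows "mdiff A (\<lambda>q. h (F q)) p = (\<lambda>\<xi>. h' (mdiff A F p \<xi>))"
proof -
  obtain D x where ch: "chart_at A p = (D, x)" by fastforce
  show ?thesis
    by (rule mdiff_eqI[OF ch], rule has_derivative_compose[OF mdiff_has_derivative[OF assms(1-3) ch]])
      (use assms(4) chart_at[OF ch] in simp)
qed

lemma dir_cong:
  assumes "open U" "p \<in> U" "\<And>q. q \<in> U \<Longrightarrow> F q = G q"
  shows "dir p X F = dir p X G"
  by (simp add: dir_deriv_def mdiff_cong[OF assms])

lemma dir_const: "dir p X (\<lambda>q. a) = 0"
proof -
  obtain D x where ch: "chart_at A p = (D, x)" by fastforce
  show ?thesis
    by (simp add: dir_deriv_def mdiff_eqI[OF ch, of _ "\<lambda>v. 0"])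
qed

lemma dir_compose:
  assumes "open U" "p \<in> U" "msmooth_on A U F" "(h has_derivative h') (at (F p))"
  shows "dir p X (\<lambda>q. h (F q)) = h' (dir p X F)"
  by (simp add: dir_deriv_def mdiff_compose[OF assms])

lemma dir_bounded_linear:
  assumes "open U" "p \<in> U" "msmooth_on A U F" "bounded_linear h"
  shows "dir p X (\<lambda>q. h (F q)) = h (dir p X F)"
  by (rule dir_compose[OF assms(1-3) bounded_linear_imp_has_derivative[OF assms(4)]])

lemma dir_add:
  assumes "open U" "p \<in> U" "msmooth_on A U F" "msmooth_on A U G"
  shows "dir p X (\<lambda>q. F q + G q) = dir p X F + dir p X G"
proof -
  obtain D x where ch: "chart_at A p = (D, x)" by fastforce
  show ?thesis
    by (simp add: dir_deriv_def mdiff_eqI[OF ch has_derivative_add[OF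
          mdiff_has_derivative[OF assms(1-3) ch] mdiff_has_derivative[OF assms(1,2,4) ch]]])
qed

lemma dir_minus:
  "open U \<Longrightarrow> p \<in> U \<Longrightarrow> msmooth_on A U F \<Longrightarrow> dir p X (\<lambda>q. - F q) = - dir p X F"
  by (rule dir_bounded_linear[OF _ _ _ bounded_linear_minus[OF bounded_linear_ident]])

lemma dir_sum:
  assumes "open U" "p \<in> U" "\<And>i. i \<in> B \<Longrightarrow> msmooth_on A U (F i)"
  shows "dir p X (\<lambda>q. \<Sum>i\<in>B. F i q) = (\<Sum>i\<in>B. dir p X (F i))"
proof -
  obtain D x where ch: "chart_at A p = (D, x)" by fastforce
  have "((\<lambda>u. \<Sum>i\<in>B. F i (inv_into D x u)) has_derivative (\<lambda>h. \<Sum>i\<in>B. mdiff A (F i) p h)) (at (x p))"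
    by (rule has_derivative_sum) (rule mdiff_has_derivative[OF assms(1,2,3) ch])
  from mdiff_eqI[OF ch this] show ?thesis by (simp add: dir_deriv_def)
qed

lemma dir_bilinear:
  assumes "open U" "p \<in> U" "bounded_bilinear pr" "msmooth_on A U F" "msmooth_on A U G"
  shows "dir p X (\<lambda>q. pr (F q) (G q)) = pr (F p) (dir p X G) + pr (dir p X F) (G p)"
proof -
  obtain D x where ch: "chart_at A p = (D, x)" by fastforce
  show ?thesis
    using mdiff_eqI[OF ch bounded_bilinear.FDERIV[OF assms(3)
          mdiff_has_derivative[OF assms(1,2,4) ch] mdiff_has_derivative[OF assms(1,2,5) ch]]] chart_at[OF ch]
    by (simp add: dir_deriv_def)
qed

lemmas dir_scaleR = dir_bilinear[OF _ _ bounded_bilinear_scaleR]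
lemmas dir_fst = dir_bounded_linear[OF _ _ _ bounded_linear_fst]
lemmas dir_snd = dir_bounded_linear[OF _ _ _ bounded_linear_snd]

lemma inj_mdiff: "inj (mdiff A \<phi> p)"
  using immersion by (simp add: immersion_def)

lemma linear_mdiff:
  assumes "open U" "p \<in> U" "msmooth_on A U F"
  shows "linear (mdiff A F p)"
proof -
  obtain D x where ch: "chart_at A p = (D, x)" by fastforce
  show ?thesis
    using mdiff_has_derivative[OF assms ch] has_derivative_linear by blast
qed

lemma linear_mdiff_immersion: "linear (mdiff A \<phi> p)"
  by (rule linear_mdiff[OF open_UNIV UNIV_I msmooth_immersion])

lemma tangent_plane_subspace: "subspace (tangent_plane A \<phi> p)"
  unfolding tangent_plane_def by (rule linear_subspace_image[OF linear_mdiff_immersion subspace_UNIV])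

lemma dim_tangent_plane: "dim (tangent_plane A \<phi> p) = 2"
  unfolding tangent_plane_def using dim_image_eq[OF linear_mdiff_immersion[of p], of UNIV] inj_mdiff[of p]
  by simp

lemma dir_immersion: "X \<in> tangent_plane A \<phi> p \<Longrightarrow> dir p X \<phi> = X"
  by (simp add: dir_deriv_def tangent_plane_def f_inv_into_f)

lemma dir_linear:
  assumes "open U" "p \<in> U" "msmooth_on A U F" "X \<in> tangent_plane A \<phi> p" "Y \<in> tangent_plane A \<phi> p"
  shows "dir p (a *\<^sub>R X + b *\<^sub>R Y) F = a *\<^sub>R dir p X F + b *\<^sub>R dir p Y F"
proof -
  obtain \<xi> \<eta> where XY: "X = mdiff A \<phi> p \<xi>" "Y = mdiff A \<phi> p \<eta>"
    using assms(4,5) by (auto simp: tangent_plane_def)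
  have "a *\<^sub>R X + b *\<^sub>R Y = mdiff A \<phi> p (a *\<^sub>R \<xi> + b *\<^sub>R \<eta>)"
    by (simp add: XY linear_add linear_scale linear_mdiff_immersion)
  then show ?thesis
    using linear_mdiff[OF assms(1-3)]
    by (simp add: dir_deriv_def XY inv_f_f[OF inj_mdiff] linear_add linear_scale)
qed

section \<open>Calculus in a fixed chart and Lie brackets\<close>

lemma chart_transition:
  assumes D: "(D, x) \<in> A" "p \<in> D" and D': "(D', x') \<in> A" "p \<in> D'"
    and F: "open U" "p \<in> U" "msmooth_on A U F"
  shows "frechet_derivative (\<lambda>u. F (inv_into D x u)) (at (x p)) =
    (\<lambda>\<xi>. frechet_derivative (\<lambda>u. F (inv_into D' x' u)) (at (x' p))
      (frechet_derivative (\<lambda>u. x' (inv_into D x u)) (at (x p)) \<xi>))"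
proof -
  let ?O = "x ` (D \<inter> (D' \<inter> U))"
  have O: "open ?O" "x p \<in> ?O"
    using chart_open_image[OF D(1) open_Int[OF chart_open(1)[OF D'(1)] F(1)]] D D' F by auto
  have "smooth_on (x ` (D \<inter> D')) (x' \<circ> inv_into D x)"
    using atlas D D' by (fastforce simp: smooth_atlas_def)
  then have t: "((\<lambda>u. x' (inv_into D x u)) has_derivative
      frechet_derivative (\<lambda>u. x' (inv_into D x u)) (at (x p))) (at (x p))"
    using smooth_on_has_derivative[of "x ` (D \<inter> D')" "x' \<circ> inv_into D x" "x p"] D D' by (simp add: o_def)
  have "((\<lambda>u. F (inv_into D' x' (x' (inv_into D x u)))) has_derivative
      (\<lambda>\<xi>. frechet_derivative (\<lambda>u. F (inv_into D' x' u)) (at (x' p))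
      (frechet_derivative (\<lambda>u. x' (inv_into D x u)) (at (x p)) \<xi>))) (at (x p))"
    by (rule has_derivative_compose[OF t]) (use msmooth_has_derivative[OF F D'] D in simp)
  then have "((\<lambda>u. F (inv_into D x u)) has_derivative
      (\<lambda>\<xi>. frechet_derivative (\<lambda>u. F (inv_into D' x' u)) (at (x' p))
      (frechet_derivative (\<lambda>u. x' (inv_into D x u)) (at (x p)) \<xi>))) (at (x p))"
    by (rule has_derivative_transform_within_open[OF _ O]) (use D D' in auto)
  then show ?thesis by (rule frechet_derivative_at[symmetric])
qed

text \<open>\<open>mdiff\<close> and \<open>dir_deriv\<close> use whichever chart
  \<open>chart_at\<close> picks at the point, and that choice may jump from point to point. To
  differentiate a derivative again, everything has to be computed in one fixed chart around the
  point.\<close>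

lemma chart_differential:
  assumes D: "(D, x) \<in> A" "p \<in> D"
  shows "inj (frechet_derivative (\<lambda>u. \<phi> (inv_into D x u)) (at (x p)))" (is "inj ?d\<phi>")
    and "tangent_plane A \<phi> p = range (frechet_derivative (\<lambda>u. \<phi> (inv_into D x u)) (at (x p)))"
    and "open U \<Longrightarrow> p \<in> U \<Longrightarrow> msmooth_on A U F \<Longrightarrow>
      dir p (frechet_derivative (\<lambda>u. \<phi> (inv_into D x u)) (at (x p)) \<xi>) F
        = frechet_derivative (\<lambda>u. F (inv_into D x u)) (at (x p)) \<xi>"
proof -
  obtain D0 x0 where ch: "chart_at A p = (D0, x0)" by fastforce
  note D0 = chart_at[OF ch]
  let ?\<tau> = "frechet_derivative (\<lambda>u. x (inv_into D0 x0 u)) (at (x0 p))"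
  have tr: "mdiff A G p = (\<lambda>\<xi>. frechet_derivative (\<lambda>u. G (inv_into D x u)) (at (x p)) (?\<tau> \<xi>))"
    if "open V" "p \<in> V" "msmooth_on A V G" for V and G :: "'m \<Rightarrow> 'c::real_normed_vector"
    using chart_transition[OF D0 D that] by (simp add: mdiff_def ch o_def)
  note tr\<phi> = tr[OF open_UNIV UNIV_I msmooth_immersion]
  \<comment> \<open>The injective differential of \<open>\<phi>\<close> in the chosen chart factors
    through \<open>?\<tau>\<close>, which is therefore injective, and surjective since both sides
    have dimension 2.\<close>
  have inj\<tau>: "inj ?\<tau>"
    using inj_mdiff[of p] unfolding tr\<phi> by (auto simp: inj_def)
  have "smooth_on (x0 ` (D0 \<inter> D)) (x \<circ> inv_into D0 x0)"
    using atlas D D0 by (fastforce simp: smooth_atlas_def)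
  then have "((\<lambda>u. x (inv_into D0 x0 u)) has_derivative ?\<tau>) (at (x0 p))"
    using smooth_on_has_derivative[of "x0 ` (D0 \<inter> D)" "x \<circ> inv_into D0 x0" "x0 p"] D D0 by (simp add: o_def)
  then have surj: "surj ?\<tau>"
    using inj\<tau> has_derivative_linear linear_injective_imp_surjective by blast
  show "inj ?d\<phi>"
  proof (rule injI)
    fix a b assume eq: "?d\<phi> a = ?d\<phi> b"
    obtain a' b' where ab: "a = ?\<tau> a'" "b = ?\<tau> b'"
      using surjD[OF surj, of a] surjD[OF surj, of b] by blast
    then have "mdiff A \<phi> p a' = mdiff A \<phi> p b'" using eq by (simp add: tr\<phi>)
    then show "a = b" using injD[OF inj_mdiff] ab by blast
  qed
  show "tangent_plane A \<phi> p = range ?d\<phi>"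
    unfolding tangent_plane_def tr\<phi> by (simp add: image_image[symmetric] surj)
  assume F: "open U" "p \<in> U" "msmooth_on A U F"
  obtain \<xi>0 where "\<xi> = ?\<tau> \<xi>0" using surjD[OF surj, of \<xi>] by blast
  moreover have "inv (mdiff A \<phi> p) (mdiff A \<phi> p \<xi>0) = \<xi>0" by (rule inv_f_f[OF inj_mdiff])
  ultimately show "dir p (?d\<phi> \<xi>) F = frechet_derivative (\<lambda>u. F (inv_into D x u)) (at (x p)) \<xi>"
    by (simp add: dir_deriv_def tr[OF F] tr\<phi>)
qed

text \<open>The components solve the linear system with the Gram matrix of the coordinate fields, so they
  depend smoothly on the point by Cramer's rule.\<close>
lemma tangent_field_components:
  assumes D: "(D, x) \<in> A" and U: "open U" and X: "tangent_field_on A \<phi> U X"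
  obtains a1 a2 where "smooth_on (x ` (D \<inter> U)) a1" "smooth_on (x ` (D \<inter> U)) a2"
    "\<forall>u\<in>x ` (D \<inter> U). X (inv_into D x u) =
      frechet_derivative (\<lambda>u. \<phi> (inv_into D x u)) (at u) (a1 u *\<^sub>R axis 1 1 + a2 u *\<^sub>R axis 2 1)"
proof
  let ?O = "x ` (D \<inter> U)"
  let ?\<psi> = "\<lambda>u. \<phi> (inv_into D x u)"
  have O: "open ?O" by (rule chart_open_image[OF D U])
  have \<psi>: "smooth_on ?O ?\<psi>" using msmooth_smooth_on[OF msmooth_immersion D] by (simp add: o_def)
  let ?p1 = "\<lambda>u. frechet_derivative ?\<psi> (at u) (axis 1 1)"
  let ?p2 = "\<lambda>u. frechet_derivative ?\<psi> (at u) (axis 2 1)"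
  let ?det = "\<lambda>u. (?p1 u \<bullet> ?p1 u) * (?p2 u \<bullet> ?p2 u) + - ((?p1 u \<bullet> ?p2 u) * (?p1 u \<bullet> ?p2 u))"
  let ?b1 = "\<lambda>u. X (inv_into D x u) \<bullet> ?p1 u"
  let ?b2 = "\<lambda>u. X (inv_into D x u) \<bullet> ?p2 u"
  define a1 where "a1 = (\<lambda>u. ((?p2 u \<bullet> ?p2 u) * ?b1 u + - ((?p1 u \<bullet> ?p2 u) * ?b2 u)) * inverse (?det u))"
  define a2 where "a2 = (\<lambda>u. ((?p1 u \<bullet> ?p1 u) * ?b2 u + - ((?p1 u \<bullet> ?p2 u) * ?b1 u)) * inverse (?det u))"
  have det: "?det u \<noteq> 0" and X1: "X (inv_into D x u) = frechet_derivative ?\<psi> (at u) (a1 u *\<^sub>R axis 1 1 + a2 u *\<^sub>R axis 2 1)"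
    if u: "u \<in> ?O" for u
  proof -
    obtain q where q: "q \<in> D" "q \<in> U" "u = x q" using u by blast
    let ?d = "frechet_derivative ?\<psi> (at u)"
    have inj: "inj ?d" and tp: "tangent_plane A \<phi> q = range ?d"
      using chart_differential(1,2)[OF D q(1)] q(3) by auto
    have lin: "linear ?d"
      using smooth_on_has_derivative[OF \<psi> u] has_derivative_linear by blast
    have exp: "?d \<xi> = \<xi> $ 1 *\<^sub>R ?p1 u + \<xi> $ 2 *\<^sub>R ?p2 u" for \<xi>
      by (subst real2_expansion) (simp only: linear_add[OF lin] linear_scale[OF lin])
    show det: "?det u \<noteq> 0" by (rule gram_determinant_neq_0[OF lin inj])
    have "X q \<in> tangent_plane A \<phi> q" using X q by (simp add: tangent_field_on_def)
    then obtain \<xi> where \<xi>: "X q = ?d \<xi>" unfolding tp by blast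
    have Xq: "X (inv_into D x u) = \<xi> $ 1 *\<^sub>R ?p1 u + \<xi> $ 2 *\<^sub>R ?p2 u"
      using \<xi> exp[of \<xi>] q D by simp
    have b: "?b1 u = \<xi> $ 1 * (?p1 u \<bullet> ?p1 u) + \<xi> $ 2 * (?p1 u \<bullet> ?p2 u)"
      "?b2 u = \<xi> $ 1 * (?p1 u \<bullet> ?p2 u) + \<xi> $ 2 * (?p2 u \<bullet> ?p2 u)"
      unfolding Xq by (simp_all only: inner_add_left inner_scaleR_left inner_commute[of "?p2 u" "?p1 u"])
    have "a1 u = \<xi> $ 1" "a2 u = \<xi> $ 2"
      unfolding a1_def a2_def b by (rule cramer_2[OF det])+
    then show "X (inv_into D x u) = ?d (a1 u *\<^sub>R axis 1 1 + a2 u *\<^sub>R axis 2 1)"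
      using real2_expansion[of \<xi>] \<xi> q D by simp
  qed
  have p: "smooth_on ?O ?p1" "smooth_on ?O ?p2" by (intro smooth_on_frechet_derivative \<psi>)+
  have Xs: "smooth_on ?O (\<lambda>u. X (inv_into D x u))"
    using X msmooth_smooth_on[OF _ D, of U X] by (simp add: tangent_field_on_def o_def)
  note sm = smooth_on_add[OF O] smooth_on_bilinear[OF O bounded_bilinear_mult]
      smooth_on_bilinear[OF O bounded_bilinear_inner]
      smooth_on_bounded_linear[OF O bounded_linear_minus[OF bounded_linear_ident]] p Xs
  have dets: "smooth_on ?O ?det" by (intro sm)
  show "smooth_on ?O a1" "smooth_on ?O a2"
    unfolding a1_def a2_def by (intro sm smooth_on_inverse[OF O dets det]; assumption)+
  show "\<forall>u\<in>?O. X (inv_into D x u) = frechet_derivative ?\<psi> (at u) (a1 u *\<^sub>R axis 1 1 + a2 u *\<^sub>R axis 2 1)"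
    using X1 by blast
qed

lemma dir_components:
  assumes D: "(D, x) \<in> A" and U: "open U" and F: "msmooth_on A U F" and u: "u \<in> x ` (D \<inter> U)"
    and X: "X = frechet_derivative (\<lambda>u. \<phi> (inv_into D x u)) (at u) (a1 *\<^sub>R axis 1 1 + a2 *\<^sub>R axis 2 1)"
  shows "dir (inv_into D x u) X F =
      a1 *\<^sub>R frechet_derivative (\<lambda>u. F (inv_into D x u)) (at u) (axis 1 1)
      + a2 *\<^sub>R frechet_derivative (\<lambda>u. F (inv_into D x u)) (at u) (axis 2 1)"
proof -
  obtain q where q: "q \<in> D" "q \<in> U" "u = x q" using u by blast
  have lin: "linear (frechet_derivative (\<lambda>u. F (inv_into D x u)) (at (x q)))"
    using msmooth_has_derivative[OF U q(2) F D q(1)] has_derivative_linear by blast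
  show ?thesis
    using chart_differential(3)[OF D q(1) U q(2) F, of "a1 *\<^sub>R axis 1 1 + a2 *\<^sub>R axis 2 1"] D q
    by (simp add: X linear_add[OF lin] linear_scale[OF lin])
qed

lemma msmooth_dir:
  assumes U: "open U" and X: "tangent_field_on A \<phi> U X" and F: "msmooth_on A U F"
  shows "msmooth_on A U (\<lambda>q. dir q (X q) F)"
proof (rule msmooth_onI)
  fix D x assume D: "(D, x) \<in> A"
  let ?O = "x ` (D \<inter> U)"
  have O: "open ?O" by (rule chart_open_image[OF D U])
  obtain a1 a2 where a: "smooth_on ?O a1" "smooth_on ?O a2"
    "\<forall>u\<in>?O. X (inv_into D x u) =
      frechet_derivative (\<lambda>u. \<phi> (inv_into D x u)) (at u) (a1 u *\<^sub>R axis 1 1 + a2 u *\<^sub>R axis 2 1)"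
    by (rule tangent_field_components[OF D U X])
  have Fs: "smooth_on ?O (\<lambda>u. F (inv_into D x u))"
    using msmooth_smooth_on[OF F D] by (simp add: o_def)
  have eq: "dir (inv_into D x u) (X (inv_into D x u)) F =
      a1 u *\<^sub>R frechet_derivative (\<lambda>u. F (inv_into D x u)) (at u) (axis 1 1)
      + a2 u *\<^sub>R frechet_derivative (\<lambda>u. F (inv_into D x u)) (at u) (axis 2 1)" if "u \<in> ?O" for u
    by (rule dir_components[OF D U F that bspec[OF a(3) that]])
  have "smooth_on ?O (\<lambda>u. a1 u *\<^sub>R frechet_derivative (\<lambda>u. F (inv_into D x u)) (at u) (axis 1 1)
      + a2 u *\<^sub>R frechet_derivative (\<lambda>u. F (inv_into D x u)) (at u) (axis 2 1))"
    by (intro smooth_on_add[OF O] smooth_on_bilinear[OF O bounded_bilinear_scaleR] a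
        smooth_on_frechet_derivative Fs)
  moreover have "smooth_on ?O (\<lambda>u. dir (inv_into D x u) (X (inv_into D x u)) F) \<longleftrightarrow>
    smooth_on ?O (\<lambda>u. a1 u *\<^sub>R frechet_derivative (\<lambda>u. F (inv_into D x u)) (at u) (axis 1 1)
      + a2 u *\<^sub>R frechet_derivative (\<lambda>u. F (inv_into D x u)) (at u) (axis 2 1))"
    by (rule smooth_on_cong[OF O]) (rule eq)
  ultimately show "smooth_on ?O (\<lambda>u. dir (inv_into D x u) (X (inv_into D x u)) F)" by blast
qed

text \<open>The Lie bracket pushed forward by the immersion: a tangent vector is the derivative of
  \<open>\<phi>\<close> along itself, so the right side is the commutator of \<open>X\<close> and
  \<open>Y\<close> applied to \<open>\<phi>\<close>.\<close>

definition bracket :: "('m \<Rightarrow> 'a) \<Rightarrow> ('m \<Rightarrow> 'a) \<Rightarrow> 'm \<Rightarrow> 'a" where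
  "bracket X Y p = dir p (X p) Y - dir p (Y p) X"

text \<open>The terms with second derivatives of \<open>F\<close> cancel by symmetry. What is left
  is a first derivative of \<open>F\<close> whose direction, the coordinate expression of the Lie
  bracket, does not depend on \<open>F\<close>.\<close>

lemma dir_commutator_chart:
  fixes F :: "'m \<Rightarrow> 'b::euclidean_space"
  assumes D: "(D, x) \<in> A" "p \<in> D" and U: "open U" "p \<in> U" and F: "msmooth_on A U F"
    and a: "smooth_on (x ` (D \<inter> U)) a1" "smooth_on (x ` (D \<inter> U)) a2"
      "\<forall>u\<in>x ` (D \<inter> U). X (inv_into D x u) =
        frechet_derivative (\<lambda>u. \<phi> (inv_into D x u)) (at u) (a1 u *\<^sub>R axis 1 1 + a2 u *\<^sub>R axis 2 1)"
    and b: "smooth_on (x ` (D \<inter> U)) b1" "smooth_on (x ` (D \<inter> U)) b2"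
      "\<forall>u\<in>x ` (D \<inter> U). Y (inv_into D x u) =
        frechet_derivative (\<lambda>u. \<phi> (inv_into D x u)) (at u) (b1 u *\<^sub>R axis 1 1 + b2 u *\<^sub>R axis 2 1)"
    and XY: "tangent_field_on A \<phi> U X" "tangent_field_on A \<phi> U Y"
  defines "\<xi> \<equiv> a1 (x p) *\<^sub>R axis 1 1 + a2 (x p) *\<^sub>R axis 2 1"
    and "\<eta> \<equiv> b1 (x p) *\<^sub>R axis 1 1 + b2 (x p) *\<^sub>R axis 2 1"
  shows "dir p (X p) (\<lambda>q. dir q (Y q) F) - dir p (Y p) (\<lambda>q. dir q (X q) F) =
    frechet_derivative (\<lambda>u. F (inv_into D x u)) (at (x p))
      ((frechet_derivative b1 (at (x p)) \<xi> - frechet_derivative a1 (at (x p)) \<eta>) *\<^sub>R axis 1 1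
       + (frechet_derivative b2 (at (x p)) \<xi> - frechet_derivative a2 (at (x p)) \<eta>) *\<^sub>R axis 2 1)"
proof -
  let ?O = "x ` (D \<inter> U)"
  have O: "open ?O" "x p \<in> ?O" using chart_open_image[OF D(1) U(1)] D U by auto
  let ?F = "\<lambda>u. F (inv_into D x u)"
  let ?F1 = "\<lambda>u. frechet_derivative ?F (at u) (axis 1 1)"
  let ?F2 = "\<lambda>u. frechet_derivative ?F (at u) (axis 2 1)"
  have Fs: "smooth_on ?O ?F" using msmooth_smooth_on[OF F D(1)] by (simp add: o_def)
  have fd: "(h has_derivative frechet_derivative h (at (x p))) (at (x p))" if "smooth_on ?O h"
    for h :: "real^2 \<Rightarrow> 'c::real_normed_vector"
    by (rule smooth_on_has_derivative[OF that O(2)])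
  have lin: "linear (frechet_derivative h (at (x p)))" if "smooth_on ?O h"
    for h :: "real^2 \<Rightarrow> 'c::real_normed_vector"
    using fd[OF that] has_derivative_linear by blast
  have Fi: "smooth_on ?O ?F1" "smooth_on ?O ?F2" by (intro smooth_on_frechet_derivative Fs)+
  have main: "dir p Z (\<lambda>q. dir q (W q) F) =
      w1 (x p) *\<^sub>R frechet_derivative ?F1 (at (x p)) \<zeta> + frechet_derivative w1 (at (x p)) \<zeta> *\<^sub>R ?F1 (x p)
      + (w2 (x p) *\<^sub>R frechet_derivative ?F2 (at (x p)) \<zeta> + frechet_derivative w2 (at (x p)) \<zeta> *\<^sub>R ?F2 (x p))"
    if W: "tangent_field_on A \<phi> U W"
      and w: "smooth_on ?O w1" "smooth_on ?O w2"
        "\<forall>u\<in>?O. W (inv_into D x u) =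
        frechet_derivative (\<lambda>u. \<phi> (inv_into D x u)) (at u) (w1 u *\<^sub>R axis 1 1 + w2 u *\<^sub>R axis 2 1)"
      and Z: "Z = frechet_derivative (\<lambda>u. \<phi> (inv_into D x u)) (at (x p)) \<zeta>" for Z W \<zeta> w1 w2
  proof -
    have "dir p Z (\<lambda>q. dir q (W q) F)
      = frechet_derivative (\<lambda>u. dir (inv_into D x u) (W (inv_into D x u)) F) (at (x p)) \<zeta>"
      unfolding Z by (rule chart_differential(3)[OF D U msmooth_dir[OF U(1) W F]])
    also have "frechet_derivative (\<lambda>u. dir (inv_into D x u) (W (inv_into D x u)) F) (at (x p))
      = frechet_derivative (\<lambda>u. w1 u *\<^sub>R ?F1 u + w2 u *\<^sub>R ?F2 u) (at (x p))"
      by (rule frechet_derivative_cong_open[OF O dir_components[OF D(1) U(1) F _ bspec[OF w(3)]]])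
    also have "\<dots> = (\<lambda>\<zeta>. w1 (x p) *\<^sub>R frechet_derivative ?F1 (at (x p)) \<zeta> + frechet_derivative w1 (at (x p)) \<zeta> *\<^sub>R ?F1 (x p)
      + (w2 (x p) *\<^sub>R frechet_derivative ?F2 (at (x p)) \<zeta> + frechet_derivative w2 (at (x p)) \<zeta> *\<^sub>R ?F2 (x p)))"
      by (intro frechet_derivative_at[symmetric] has_derivative_add has_derivative_scaleR fd w Fi)
    finally show ?thesis .
  qed
  have Xp: "X p = frechet_derivative (\<lambda>u. \<phi> (inv_into D x u)) (at (x p)) \<xi>"
    using bspec[OF a(3) O(2)] D by (simp add: \<xi>_def)
  have Yp: "Y p = frechet_derivative (\<lambda>u. \<phi> (inv_into D x u)) (at (x p)) \<eta>"
    using bspec[OF b(3) O(2)] D by (simp add: \<eta>_def)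
  have sym: "frechet_derivative ?F2 (at (x p)) (axis 1 1) = frechet_derivative ?F1 (at (x p)) (axis 2 1)"
    by (rule symmetric_second_derivative[OF O Fs])
  show ?thesis
    unfolding main[OF XY(2) b Xp] main[OF XY(1) a Yp]
    unfolding linear_add[OF lin[OF Fs]] linear_scale[OF lin[OF Fs]]
    unfolding \<xi>_def \<eta>_def
      linear_add[OF lin[OF Fi(1)]] linear_scale[OF lin[OF Fi(1)]]
      linear_add[OF lin[OF Fi(2)]] linear_scale[OF lin[OF Fi(2)]] sym
    by (simp add: algebra_simps)
qed

text \<open>The direction in \<open>dir_commutator_chart\<close> is the same for every
  \<open>F\<close>. Taking \<open>F = \<phi>\<close> shows that \<open>bracket X Y p\<close> is its
  image under the differential of \<open>\<phi>\<close>; both claims follow.\<close>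

lemma bracket:
  assumes U: "open U" "p \<in> U" and XY: "tangent_field_on A \<phi> U X" "tangent_field_on A \<phi> U Y"
  shows "bracket X Y p \<in> tangent_plane A \<phi> p"
    and "msmooth_on A U (F :: 'm \<Rightarrow> 'b::euclidean_space) \<Longrightarrow>
      dir p (X p) (\<lambda>q. dir q (Y q) F) - dir p (Y p) (\<lambda>q. dir q (X q) F) = dir p (bracket X Y p) F"
proof -
  obtain D x where ch: "chart_at A p = (D, x)" by fastforce
  note D = chart_at[OF ch]
  let ?O = "x ` (D \<inter> U)"
  let ?d\<phi> = "frechet_derivative (\<lambda>u. \<phi> (inv_into D x u)) (at (x p))"
  obtain a1 a2 where a: "smooth_on ?O a1" "smooth_on ?O a2"
    "\<forall>u\<in>?O. X (inv_into D x u) =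
      frechet_derivative (\<lambda>u. \<phi> (inv_into D x u)) (at u) (a1 u *\<^sub>R axis 1 1 + a2 u *\<^sub>R axis 2 1)"
    by (rule tangent_field_components[OF D(1) U(1) XY(1)])
  obtain b1 b2 where b: "smooth_on ?O b1" "smooth_on ?O b2"
    "\<forall>u\<in>?O. Y (inv_into D x u) =
      frechet_derivative (\<lambda>u. \<phi> (inv_into D x u)) (at u) (b1 u *\<^sub>R axis 1 1 + b2 u *\<^sub>R axis 2 1)"
    by (rule tangent_field_components[OF D(1) U(1) XY(2)])
  define \<xi> where "\<xi> = a1 (x p) *\<^sub>R axis 1 1 + a2 (x p) *\<^sub>R (axis 2 1 :: real^2)"
  define \<eta> where "\<eta> = b1 (x p) *\<^sub>R axis 1 1 + b2 (x p) *\<^sub>R (axis 2 1 :: real^2)"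
  define \<Lambda> where "\<Lambda> = (frechet_derivative b1 (at (x p)) \<xi> - frechet_derivative a1 (at (x p)) \<eta>) *\<^sub>R axis 1 1
       + (frechet_derivative b2 (at (x p)) \<xi> - frechet_derivative a2 (at (x p)) \<eta>) *\<^sub>R (axis 2 1 :: real^2)"
  have c: "dir p (X p) (\<lambda>q. dir q (Y q) G) - dir p (Y p) (\<lambda>q. dir q (X q) G) =
      frechet_derivative (\<lambda>u. G (inv_into D x u)) (at (x p)) \<Lambda>"
    if "msmooth_on A U G" for G :: "'m \<Rightarrow> 'd::euclidean_space"
    using dir_commutator_chart[OF D U that a b XY] by (simp add: \<xi>_def \<eta>_def \<Lambda>_def)
  have "dir p (X p) (\<lambda>q. dir q (Y q) \<phi>) = dir p (X p) Y" "dir p (Y p) (\<lambda>q. dir q (X q) \<phi>) = dir p (Y p) X"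
    using XY by (auto intro!: dir_cong[OF U] dir_immersion simp: tangent_field_on_def)
  then have br: "bracket X Y p = ?d\<phi> \<Lambda>"
    using c[OF msmooth_immersion] by (simp add: bracket_def)
  then show "bracket X Y p \<in> tangent_plane A \<phi> p"
    using chart_differential(2)[OF D] by simp
  show "dir p (X p) (\<lambda>q. dir q (Y q) F) - dir p (Y p) (\<lambda>q. dir q (X q) F) = dir p (bracket X Y p) F"
    if "msmooth_on A U F"
    using c[OF that] chart_differential(3)[OF D U that, of \<Lambda>] by (simp add: br)
qed

end

section \<open>The connection of a Robertson-Walker space-time\<close>

text \<open>The polar form of the quadratic form \<open>a\<^sup>2 + c (x \<bullet> x)\<close> that defines the space form.\<close>
definition quadric :: "real \<Rightarrow> real \<times> (real^3) \<Rightarrow> real \<times> (real^3) \<Rightarrow> real" where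
  "quadric c v w = fst v * fst w + c * (snd v \<bullet> snd w)"

lemma bilinear_quadric: "bounded_bilinear (quadric c)"
  unfolding bilinear_conv_bounded_bilinear[symmetric] bilinear_def
  by (auto intro!: linearI simp: quadric_def inner_add_left inner_add_right algebra_simps)

lemma bilinear_space_form_metric: "bounded_bilinear (space_form_metric c)"
  unfolding bilinear_conv_bounded_bilinear[symmetric] bilinear_def
  by (auto intro!: linearI simp: space_form_metric_def inner_add_left inner_add_right algebra_simps)

interpretation quadric: bounded_bilinear "quadric c" for c
  by (rule bilinear_quadric)

interpretation metric: bounded_bilinear "space_form_metric c" for c
  by (rule bilinear_space_form_metric)

lemmas quadric_simps = quadric.add_left quadric.add_right quadric.diff_left quadric.diff_right
  quadric.scaleR_left quadric.scaleR_right quadric.minus_left quadric.minus_right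
lemmas metric_simps = metric.add_left metric.add_right metric.diff_left metric.diff_right
  metric.scaleR_left metric.scaleR_right metric.minus_left metric.minus_right

lemma quadric_commute: "quadric c v w = quadric c w v"
  by (simp add: quadric_def inner_commute)

lemma metric_commute: "space_form_metric c v w = space_form_metric c w v"
  by (simp add: space_form_metric_def inner_commute)

lemma space_form_quadric: "y \<in> space_form c \<longleftrightarrow> quadric c y y = 1 \<and> (c \<le> 0 \<longrightarrow> fst y > 0)"
  by (auto simp: space_form_def quadric_def power2_eq_square)

text \<open>For \<open>c = -1\<close> a vector orthogonal to the time-like position vector is
  space-like: with \<open>a * b = x \<bullet> w\<close> and
  \<open>a * a = 1 + x \<bullet> x\<close>, Cauchy-Schwarz leaves a strict margin of
  \<open>w \<bullet> w\<close>.\<close>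

lemma metric_pos_def:
  assumes c: "c \<in> {-1, 0, 1}" and y: "y \<in> space_form c" and v: "quadric c y v = 0" "v \<noteq> 0"
  shows "space_form_metric c v v > 0"
proof -
  consider "c = 1" | "c = 0" | "c = -1" using c by blast
  then show ?thesis
  proof cases
    case 1
    then show ?thesis using v by (simp add: space_form_metric_sphere)
  next
    case 2
    then have "fst v = 0" using v y by (auto simp: quadric_def space_form_def)
    then show ?thesis using v 2 by (cases v) (auto simp: space_form_metric_def zero_prod_def)
  next
    case 3
    obtain a x b w where yv: "y = (a, x)" "v = (b, w)" by (cases y, cases v)
    have a: "a * a = 1 + x \<bullet> x" and ab: "a * b = x \<bullet> w"
      using y v 3 by (auto simp: yv quadric_def space_form_def power2_eq_square)
    have w: "w \<noteq> 0"
    proof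
      assume "w = 0"
      then have "b = 0" using ab a by (auto simp: add_nonneg_eq_0_iff)
      then show False using \<open>w = 0\<close> v yv by (simp add: zero_prod_def)
    qed
    have "(a * a) * (b * b) = (x \<bullet> w)\<^sup>2" by (simp add: ab[symmetric] power2_eq_square)
    also have "\<dots> \<le> (x \<bullet> x) * (w \<bullet> w)" by (rule Cauchy_Schwarz_ineq)
    also have "\<dots> = a * a * (w \<bullet> w) - w \<bullet> w" by (simp add: a algebra_simps)
    also have "\<dots> < (a * a) * (w \<bullet> w)" using w by simp
    finally have "b * b < w \<bullet> w" using zero_le_square[of a] by (simp add: mult_less_cancel_left)
    then show ?thesis using 3 yv by (simp add: space_form_metric_def)
  qed
qed

text \<open>Tangent vectors are velocities of curves in the set, so equations that hold on the set
  are differentiated through this lemma.\<close>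

lemma derivative_along_level_curve:
  assumes \<gamma>: "(\<gamma> has_vector_derivative v) (at (0::real))" and h: "(h has_derivative h') (at (\<gamma> 0))"
    and k: "\<forall>\<^sub>F s in nhds 0. h (\<gamma> s) = (k :: 'b::real_normed_vector)"
  shows "h' v = 0"
proof -
  have "((\<lambda>s. h (\<gamma> s)) has_derivative (\<lambda>s. h' (s *\<^sub>R v))) (at 0)"
    by (rule has_derivative_compose[OF \<gamma>[unfolded has_vector_derivative_def] h])
  moreover have "((\<lambda>s. h (\<gamma> s)) has_derivative (\<lambda>s. 0)) (at 0)"
  proof (rule has_derivative_transform_eventually[OF has_derivative_const])
    show "\<forall>\<^sub>F s in at 0 within UNIV. k = h (\<gamma> s)"
      using k by (auto simp: eventually_nhds_conv_at elim: eventually_mono)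
    show "k = h (\<gamma> 0)" using eventually_nhds_x_imp_x[OF k] by simp
  qed simp
  ultimately have "(\<lambda>s. h' (s *\<^sub>R v)) = (\<lambda>s. 0)" by (rule has_derivative_unique)
  from fun_cong[OF this, of 1] show ?thesis by simp
qed

section \<open>Tangent spaces of the space-time and uniqueness of its connection\<close>

locale rw_spacetime =
  fixes c :: real and I :: "real set" and f :: "real \<Rightarrow> real"
    and D :: "rw_point \<Rightarrow> rw_point \<Rightarrow> (rw_point \<Rightarrow> rw_point) \<Rightarrow> rw_point"
  assumes c: "c \<in> {-1, 0, 1}" and open_I: "open I"
    and smooth_f: "smooth_on I f" and f_neq_0: "t \<in> I \<Longrightarrow> f t \<noteq> 0"
    and connection: "levi_civita (rw_space I c) (rw_metric f c) D"
begin

abbreviation "L \<equiv> rw_space I c"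
abbreviation "g \<equiv> rw_metric f c"
abbreviation "K \<equiv> quadric c"
abbreviation "B \<equiv> space_form_metric c"
abbreviation "f' \<equiv> deriv f"

lemma mem_L: "p \<in> L \<longleftrightarrow> fst p \<in> I \<and> snd p \<in> space_form c"
  by (cases p) (simp add: rw_space_def)

text \<open>The straight line with velocity \<open>v\<close> is projected back to the space form by
  rescaling. The radial form of \<open>\<gamma>\<close> and the clause for \<open>c = 0\<close>
  serve \<open>totally_geodesic_slice\<close>: rescaling preserves a linear hyperplane, and in the
  flat case the line itself stays in an affine one.\<close>

lemma normalised_curve:
  assumes p: "p \<in> L" and v: "K (snd p) (snd v) = 0"
  obtains \<gamma> r where "\<gamma> 0 = p" "\<forall>\<^sub>F s in nhds 0. \<gamma> s \<in> L" "(\<gamma> has_vector_derivative v) (at 0)"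
    "\<And>s. snd (\<gamma> s) = r s *\<^sub>R (snd p + s *\<^sub>R snd v)" "c = 0 \<Longrightarrow> r = (\<lambda>s. 1)"
proof
  define k where "k = K (snd v) (snd v)"
  define r where "r s = inverse (sqrt (1 + s\<^sup>2 * k))" for s
  define \<gamma> where "\<gamma> s = (fst p + s * fst v, r s *\<^sub>R (snd p + s *\<^sub>R snd v))" for s
  have p1: "K (snd p) (snd p) = 1" using p by (simp add: mem_L space_form_quadric)
  \<comment> \<open>As \<open>v\<close> is tangent, there is no term linear in \<open>s\<close>;
    hence the derivative of \<open>r\<close> at 0 vanishes and rescaling leaves the velocity
    unchanged.\<close>
  have Kq: "K (snd p + s *\<^sub>R snd v) (snd p + s *\<^sub>R snd v) = 1 + s\<^sup>2 * k" for s
    using v quadric_commute[of c "snd p" "snd v"] p1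
    by (simp add: quadric_simps k_def power2_eq_square)
  show "\<gamma> 0 = p" by (simp add: \<gamma>_def r_def)
  show "snd (\<gamma> s) = r s *\<^sub>R (snd p + s *\<^sub>R snd v)" for s by (simp add: \<gamma>_def)
  show "r = (\<lambda>s. 1)" if "c = 0"
  proof -
    have "snd p \<in> space_form c" using p by (simp add: mem_L)
    then have "fst (snd v) = 0" using v that by (auto simp: quadric_def space_form_def)
    then show ?thesis using that by (auto simp: r_def k_def quadric_def)
  qed
  have r': "(r has_real_derivative 0) (at 0)"
    unfolding r_def by (auto intro!: derivative_eq_intros)
  show "(\<gamma> has_vector_derivative v) (at 0)"
  proof -
    have "(\<gamma> has_vector_derivative (fst v, r 0 *\<^sub>R snd v + 0 *\<^sub>R (snd p + 0 *\<^sub>R snd v))) (at 0)"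
      unfolding \<gamma>_def
    proof (intro has_vector_derivative_Pair has_vector_derivative_scaleR r')
      show "((\<lambda>s. fst p + s * fst v) has_vector_derivative fst v) (at 0)"
        by (auto intro!: derivative_eq_intros simp: has_real_derivative_iff_has_vector_derivative[symmetric])
      show "((\<lambda>s. snd p + s *\<^sub>R snd v) has_vector_derivative snd v) (at 0)"
        by (auto intro!: derivative_eq_intros)
    qed
    then show ?thesis by (simp add: r_def)
  qed
  have ev: "\<forall>\<^sub>F s in nhds 0. P (h s)" if "isCont h 0" "open {x. P x}" "P (h 0)" for h :: "real \<Rightarrow> real" and P
  proof -
    have "(h \<longlongrightarrow> h 0) (nhds 0)"
      using that(1) unfolding isCont_def by (rule tendsto_at_iff_tendsto_nhds[THEN iffD1])
    from topological_tendstoD[OF this that(2)] that(3) show ?thesis by simp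
  qed
  have e1: "\<forall>\<^sub>F s in nhds 0. 1 + s\<^sup>2 * k > 0"
    by (rule ev) (auto intro: open_Collect_less continuous_intros)
  have e2: "\<forall>\<^sub>F s in nhds 0. fst p + s * fst v \<in> I"
    by (rule ev) (use p open_I in \<open>auto simp: mem_L intro: continuous_intros\<close>)
  \<comment> \<open>For \<open>c = 0\<close> and \<open>c = -1\<close> a sign condition selects the
    hyperplane or the upper sheet; it is open and so persists for small \<open>s\<close>.\<close>
  have e3: "\<forall>\<^sub>F s in nhds 0. c \<le> 0 \<longrightarrow> fst (snd p) + s * fst (snd v) > 0"
  proof (cases "c \<le> 0")
    case True
    then have "fst (snd p) > 0" using p by (simp add: mem_L space_form_quadric)
    then have "\<forall>\<^sub>F s in nhds 0. fst (snd p) + s * fst (snd v) > 0"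
      by (intro ev) (auto intro: open_Collect_less continuous_intros)
    then show ?thesis by (rule eventually_mono) simp
  qed simp
  show "\<forall>\<^sub>F s in nhds 0. \<gamma> s \<in> L"
    using e1 e2 e3
  proof eventually_elim
    case (elim s)
    have "K (snd (\<gamma> s)) (snd (\<gamma> s)) = (r s)\<^sup>2 * (1 + s\<^sup>2 * k)"
      by (simp add: \<gamma>_def quadric.scaleR_left quadric.scaleR_right Kq power2_eq_square)
    also have "\<dots> = 1" using elim by (simp add: r_def power_inverse)
    finally have "K (snd (\<gamma> s)) (snd (\<gamma> s)) = 1" .
    moreover have "r s > 0" using elim by (simp add: r_def)
    ultimately show ?case using elim by (simp add: mem_L space_form_quadric \<gamma>_def)
  qed
qed

text \<open>\<open>K (snd p)\<close> is the differential at \<open>p\<close> of half the defining function of \<open>L\<close>.\<close>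
lemma tangent_space_L:
  assumes p: "p \<in> L"
  shows "tangent_space L p = {v. K (snd p) (snd v) = 0}"
proof (intro set_eqI iffI)
  fix v assume "v \<in> tangent_space L p"
  then obtain \<gamma> where \<gamma>: "\<gamma> 0 = p" "\<forall>\<^sub>F s in nhds (0::real). \<gamma> s \<in> L" "(\<gamma> has_vector_derivative v) (at 0)"
    by (auto simp: tangent_space_def)
  have "((\<lambda>q. K (snd q) (snd q)) has_derivative (\<lambda>v. K (snd (\<gamma> 0)) (snd v) + K (snd v) (snd (\<gamma> 0)))) (at (\<gamma> 0))"
    by (intro quadric.FDERIV has_derivative_snd has_derivative_ident)
  then have "K (snd (\<gamma> 0)) (snd v) + K (snd v) (snd (\<gamma> 0)) = 0"
    by (rule derivative_along_level_curve[OF \<gamma>(3), where k = 1])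
      (use \<gamma>(2) in \<open>auto elim!: eventually_mono simp: mem_L space_form_quadric\<close>)
  then show "v \<in> {v. K (snd p) (snd v) = 0}"
    using \<gamma>(1) quadric_commute[of c "snd v" "snd p"] by simp
next
  fix v :: rw_point assume "v \<in> {v. K (snd p) (snd v) = 0}"
  then have "K (snd p) (snd v) = 0" by simp
  from normalised_curve[OF p this] show "v \<in> tangent_space L p"
    unfolding tangent_space_def by blast
qed

lemma field_tangent: "Y \<in> vector_fields L \<Longrightarrow> p \<in> L \<Longrightarrow> K (snd p) (snd (Y p)) = 0"
  using tangent_space_L by (auto simp: vector_fields_def)

lemma field_has_derivative:
  assumes "Y \<in> vector_fields L" "p \<in> L"
  shows "(Y has_derivative frechet_derivative Y (at p)) (at p)"
  using assms smooth_on_has_derivative by (fastforce simp: vector_fields_def)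

text \<open>The ambient derivative of a tangent field need not be tangent. Its normal component,
  found by differentiating \<open>K (snd q) (snd (Y q)) = 0\<close>, is cancelled by that of
  \<open>christoffel\<close>.\<close>

lemma field_derivative_normal:
  assumes Y: "Y \<in> vector_fields L" and p: "p \<in> L" and v: "v \<in> tangent_space L p"
  shows "K (snd p) (snd (frechet_derivative Y (at p) v)) = - K (snd v) (snd (Y p))"
proof -
  obtain \<gamma> where \<gamma>: "\<gamma> 0 = p" "\<forall>\<^sub>F s in nhds (0::real). \<gamma> s \<in> L" "(\<gamma> has_vector_derivative v) (at 0)"
    using v by (auto simp: tangent_space_def)
  have "((\<lambda>q. K (snd q) (snd (Y q))) has_derivative
      (\<lambda>v. K (snd p) (snd (frechet_derivative Y (at p) v)) + K (snd v) (snd (Y p)))) (at p)"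
    by (intro quadric.FDERIV has_derivative_snd has_derivative_ident field_has_derivative[OF Y p])
  then have "((\<lambda>q. K (snd q) (snd (Y q))) has_derivative
      (\<lambda>v. K (snd p) (snd (frechet_derivative Y (at p) v)) + K (snd v) (snd (Y p)))) (at (\<gamma> 0))"
    by (simp add: \<gamma>(1))
  then have "K (snd p) (snd (frechet_derivative Y (at p) v)) + K (snd v) (snd (Y p)) = 0"
    by (rule derivative_along_level_curve[OF \<gamma>(3), where k = 0])
      (rule eventually_mono[OF \<gamma>(2) field_tangent[OF Y]])
  then show ?thesis by simp
qed

text \<open>The constant vector \<open>w\<close> projected to the tangent spaces along the position
  vector. This gives a global field through every tangent vector: test fields for the uniqueness of
  the connection, and spanning fields for \<open>cov_deriv\<close>.\<close>

definition extend :: "rw_point \<Rightarrow> rw_point \<Rightarrow> rw_point" where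
  "extend w q = w - K (snd q) (snd w) *\<^sub>R (0, snd q)"

lemma extend_tangent: "p \<in> L \<Longrightarrow> K (snd p) (snd (extend w p)) = 0"
  by (simp add: extend_def quadric_simps mem_L space_form_quadric)

lemma extend_eq: "K (snd p) (snd w) = 0 \<Longrightarrow> extend w p = w"
  by (simp add: extend_def zero_prod_def[symmetric])

lemma linear_extend: "linear (\<lambda>w. extend w p)"
  by (intro linearI) (simp_all add: extend_def quadric_simps scaleR_add_left scaleR_right_diff_distrib)

lemma extend_field: "extend w \<in> vector_fields L"
proof -
  have "smooth_on UNIV (\<lambda>q::rw_point. w + - (K (snd q) (snd w) *\<^sub>R (0, snd q) :: rw_point))"
  proof (rule smooth_on_add[OF open_UNIV smooth_on_const],
      rule smooth_on_bounded_linear[OF open_UNIV bounded_linear_minus[OF bounded_linear_ident]],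
      rule smooth_on_bilinear[OF open_UNIV bounded_bilinear_scaleR])
    show "smooth_on UNIV (\<lambda>q::rw_point. K (snd q) (snd w))"
      by (rule smooth_on_bounded_linear[OF open_UNIV _ smooth_on_ident])
        (auto intro: bounded_linear_compose[OF quadric.bounded_linear_left bounded_linear_snd])
    show "smooth_on UNIV (\<lambda>q::rw_point. (0, snd q) :: rw_point)"
      by (rule smooth_on_bounded_linear[OF open_UNIV _ smooth_on_ident])
        (auto intro: bounded_linear_Pair bounded_linear_zero bounded_linear_snd)
  qed
  then have "smooth_on UNIV (extend w)" by (simp only: extend_def[abs_def] diff_conv_add_uminus)
  then show ?thesis
    using extend_tangent tangent_space_L by (auto simp: vector_fields_def)
qed

text \<open>The terms with \<open>f'\<close> are the Christoffel symbols of the warped product. The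
  multiple of \<open>snd p\<close> is the correction of the Gauss formula that makes the flat
  derivative of the ambient space tangent to the space form.\<close>

definition christoffel :: "rw_point \<Rightarrow> rw_point \<Rightarrow> rw_point \<Rightarrow> rw_point" where
  "christoffel p v w = (f (fst p) * f' (fst p) * B (snd v) (snd w),
     (f' (fst p) / f (fst p)) *\<^sub>R (fst v *\<^sub>R snd w + fst w *\<^sub>R snd v)
     + (c * B (snd v) (snd w)) *\<^sub>R snd p)"

lemma christoffel_commute: "christoffel p v w = christoffel p w v"
  by (simp add: christoffel_def metric_commute add.commute)

lemma bilinear_christoffel: "bounded_bilinear (christoffel p)"
  unfolding bilinear_conv_bounded_bilinear[symmetric] bilinear_def
  by (intro conjI allI linearI prod_eqI) (simp_all add: christoffel_def metric_simps add_divide_distrib algebra_simps)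

sublocale christoffel: bounded_bilinear "christoffel p" for p
  by (rule bilinear_christoffel)

text \<open>For \<open>c = 1\<close> and \<open>c = -1\<close> the two forms differ by the factor
  \<open>c\<close>, and \<open>c * c = 1\<close>. For \<open>c = 0\<close> both sides vanish, since
  tangent vectors of the hyperplane have first component 0.\<close>

lemma c_metric:
  assumes "y \<in> space_form c" "K y v = 0" "K y w = 0"
  shows "c * B v w = K v w"
proof -
  have "fst v = 0" if "c = 0"
    using assms(1,2) that by (auto simp: quadric_def space_form_def)
  then show ?thesis
    using c by (auto simp: quadric_def space_form_metric_def algebra_simps)
qed

text \<open>The factor \<open>c\<close> makes the cases uniform: in the flat case the position
  vector need not be \<open>B\<close>-orthogonal to tangent vectors.\<close>

lemma c_metric_position:
  assumes "K y v = 0"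
  shows "c * B y v = 0"
  using c assms by (auto simp: quadric_def space_form_metric_def algebra_simps)

lemma christoffel_normal:
  assumes p: "p \<in> L" and v: "K (snd p) (snd v) = 0" and w: "K (snd p) (snd w) = 0"
  shows "K (snd p) (snd (christoffel p v w)) = K (snd v) (snd w)"
  using assms c_metric[OF _ v w]
  by (simp add: christoffel_def quadric_simps mem_L space_form_quadric)

lemma bilinear_g: "bounded_bilinear (g p)"
  unfolding bilinear_conv_bounded_bilinear[symmetric] bilinear_def
  by (intro conjI allI linearI) (simp_all add: rw_metric_def metric_simps algebra_simps)

sublocale g: bounded_bilinear "g p" for p
  by (rule bilinear_g)

lemma g_commute: "g p v w = g p w v"
  by (simp add: rw_metric_def metric_commute)

text \<open>Pairing with \<open>ddt\<close> kills the time component; what remains is tangent to the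
  space form, where the metric is positive definite, and is paired with itself.\<close>

lemma g_nondegenerate:
  assumes p: "p \<in> L" and v: "K (snd p) (snd v) = 0"
    and 0: "\<And>w. K (snd p) (snd w) = 0 \<Longrightarrow> g p v w = 0"
  shows "v = 0"
proof -
  have "fst v = 0" using 0[of "(1, 0)"] by (simp add: rw_metric_def metric.zero_right quadric.zero_right)
  moreover have "snd v = 0"
  proof (rule ccontr)
    assume "snd v \<noteq> 0"
    then have "B (snd v) (snd v) > 0" using metric_pos_def[OF c _ v] p by (simp add: mem_L)
    moreover have "(f (fst p))\<^sup>2 * B (snd v) (snd v) = 0"
      using 0[OF v] \<open>fst v = 0\<close> by (simp add: rw_metric_def)
    ultimately show False using f_neq_0 p by (simp add: mem_L)
  qed
  ultimately show ?thesis by (simp add: prod_eq_iff)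
qed

lemma f_derivative: "t \<in> I \<Longrightarrow> (f has_real_derivative f' t) (at t)"
  by (rule smooth_on_has_real_derivative[OF smooth_f])

text \<open>Stated along a map \<open>P\<close> into the space-time: the identity gives
  compatibility for fields on \<open>L\<close>, and \<open>\<phi>\<close> composed with the inverse
  of a chart gives it along the surface.\<close>

lemma metric_has_derivative:
  assumes P: "(P has_derivative P') (at x)" and V: "(V has_derivative V') (at x)"
    and W: "(W has_derivative W') (at x)"
    and L: "P x \<in> L" "K (snd (P x)) (snd (V x)) = 0" "K (snd (P x)) (snd (W x)) = 0"
  shows "((\<lambda>x. g (P x) (V x) (W x)) has_derivative (\<lambda>h.
    g (P x) (V' h + christoffel (P x) (P' h) (V x)) (W x)
    + g (P x) (V x) (W' h + christoffel (P x) (P' h) (W x)))) (at x)"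
proof -
  let ?t = "fst (P x)"
  have I: "?t \<in> I" using L by (simp add: mem_L)
  have "(f has_derivative (\<lambda>h. f' ?t * h)) (at ?t)"
    using f_derivative[OF I] by (simp add: has_field_derivative_def)
  from has_derivative_compose[OF has_derivative_fst[OF P] this]
  have df: "((\<lambda>x. f (fst (P x))) has_derivative (\<lambda>h. f' ?t * fst (P' h))) (at x)" .
  have "((\<lambda>x. - (fst (V x) * fst (W x)) + (f (fst (P x)) * f (fst (P x))) * B (snd (V x)) (snd (W x))) has_derivative
    (\<lambda>h. - (fst (V x) * fst (W' h) + fst (V' h) * fst (W x)) +
      ((f ?t * f ?t) * (B (snd (V x)) (snd (W' h)) + B (snd (V' h)) (snd (W x)))
      + (f ?t * (f' ?t * fst (P' h)) + (f' ?t * fst (P' h)) * f ?t) * B (snd (V x)) (snd (W x))))) (at x)"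
    by (intro has_derivative_add has_derivative_minus has_derivative_mult metric.FDERIV
        has_derivative_fst has_derivative_snd df V W)
  moreover have "- (fst (V x) * fst (W' h) + fst (V' h) * fst (W x)) +
      ((f ?t * f ?t) * (B (snd (V x)) (snd (W' h)) + B (snd (V' h)) (snd (W x)))
      + (f ?t * (f' ?t * fst (P' h)) + (f' ?t * fst (P' h)) * f ?t) * B (snd (V x)) (snd (W x)))
    = g (P x) (V' h + christoffel (P x) (P' h) (V x)) (W x)
      + g (P x) (V x) (W' h + christoffel (P x) (P' h) (W x))" for h
  proof -
    have "c * B (snd (P x)) (snd (W x)) = 0" "c * B (snd (V x)) (snd (P x)) = 0"
      using c_metric_position[OF L(2)] c_metric_position[OF L(3)] by (simp_all add: metric_commute)
    \<comment> \<open>Either alternative removes the contribution of the position vector in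
      \<open>christoffel\<close> to the products.\<close>
    then have 0: "c = 0 \<or> B (snd (P x)) (snd (W x)) = 0 \<and> B (snd (V x)) (snd (P x)) = 0" by auto
    have "f ?t \<noteq> 0" using f_neq_0[OF I] .
    then have ff: "f ?t * (f ?t * (f' ?t * z / f ?t)) = f ?t * (f' ?t * z)" for z by simp
    show ?thesis
      using 0 metric_commute[of c "snd (V x)" "snd (P' h)"]
      unfolding rw_metric_def christoffel_def
      by (elim disjE) (simp_all add: metric_simps power2_eq_square algebra_simps ff)
  qed
  ultimately show ?thesis by (simp add: rw_metric_def[abs_def] power2_eq_square)
qed

lemma connection_tangent:
  assumes "X \<in> vector_fields L" "Y \<in> vector_fields L" "p \<in> L"
  shows "K (snd p) (snd (D p (X p) Y)) = 0"
proof -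
  obtain Z where Z: "Z \<in> vector_fields L" "Z p = D p (X p) Y"
    using connection[unfolded levi_civita_def, THEN conjunct1] assms by blast
  then show ?thesis using field_tangent[OF Z(1) assms(3)] by simp
qed

lemma connection_metric:
  assumes "p \<in> L" "v \<in> tangent_space L p" "Y \<in> vector_fields L" "Z \<in> vector_fields L"
  shows "frechet_derivative (\<lambda>q. g q (Y q) (Z q)) (at p) v = g p (D p v Y) (Z p) + g p (Y p) (D p v Z)"
  using connection[unfolded levi_civita_def, THEN conjunct2, THEN conjunct2, THEN conjunct2, THEN conjunct2,
      THEN conjunct1] assms by blast

lemma connection_torsion:
  assumes "p \<in> L" "X \<in> vector_fields L" "Y \<in> vector_fields L"
  shows "D p (X p) Y - D p (Y p) X = frechet_derivative Y (at p) (X p) - frechet_derivative X (at p) (Y p)"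
  using connection[unfolded levi_civita_def, THEN conjunct2, THEN conjunct2, THEN conjunct2, THEN conjunct2,
      THEN conjunct2] assms by blast

text \<open>The difference of two metric torsion-free connections is symmetric in its first two arguments
  and skew in the last two, hence zero.\<close>
theorem connection_eq:
  assumes p: "p \<in> L" and v: "K (snd p) (snd v) = 0" and Y: "Y \<in> vector_fields L"
  shows "D p v Y = frechet_derivative Y (at p) v + christoffel p v (Y p)"
proof -
  define S where "S X Y = D p (X p) Y - (frechet_derivative Y (at p) (X p) + christoffel p (X p) (Y p))" for X Y
  let ?V = "vector_fields L"
  have tan: "X p \<in> tangent_space L p" "K (snd p) (snd (X p)) = 0" if "X \<in> ?V" for X
    using field_tangent[OF that p] tangent_space_L[OF p] by auto
  have S_tan: "K (snd p) (snd (S X Y)) = 0" if "X \<in> ?V" "Y \<in> ?V" for X Y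
    using connection_tangent[OF that p] field_derivative_normal[OF that(2) p tan(1)[OF that(1)]]
      christoffel_normal[OF p tan(2)[OF that(1)] tan(2)[OF that(2)]]
    by (simp add: S_def quadric_simps)
  have S_sym: "S X Y = S Y X" if "X \<in> ?V" "Y \<in> ?V" for X Y
    using connection_torsion[OF p that] christoffel_commute[of p "X p" "Y p"]
    by (simp add: S_def algebra_simps)
  have S_skew: "g p (S X Y) (Z p) = - g p (S X Z) (Y p)" if "X \<in> ?V" "Y \<in> ?V" "Z \<in> ?V" for X Y Z
  proof -
    have "frechet_derivative (\<lambda>q. g q (Y q) (Z q)) (at p) (X p) =
      g p (frechet_derivative Y (at p) (X p) + christoffel p (X p) (Y p)) (Z p)
      + g p (Y p) (frechet_derivative Z (at p) (X p) + christoffel p (X p) (Z p))"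
      using fun_cong[OF frechet_derivative_at[OF metric_has_derivative[OF has_derivative_ident
            field_has_derivative[OF that(2) p] field_has_derivative[OF that(3) p] p tan(2)[OF that(2)] tan(2)[OF that(3)]]],
            of "X p"]
      by simp
    then show ?thesis
      using connection_metric[OF p tan(1)[OF that(1)] that(2,3)]
        g_commute[of p "Y p"]
      by (simp add: S_def g.diff_left)
  qed
  have vV: "extend v \<in> ?V" "extend v p = v" using extend_field extend_eq[OF v] by auto
  have "S (extend v) Y = 0"
  proof (rule g_nondegenerate[OF p S_tan[OF vV(1) Y]])
    fix w :: rw_point assume "K (snd p) (snd w) = 0"
    then have w: "extend w \<in> ?V" "extend w p = w" using extend_field extend_eq by auto
    let ?X = "extend v" and ?Z = "extend w"
    \<comment> \<open>Alternating skewness and symmetry three times brings the arguments back to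
      their places and leaves an overall minus sign.\<close>
    have "g p (S ?X Y) (?Z p) = - g p (S ?Z ?X) (Y p)"
      using S_skew[OF vV(1) Y w(1)] S_sym[OF vV(1) w(1)] by simp
    also have "\<dots> = g p (S Y ?Z) (?X p)"
      using S_skew[OF w(1) Y vV(1)] S_sym[OF w(1) Y] by simp
    also have "\<dots> = - g p (S ?X Y) (?Z p)"
      using S_skew[OF Y vV(1) w(1)] S_sym[OF Y vV(1)] by simp
    finally show "g p (S ?X Y) w = 0" using w by simp
  qed
  then show ?thesis using vV by (simp add: S_def)
qed

end

section \<open>Surfaces in a Robertson-Walker space-time\<close>

context rw_spacetime
begin

text \<open>The derivative of \<open>christoffel p v w\<close> in its base point, in direction
  \<open>u\<close> with \<open>v\<close> and \<open>w\<close> held fixed: the coefficients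
  \<open>f f'\<close> and \<open>f'/f\<close> are differentiated in time, and the position becomes
  \<open>snd u\<close>.\<close>

definition christoffel_deriv :: "rw_point \<Rightarrow> rw_point \<Rightarrow> rw_point \<Rightarrow> rw_point \<Rightarrow> rw_point" where
  "christoffel_deriv p u v w =
    ((f' (fst p) * f' (fst p) + deriv f' (fst p) * f (fst p)) * fst u * B (snd v) (snd w),
     ((deriv f' (fst p) * f (fst p) - f' (fst p) * f' (fst p)) / (f (fst p) * f (fst p)) * fst u) *\<^sub>R
       (fst v *\<^sub>R snd w + fst w *\<^sub>R snd v)
     + (c * B (snd v) (snd w)) *\<^sub>R snd u)"

text \<open>The curvature tensor \<open>R(u, v)w\<close> with the convention
  \<open>[D_u, D_v] - D_[u, v]\<close>. The second derivative of \<open>f\<close> enters through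
  planes that contain \<open>ddt\<close>, the factor \<open>c + f'^2\<close> through planes tangent
  to the space form.\<close>

definition curvature :: "rw_point \<Rightarrow> rw_point \<Rightarrow> rw_point \<Rightarrow> rw_point \<Rightarrow> rw_point" where
  "curvature p u v w =
    (f (fst p) * deriv f' (fst p) * (fst u * B (snd v) (snd w) - fst v * B (snd u) (snd w)),
     (deriv f' (fst p) / f (fst p) * fst w) *\<^sub>R (fst u *\<^sub>R snd v - fst v *\<^sub>R snd u)
     + (c + (f' (fst p))\<^sup>2) *\<^sub>R (B (snd v) (snd w) *\<^sub>R snd u - B (snd u) (snd w) *\<^sub>R snd v))"

lemma smooth_f': "smooth_on I f'"
  by (rule smooth_on_deriv[OF open_I smooth_f])

lemma christoffel_has_derivative:
  assumes P: "(P has_derivative P') (at x)" and V: "(V has_derivative V') (at x)"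
    and W: "(W has_derivative W') (at x)" and I: "fst (P x) \<in> I"
  shows "((\<lambda>x. christoffel (P x) (V x) (W x)) has_derivative (\<lambda>h.
    christoffel_deriv (P x) (P' h) (V x) (W x)
    + (christoffel (P x) (V' h) (W x) + christoffel (P x) (V x) (W' h)))) (at x)"
proof -
  let ?t = "fst (P x)"
  have df: "(f has_real_derivative f' ?t) (at ?t)" by (rule f_derivative[OF I])
  have ddf: "(f' has_real_derivative deriv f' ?t) (at ?t)"
    by (rule smooth_on_has_real_derivative[OF smooth_f' I])
  have ff: "((\<lambda>x. f (fst (P x)) * f' (fst (P x))) has_derivative
      (\<lambda>h. (f' ?t * f' ?t + deriv f' ?t * f ?t) * fst (P' h))) (at x)"
    using has_derivative_compose[OF has_derivative_fst[OF P] DERIV_mult[OF df ddf, unfolded has_field_derivative_def]] .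
  have fq: "((\<lambda>x. f' (fst (P x)) / f (fst (P x))) has_derivative
      (\<lambda>h. (deriv f' ?t * f ?t - f' ?t * f' ?t) / (f ?t * f ?t) * fst (P' h))) (at x)"
    using has_derivative_compose[OF has_derivative_fst[OF P]
        DERIV_divide[OF ddf df f_neq_0[OF I], unfolded has_field_derivative_def]] .
  have "((\<lambda>x. (f (fst (P x)) * f' (fst (P x)) * B (snd (V x)) (snd (W x)),
     (f' (fst (P x)) / f (fst (P x))) *\<^sub>R (fst (V x) *\<^sub>R snd (W x) + fst (W x) *\<^sub>R snd (V x))
     + (c * B (snd (V x)) (snd (W x))) *\<^sub>R snd (P x))) has_derivative
    (\<lambda>h. (f ?t * f' ?t * (B (snd (V x)) (snd (W' h)) + B (snd (V' h)) (snd (W x)))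
       + (f' ?t * f' ?t + deriv f' ?t * f ?t) * fst (P' h) * B (snd (V x)) (snd (W x)),
      ((f' ?t / f ?t) *\<^sub>R ((fst (V x) *\<^sub>R snd (W' h) + fst (V' h) *\<^sub>R snd (W x))
          + (fst (W x) *\<^sub>R snd (V' h) + fst (W' h) *\<^sub>R snd (V x)))
        + ((deriv f' ?t * f ?t - f' ?t * f' ?t) / (f ?t * f ?t) * fst (P' h)) *\<^sub>R
          (fst (V x) *\<^sub>R snd (W x) + fst (W x) *\<^sub>R snd (V x)))
     + ((c * B (snd (V x)) (snd (W x))) *\<^sub>R snd (P' h)
        + (c * (B (snd (V x)) (snd (W' h)) + B (snd (V' h)) (snd (W x)))) *\<^sub>R snd (P x))))) (at x)"
    by (intro has_derivative_Pair has_derivative_add has_derivative_mult has_derivative_scaleR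
        has_derivative_mult_right metric.FDERIV has_derivative_fst has_derivative_snd ff fq P V W)
  then show ?thesis
    by (simp add: christoffel_def[abs_def] christoffel_deriv_def metric.add_left metric.add_right algebra_simps)
qed

text \<open>The usual formula in derivatives and products of Christoffel symbols; the flat part of
  the connection has no curvature. Tangency of \<open>u\<close> and \<open>v\<close> removes the
  products with the position vector.\<close>

lemma christoffel_curvature:
  assumes p: "p \<in> L" and u: "K (snd p) (snd u) = 0" and v: "K (snd p) (snd v) = 0"
  shows "christoffel_deriv p u v w - christoffel_deriv p v u w
    + (christoffel p u (christoffel p v w) - christoffel p v (christoffel p u w)) = curvature p u v w"
proof -
  \<comment> \<open>Writing both derivatives of \<open>f\<close> as multiples of \<open>f\<close>
    turns the claim into an identity without divisions.\<close>
  define h k where "h = f' (fst p) / f (fst p)" and "k = deriv f' (fst p) / f (fst p)"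
  have f0: "f (fst p) \<noteq> 0" using p f_neq_0 by (simp add: mem_L)
  have f': "f' (fst p) = h * f (fst p)" "deriv f' (fst p) = k * f (fst p)"
    using f0 by (simp_all add: h_def k_def)
  have hk: "(deriv f' (fst p) * f (fst p) - f' (fst p) * f' (fst p)) / (f (fst p) * f (fst p)) = k - h * h"
    "f' (fst p) / f (fst p) = h" "deriv f' (fst p) / f (fst p) = k"
    using f0 by (simp_all add: h_def k_def field_simps)
  have "c * B (snd p) (snd u) = 0" "c * B (snd p) (snd v) = 0"
    using c_metric_position u v by blast+
  then have c0: "c = 0 \<or> B (snd p) (snd u) = 0 \<and> B (snd p) (snd v) = 0
      \<and> B (snd u) (snd p) = 0 \<and> B (snd v) (snd p) = 0"
    by (auto simp: metric_commute)
  show ?thesis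
    using c0 metric_commute[of c "snd v" "snd u"]
    unfolding christoffel_deriv_def curvature_def christoffel_def hk unfolding f'
    by (elim disjE; intro prod_eqI) (simp_all add: metric_simps power2_eq_square algebra_simps)
qed

text \<open>For mutually orthogonal vectors the space form products reduce to products of time
  components, so every surviving term carries \<open>fst n * fst y\<close>. The factor in
  parentheses is the quantity that assumption (i) makes nonzero.\<close>

lemma curvature_normal:
  assumes p: "p \<in> L" and g: "g p x y = 0" "g p x n = 0" "g p y n = 0"
  shows "g p (curvature p x y x) n =
    g p x x * (deriv f' (fst p) / f (fst p) - ((f' (fst p))\<^sup>2 + c) / (f (fst p))\<^sup>2) * fst n * fst y"
proof -
  let ?F = "(f (fst p))\<^sup>2"
  have f0: "f (fst p) \<noteq> 0" using p f_neq_0 by (simp add: mem_L)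
  have B: "B (snd x) (snd y) = fst x * fst y / ?F" "B (snd x) (snd n) = fst x * fst n / ?F"
    "B (snd y) (snd n) = fst y * fst n / ?F" "B (snd x) (snd x) = (g p x x + fst x * fst x) / ?F"
    using g f0 by (simp_all add: rw_metric_def field_simps)
  have "g p (curvature p x y x) n =
    - (f (fst p) * deriv f' (fst p) * (fst x * B (snd x) (snd y) - fst y * B (snd x) (snd x)) * fst n)
    + ?F * (deriv f' (fst p) / f (fst p) * fst x * (fst x * B (snd y) (snd n) - fst y * B (snd x) (snd n))
       + (c + (f' (fst p))\<^sup>2) * (B (snd x) (snd y) * B (snd x) (snd n) - B (snd x) (snd x) * B (snd y) (snd n)))"
    using metric_commute[of c "snd y" "snd x"]
    unfolding rw_metric_def[of f c p "curvature p x y x"] unfolding curvature_def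
    by (simp add: metric_simps)
  also have "\<dots> = g p x x * (deriv f' (fst p) / f (fst p) - ((f' (fst p))\<^sup>2 + c) / ?F) * fst n * fst y"
    unfolding B using f0 by (simp add: field_simps power2_eq_square)
  finally show ?thesis .
qed

end

section \<open>The pullback connection of a surface\<close>

locale rw_surface = rw_spacetime c I f D + immersed_surface A \<phi>
  for c :: real and I :: "real set" and f :: "real \<Rightarrow> real"
    and D :: "rw_point \<Rightarrow> rw_point \<Rightarrow> (rw_point \<Rightarrow> rw_point) \<Rightarrow> rw_point"
    and A :: "('m::t2_space set \<times> ('m \<Rightarrow> real^2)) set"
    and \<phi> :: "'m \<Rightarrow> rw_point" +
  assumes immersed: "\<phi> p \<in> L" and spacelike: "spacelike g A \<phi>"
begin

abbreviation tangent :: "'m \<Rightarrow> rw_point \<Rightarrow> bool" where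
  "tangent q v \<equiv> K (snd (\<phi> q)) (snd v) = 0"

text \<open>The pullback connection without a choice of fields: the flat derivative along the
  surface plus a Christoffel term. \<open>cov_deriv_eq\<close> identifies it with
  \<open>cov_deriv\<close> on smooth maps with values tangent to the space-time.\<close>

definition nabla :: "'m \<Rightarrow> rw_point \<Rightarrow> ('m \<Rightarrow> rw_point) \<Rightarrow> rw_point" where
  "nabla p X V = dir p X V + christoffel (\<phi> p) X (V p)"

lemma time_in_I: "fst (\<phi> p) \<in> I"
  using immersed mem_L by blast

lemma position_quadric: "K (snd (\<phi> p)) (snd (\<phi> p)) = 1"
  using immersed[of p] by (simp add: mem_L space_form_quadric)

lemma dir_quadric:
  assumes "open U" "p \<in> U" "msmooth_on A U V" "X \<in> tangent_plane A \<phi> p"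
  shows "dir p X (\<lambda>q. K (snd (\<phi> q)) (snd (V q))) = K (snd (\<phi> p)) (snd (dir p X V)) + K (snd X) (snd (V p))"
  using dir_bilinear[OF assms(1,2) bilinear_quadric msmooth_snd[OF assms(1) msmooth_immersion]
      msmooth_snd[OF assms(1,3)]]
  by (simp add: dir_snd[OF assms(1,2) msmooth_immersion] dir_snd[OF assms(1-3)] dir_immersion[OF assms(4)])

lemma tangent_plane_tangent:
  assumes "X \<in> tangent_plane A \<phi> p"
  shows "tangent p X"
proof -
  have "K (snd (\<phi> p)) (snd X) + K (snd X) (snd (\<phi> p)) = 0"
    using dir_quadric[OF open_UNIV UNIV_I msmooth_immersion assms] dir_const[of p X "1::real"]
    by (simp add: position_quadric dir_immersion[OF assms])
  then show ?thesis using quadric_commute[of c "snd X"] by simp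
qed

lemma msmooth_field:
  assumes "open U" "E \<in> vector_fields L"
  shows "msmooth_on A U (\<lambda>q. E (\<phi> q))"
proof -
  obtain W where W: "open W" "L \<subseteq> W" "smooth_on W E" using assms by (auto simp: vector_fields_def)
  show ?thesis
    by (rule msmooth_compose[OF assms(1) msmooth_immersion W(1,3)]) (use W immersed in auto)
qed

text \<open>By the product rule and \<open>connection_eq\<close> the sum does not depend on the
  chosen representation of \<open>V\<close>; this is the uniqueness that the description in
  \<open>cov_deriv\<close> calls for.\<close>

lemma nabla_expansion:
  assumes U: "open U" "p \<in> U" and v: "\<And>i. i < n \<Longrightarrow> msmooth_on A U (v i)"
    and E: "\<And>i. i < n \<Longrightarrow> E i \<in> vector_fields L" and V: "\<And>q. q \<in> U \<Longrightarrow> V q = (\<Sum>i<n. v i q *\<^sub>R E i (\<phi> q))"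
    and X: "X \<in> tangent_plane A \<phi> p"
  shows "(\<Sum>i<n. dir p X (v i) *\<^sub>R E i (\<phi> p) + v i p *\<^sub>R D (\<phi> p) X (E i)) = nabla p X V"
proof -
  have "dir p X V = dir p X (\<lambda>q. \<Sum>i<n. v i q *\<^sub>R E i (\<phi> q))"
    by (rule dir_cong[OF U V])
  also have "\<dots> = (\<Sum>i<n. dir p X (\<lambda>q. v i q *\<^sub>R E i (\<phi> q)))"
    by (rule dir_sum[OF U]) (auto intro: msmooth_scaleR[OF U(1) v msmooth_field[OF U(1) E]])
  also have "\<dots> = (\<Sum>i<n. v i p *\<^sub>R frechet_derivative (E i) (at (\<phi> p)) X + dir p X (v i) *\<^sub>R E i (\<phi> p))"
  proof (rule sum.cong[OF refl])
    fix i assume "i \<in> {..<n}"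
    then have i: "i < n" by simp
    have "dir p X (\<lambda>q. E i (\<phi> q)) = frechet_derivative (E i) (at (\<phi> p)) X"
      using dir_compose[OF U msmooth_immersion field_has_derivative[OF E[OF i] immersed]]
      by (simp add: dir_immersion[OF X])
    then show "dir p X (\<lambda>q. v i q *\<^sub>R E i (\<phi> q)) =
        v i p *\<^sub>R frechet_derivative (E i) (at (\<phi> p)) X + dir p X (v i) *\<^sub>R E i (\<phi> p)"
      using dir_scaleR[OF U v[OF i] msmooth_field[OF U(1) E[OF i]]] by simp
  qed
  finally have d: "dir p X V = (\<Sum>i<n. v i p *\<^sub>R frechet_derivative (E i) (at (\<phi> p)) X + dir p X (v i) *\<^sub>R E i (\<phi> p))" .
  have "christoffel (\<phi> p) X (V p) = (\<Sum>i<n. v i p *\<^sub>R christoffel (\<phi> p) X (E i (\<phi> p)))"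
    by (simp add: V[OF U(2)] christoffel.sum_right christoffel.scaleR_right)
  moreover have "D (\<phi> p) X (E i) = frechet_derivative (E i) (at (\<phi> p)) X + christoffel (\<phi> p) X (E i (\<phi> p))"
    if "i < n" for i
    by (rule connection_eq[OF immersed tangent_plane_tangent[OF X] E[OF that]])
  ultimately show ?thesis
    by (simp add: nabla_def d scaleR_add_right sum.distrib algebra_simps)
qed

lemma cov_deriv_eq:
  assumes U: "open U" "p \<in> U" and V: "msmooth_on A U V" "\<And>q. q \<in> U \<Longrightarrow> tangent q (V q)"
    and X: "X \<in> tangent_plane A \<phi> p"
  shows "cov_deriv L D A \<phi> p X V = nabla p X V"
  unfolding cov_deriv_def
proof (rule the_equality)
  obtain b :: "nat \<Rightarrow> rw_point" and n where b: "bij_betw b {..<n} Basis"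
    using ex_bij_betw_nat_finite[OF finite_Basis] by (auto simp: atLeast0LessThan)
  \<comment> \<open>Coordinates of \<open>V\<close> in the ambient basis, with the projected basis
    vectors as fields. Projecting does not change the sum, because \<open>V\<close> is tangent and
    the projection is linear.\<close>
  let ?v = "\<lambda>i q. V q \<bullet> b i" and ?E = "\<lambda>i. extend (b i)"
  have v: "msmooth_on A U (?v i)" for i
    by (rule msmooth_bounded_linear[OF U(1) bounded_linear_inner_left V(1)])
  have rep: "V q = (\<Sum>i<n. ?v i q *\<^sub>R ?E i (\<phi> q))" if "q \<in> U" for q
  proof -
    have e: "V q = (\<Sum>i<n. ?v i q *\<^sub>R b i)"
      unfolding sum.reindex_bij_betw[OF b, of "\<lambda>e. (V q \<bullet> e) *\<^sub>R e"] by (simp add: euclidean_representation)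
    have "V q = extend (V q) (\<phi> q)" by (simp add: extend_eq V(2)[OF that])
    also have "\<dots> = extend (\<Sum>i<n. ?v i q *\<^sub>R b i) (\<phi> q)" using e by simp
    also have "\<dots> = (\<Sum>i<n. ?v i q *\<^sub>R ?E i (\<phi> q))"
      by (simp add: linear_sum[OF linear_extend] linear_scale[OF linear_extend])
    finally show ?thesis .
  qed
  show "\<exists>U (n::nat) v E. open U \<and> p \<in> U \<and>
     (\<forall>i<n. msmooth_on A U (v i) \<and> E i \<in> vector_fields L) \<and>
     (\<forall>q\<in>U. V q = (\<Sum>i<n. v i q *\<^sub>R E i (\<phi> q))) \<and>
     nabla p X V = (\<Sum>i<n. dir p X (v i) *\<^sub>R E i (\<phi> p) + v i p *\<^sub>R D (\<phi> p) X (E i))"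
  proof (rule exI[of _ U], rule exI[of _ n], rule exI[of _ ?v], rule exI[of _ ?E], intro conjI allI impI ballI)
    show "nabla p X V = (\<Sum>i<n. dir p X (?v i) *\<^sub>R ?E i (\<phi> p) + ?v i p *\<^sub>R D (\<phi> p) X (?E i))"
      by (rule nabla_expansion[OF U v extend_field rep X, symmetric])
  qed (use U v extend_field rep in auto)
next
  fix Z assume "\<exists>U (n::nat) v E. open U \<and> p \<in> U \<and>
     (\<forall>i<n. msmooth_on A U (v i) \<and> E i \<in> vector_fields L) \<and>
     (\<forall>q\<in>U. V q = (\<Sum>i<n. v i q *\<^sub>R E i (\<phi> q))) \<and>
     Z = (\<Sum>i<n. dir p X (v i) *\<^sub>R E i (\<phi> p) + v i p *\<^sub>R D (\<phi> p) X (E i))"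
  then obtain U and n :: nat and v E where h: "open U" "p \<in> U"
     "\<forall>i<n. msmooth_on A U (v i) \<and> E i \<in> vector_fields L"
     "\<forall>q\<in>U. V q = (\<Sum>i<n. v i q *\<^sub>R E i (\<phi> q))"
     and Z: "Z = (\<Sum>i<n. dir p X (v i) *\<^sub>R E i (\<phi> p) + v i p *\<^sub>R D (\<phi> p) X (E i))"
    by blast
  show "Z = nabla p X V"
    unfolding Z by (rule nabla_expansion[OF h(1,2) _ _ _ X]) (use h in auto)
qed

lemma nabla_tangent:
  assumes U: "open U" "p \<in> U" and V: "msmooth_on A U V" "\<And>q. q \<in> U \<Longrightarrow> tangent q (V q)"
    and X: "X \<in> tangent_plane A \<phi> p"
  shows "tangent p (nabla p X V)"
proof -
  have "dir p X (\<lambda>q. K (snd (\<phi> q)) (snd (V q))) = dir p X (\<lambda>q. 0)"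
    by (rule dir_cong[OF U]) (rule V(2))
  then have "K (snd (\<phi> p)) (snd (dir p X V)) + K (snd X) (snd (V p)) = 0"
    using dir_quadric[OF U V(1) X] by (simp add: dir_const)
  then show ?thesis
    using christoffel_normal[OF immersed tangent_plane_tangent[OF X] V(2)[OF U(2)]]
    by (simp add: nabla_def quadric_simps)
qed

lemma nabla_metric:
  assumes U: "open U" "p \<in> U" and V: "msmooth_on A U V" "tangent p (V p)"
    and W: "msmooth_on A U W" "tangent p (W p)" and X: "X \<in> tangent_plane A \<phi> p"
  shows "dir p X (\<lambda>q. g (\<phi> q) (V q) (W q)) = g (\<phi> p) (nabla p X V) (W p) + g (\<phi> p) (V p) (nabla p X W)"
proof -
  obtain Dm x where ch: "chart_at A p = (Dm, x)" by fastforce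
  have p: "inv_into Dm x (x p) = p" using chart_at[OF ch] by simp
  have "mdiff A (\<lambda>q. g (\<phi> q) (V q) (W q)) p = (\<lambda>h.
    g (\<phi> p) (mdiff A V p h + christoffel (\<phi> p) (mdiff A \<phi> p h) (V p)) (W p)
    + g (\<phi> p) (V p) (mdiff A W p h + christoffel (\<phi> p) (mdiff A \<phi> p h) (W p)))"
    using mdiff_eqI[OF ch metric_has_derivative[OF mdiff_has_derivative[OF U msmooth_immersion ch]
          mdiff_has_derivative[OF U V(1) ch] mdiff_has_derivative[OF U W(1) ch]]] immersed V(2) W(2)
    by (simp add: p)
  then show ?thesis
    using dir_immersion[OF X] by (simp add: dir_deriv_def nabla_def)
qed

lemma nabla_torsion: "nabla p (X p) Y - nabla p (Y p) X = bracket X Y p"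
  by (simp add: nabla_def bracket_def christoffel_commute[of "\<phi> p" "X p"])

lemma nabla_linear:
  assumes "open U" "p \<in> U" "msmooth_on A U V" "X \<in> tangent_plane A \<phi> p" "Y \<in> tangent_plane A \<phi> p"
  shows "nabla p (a *\<^sub>R X + b *\<^sub>R Y) V = a *\<^sub>R nabla p X V + b *\<^sub>R nabla p Y V"
  by (simp add: nabla_def dir_linear[OF assms] christoffel.add_left christoffel.scaleR_left scaleR_add_right)

lemma msmooth_Pair:
  assumes "open U" "msmooth_on A U F" "msmooth_on A U G"
  shows "msmooth_on A U (\<lambda>q. (F q, G q))"
proof -
  have "msmooth_on A U (\<lambda>q. (F q, 0) + (0, G q))"
    by (intro msmooth_add[OF assms(1)] msmooth_bounded_linear[OF assms(1) _ assms(2)]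
        msmooth_bounded_linear[OF assms(1) _ assms(3)] bounded_linear_Pair bounded_linear_ident bounded_linear_zero)
  then show ?thesis by simp
qed

lemma msmooth_on_time:
  assumes "open U" "smooth_on I h"
  shows "msmooth_on A U (\<lambda>q. h (fst (\<phi> q)))"
  by (rule msmooth_compose[OF assms(1) msmooth_fst[OF assms(1) msmooth_immersion] open_I assms(2) time_in_I])

lemma msmooth_nabla:
  assumes U: "open U" and X: "tangent_field_on A \<phi> U X" and V: "msmooth_on A U V"
  shows "msmooth_on A U (\<lambda>q. nabla q (X q) V)"
proof -
  have Xs: "msmooth_on A U X" using X by (simp add: tangent_field_on_def)
  have B: "msmooth_on A U (\<lambda>q. B (snd (X q)) (snd (V q)))"
    by (intro msmooth_bilinear[OF U bilinear_space_form_metric] msmooth_snd[OF U] Xs V)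
  have inv: "smooth_on I (\<lambda>t. inverse (f t))"
    by (rule smooth_on_inverse[OF open_I smooth_f f_neq_0])
  show ?thesis
    unfolding nabla_def christoffel_def divide_inverse
    by (intro msmooth_add[OF U] msmooth_dir[OF U X V] msmooth_Pair[OF U] msmooth_mult[OF U]
        msmooth_scaleR[OF U] msmooth_on_time[OF U] msmooth_const msmooth_fst[OF U] msmooth_snd[OF U]
        smooth_f smooth_f' inv B Xs V msmooth_immersion)
qed

lemma msmooth_g:
  assumes U: "open U" and V: "msmooth_on A U V" and W: "msmooth_on A U W"
  shows "msmooth_on A U (\<lambda>q. g (\<phi> q) (V q) (W q))"
  unfolding rw_metric_def power2_eq_square
  by (intro msmooth_add[OF U] msmooth_minus[OF U] msmooth_mult[OF U] msmooth_on_time[OF U] smooth_f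
      msmooth_bilinear[OF U bilinear_space_form_metric] msmooth_fst[OF U] msmooth_snd[OF U] V W)

text \<open>Second derivatives of \<open>V\<close> combine to a derivative along the bracket, terms
  with one derivative of \<open>V\<close> cancel in pairs, and derivatives of \<open>X\<close> and
  \<open>Y\<close> inside \<open>christoffel\<close> form the bracket. Only the terms of
  \<open>christoffel_curvature\<close> remain.\<close>

theorem nabla_curvature:
  assumes U: "open U" "p \<in> U" and X: "tangent_field_on A \<phi> U X" and Y: "tangent_field_on A \<phi> U Y"
    and V: "msmooth_on A U V"
  shows "nabla p (X p) (\<lambda>q. nabla q (Y q) V) - nabla p (Y p) (\<lambda>q. nabla q (X q) V) - nabla p (bracket X Y p) V
    = curvature (\<phi> p) (X p) (Y p) (V p)"
proof -
  have d: "nabla p (Z p) (\<lambda>q. nabla q (W q) V) = dir p (Z p) (\<lambda>q. dir q (W q) V)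
      + (christoffel_deriv (\<phi> p) (Z p) (W p) (V p) + (christoffel (\<phi> p) (dir p (Z p) W) (V p)
        + christoffel (\<phi> p) (W p) (dir p (Z p) V)))
      + (christoffel (\<phi> p) (Z p) (dir p (W p) V) + christoffel (\<phi> p) (Z p) (christoffel (\<phi> p) (W p) (V p)))"
    if Z: "tangent_field_on A \<phi> U Z" and W: "tangent_field_on A \<phi> U W" for Z W
  proof -
    have Ws: "msmooth_on A U W" using W by (simp add: tangent_field_on_def)
    have Zp: "Z p \<in> tangent_plane A \<phi> p" using Z U by (simp add: tangent_field_on_def)
    obtain Dm x where ch: "chart_at A p = (Dm, x)" by fastforce
    have p: "inv_into Dm x (x p) = p" using chart_at[OF ch] by simp
    have "mdiff A (\<lambda>q. christoffel (\<phi> q) (W q) (V q)) p = (\<lambda>h.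
        christoffel_deriv (\<phi> p) (mdiff A \<phi> p h) (W p) (V p)
        + (christoffel (\<phi> p) (mdiff A W p h) (V p) + christoffel (\<phi> p) (W p) (mdiff A V p h)))"
      using mdiff_eqI[OF ch christoffel_has_derivative[OF mdiff_has_derivative[OF U msmooth_immersion ch]
          mdiff_has_derivative[OF U Ws ch] mdiff_has_derivative[OF U V ch]]] time_in_I
      by (simp add: p)
    then have 1: "dir p (Z p) (\<lambda>q. christoffel (\<phi> q) (W q) (V q)) = christoffel_deriv (\<phi> p) (Z p) (W p) (V p)
        + (christoffel (\<phi> p) (dir p (Z p) W) (V p) + christoffel (\<phi> p) (W p) (dir p (Z p) V))"
      using dir_immersion[OF Zp] by (simp add: dir_deriv_def)
    have "msmooth_on A U (\<lambda>q. (nabla q (W q) V) - dir q (W q) V)"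
      by (rule msmooth_diff[OF U(1) msmooth_nabla[OF U(1) W V] msmooth_dir[OF U(1) W V]])
    then have "msmooth_on A U (\<lambda>q. christoffel (\<phi> q) (W q) (V q))" by (simp add: nabla_def)
    from dir_add[OF U msmooth_dir[OF U(1) W V] this] 1 show ?thesis
      by (simp add: nabla_def christoffel.add_right)
  qed
  have Xp: "X p \<in> tangent_plane A \<phi> p" and Yp: "Y p \<in> tangent_plane A \<phi> p"
    using X Y U by (simp_all add: tangent_field_on_def)
  have "christoffel (\<phi> p) (dir p (X p) Y) (V p) - christoffel (\<phi> p) (dir p (Y p) X) (V p)
      = christoffel (\<phi> p) (bracket X Y p) (V p)"
    by (simp add: bracket_def christoffel.diff_left)
  then show ?thesis
    using bracket(2)[OF U X Y V] christoffel_curvature[OF immersed tangent_plane_tangent[OF Xp]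
        tangent_plane_tangent[OF Yp], of "V p"]
    unfolding d[OF X Y] d[OF Y X]
    by (simp add: nabla_def[of p "bracket X Y p"] algebra_simps)
qed

end

section \<open>Totally geodesic hypersurfaces\<close>

context rw_spacetime
begin

text \<open>Under the conditions below, the product of \<open>I\<close> with a totally geodesic
  surface of the space form: a section by a hyperplane through the origin for nonzero
  \<open>c\<close>, an affine plane for \<open>c = 0\<close>.\<close>

definition slice :: "real \<times> (real^3) \<Rightarrow> real \<Rightarrow> rw_point set" where
  "slice \<zeta> k = {q \<in> L. B \<zeta> (snd q) = k}"

text \<open>The last two conditions express that \<open>\<zeta>\<close> is tangent to the space form along the slice.\<close>
lemma totally_geodesic_slice:
  assumes \<zeta>: "B \<zeta> \<zeta> = 1" "c * k = 0" "c = 0 \<Longrightarrow> fst \<zeta> = 0"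
  shows "totally_geodesic_hypersurface L g D (slice \<zeta> k)"
proof -
  let ?N = "slice \<zeta> k"
  have NL: "q \<in> L" "B \<zeta> (snd q) = k" if "q \<in> ?N" for q
    using that by (auto simp: slice_def)
  have K\<zeta>: "K (snd q) \<zeta> = 0" if "q \<in> ?N" for q
  proof (cases "c = 0")
    case True
    then show ?thesis using \<zeta>(3) by (simp add: quadric_def)
  next
    case False
    then have "c * c = 1" using c by auto
    then have "K (snd q) \<zeta> = c * B \<zeta> (snd q)"
      by (simp add: quadric_def space_form_metric_def algebra_simps inner_commute)
    then show ?thesis using NL(2)[OF that] \<zeta>(2) by simp
  qed
  have dB: "((\<lambda>q::rw_point. B \<zeta> (snd q)) has_derivative (\<lambda>v. B \<zeta> (snd v))) (at q)" for q
    by (rule bounded_linear.has_derivative[OF metric.bounded_linear_right has_derivative_snd[OF has_derivative_ident]])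
  have TN: "tangent_space ?N q = {v. K (snd q) (snd v) = 0 \<and> B \<zeta> (snd v) = 0}" if q: "q \<in> ?N" for q
  proof (intro set_eqI iffI)
    fix v assume "v \<in> tangent_space ?N q"
    then obtain \<gamma> where \<gamma>: "\<gamma> 0 = q" "\<forall>\<^sub>F s in nhds (0::real). \<gamma> s \<in> ?N" "(\<gamma> has_vector_derivative v) (at 0)"
      by (auto simp: tangent_space_def)
    have "\<forall>\<^sub>F s in nhds 0. \<gamma> s \<in> L" by (rule eventually_mono[OF \<gamma>(2) NL(1)])
    then have "v \<in> tangent_space L q" using \<gamma> by (auto simp: tangent_space_def)
    moreover have "B \<zeta> (snd v) = 0"
      by (rule derivative_along_level_curve[OF \<gamma>(3) dB eventually_mono[OF \<gamma>(2) NL(2)]])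
    ultimately show "v \<in> {v. K (snd q) (snd v) = 0 \<and> B \<zeta> (snd v) = 0}"
      using tangent_space_L[OF NL(1)[OF q]] by simp
  next
    fix v :: rw_point assume "v \<in> {v. K (snd q) (snd v) = 0 \<and> B \<zeta> (snd v) = 0}"
    then have v: "K (snd q) (snd v) = 0" "B \<zeta> (snd v) = 0" by auto
    obtain \<gamma> r where \<gamma>: "\<gamma> 0 = q" "\<forall>\<^sub>F s in nhds 0. \<gamma> s \<in> L" "(\<gamma> has_vector_derivative v) (at 0)"
      "\<And>s. snd (\<gamma> s) = r s *\<^sub>R (snd q + s *\<^sub>R snd v)" "c = 0 \<Longrightarrow> r = (\<lambda>s. 1)"
      using normalised_curve[OF NL(1)[OF q] v(1)] by blast
    \<comment> \<open>Rescaling multiplies the value by \<open>r s\<close>. This is harmless: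
      \<open>k = 0\<close> for nonzero \<open>c\<close>, and \<open>r = 1\<close> for
      \<open>c = 0\<close>.\<close>
    have "B \<zeta> (snd (\<gamma> s)) = k" for s
    proof -
      have "B \<zeta> (snd (\<gamma> s)) = r s * k"
        using v(2) NL(2)[OF q] by (simp add: \<gamma>(4) metric_simps)
      then show ?thesis using \<zeta>(2) \<gamma>(5) by (cases "c = 0") auto
    qed
    then have "\<forall>\<^sub>F s in nhds 0. \<gamma> s \<in> ?N"
      by (intro eventually_mono[OF \<gamma>(2)]) (simp add: slice_def)
    then show "v \<in> tangent_space ?N q" using \<gamma> by (auto simp: tangent_space_def)
  qed
  have "hypersurface L ?N"
    unfolding hypersurface_def
  proof (intro conjI ballI)
    show "?N \<subseteq> L" using NL by blast
    fix q assume q: "q \<in> ?N"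
    let ?F = "\<lambda>q::rw_point. B \<zeta> (snd q) + - k"
    have "smooth_on UNIV ?F"
      by (intro smooth_on_add smooth_on_const smooth_on_bounded_linear[OF _ _ smooth_on_ident] open_UNIV
          bounded_linear_compose[OF metric.bounded_linear_right bounded_linear_snd])
    moreover have "?N \<inter> UNIV = {q \<in> L \<inter> UNIV. ?F q = 0}" by (auto simp: slice_def)
    moreover have "(?F has_derivative (\<lambda>v. B \<zeta> (snd v) + 0)) (at q)"
      by (intro has_derivative_add dB has_derivative_const)
    then have "frechet_derivative ?F (at q) (0, \<zeta>) = 1"
      using \<zeta>(1) by (simp add: frechet_derivative_at[symmetric])
    moreover have "(0, \<zeta>) \<in> tangent_space L q" using K\<zeta>[OF q] tangent_space_L[OF NL(1)[OF q]] by simp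
    ultimately show "\<exists>W (F::rw_point \<Rightarrow> real). open W \<and> q \<in> W \<and> smooth_on W F \<and> ?N \<inter> W = {q \<in> L \<inter> W. F q = 0} \<and>
        (\<exists>v\<in>tangent_space L q. frechet_derivative F (at q) v \<noteq> 0)"
      by (intro exI[of _ UNIV] exI[of _ ?F] conjI bexI[of _ "(0, \<zeta>)"]) auto
  qed
  moreover have "v = 0" if q: "q \<in> ?N" and v: "v \<in> tangent_space ?N q"
    and 0: "\<forall>w\<in>tangent_space ?N q. g q v w = 0" for q v
  proof (rule g_nondegenerate[OF NL(1)[OF q]])
    have v': "K (snd q) (snd v) = 0" "B \<zeta> (snd v) = 0" using v TN[OF q] by auto
    then show "K (snd q) (snd v) = 0" by simp
    fix w :: rw_point assume w: "K (snd q) (snd w) = 0"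
    \<comment> \<open>The component of \<open>w\<close> along the unit normal
      \<open>(0, \<zeta>)\<close> of the slice is removed; \<open>v\<close> is orthogonal to that
      normal, so testing on the slice is enough for \<open>g_nondegenerate\<close>.\<close>
    let ?w = "w - B \<zeta> (snd w) *\<^sub>R (0, \<zeta>)"
    have "?w \<in> tangent_space ?N q"
      using w K\<zeta>[OF q] \<zeta>(1) by (simp add: TN[OF q] quadric_simps metric_simps)
    then have "g q v ?w = 0" using 0 by blast
    moreover have "g q v (0, \<zeta>) = 0" using v'(2) by (simp add: rw_metric_def metric_commute)
    ultimately show "g q v w = 0" by (simp add: g.diff_right g.scaleR_right del: scaleR_Pair)
  qed
  moreover have "D q v Y \<in> tangent_space ?N q"
    if Y: "Y \<in> vector_fields L" and YN: "\<forall>q\<in>?N. Y q \<in> tangent_space ?N q"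
      and q: "q \<in> ?N" and v: "v \<in> tangent_space ?N q" for q v Y
  proof -
    have v': "K (snd q) (snd v) = 0" "B \<zeta> (snd v) = 0" using v TN[OF q] by auto
    have D: "D q v Y = frechet_derivative Y (at q) v + christoffel q v (Y q)"
      by (rule connection_eq[OF NL(1)[OF q] v'(1) Y])
    have "K (snd q) (snd (D q v Y)) = 0"
      using connection_tangent[OF extend_field Y NL(1)[OF q], of v] extend_eq[OF v'(1)] by simp
    obtain \<gamma> where \<gamma>: "\<gamma> 0 = q" "\<forall>\<^sub>F s in nhds (0::real). \<gamma> s \<in> ?N" "(\<gamma> has_vector_derivative v) (at 0)"
      using v by (auto simp: tangent_space_def)
    have BY: "B \<zeta> (snd (Y q)) = 0" if "q \<in> ?N" for q using YN TN[OF that] that by auto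
    have "((\<lambda>q. B \<zeta> (snd (Y q))) has_derivative (\<lambda>v. B \<zeta> (snd (frechet_derivative Y (at q) v)))) (at (\<gamma> 0))"
      unfolding \<gamma>(1)
      by (rule bounded_linear.has_derivative[OF metric.bounded_linear_right
            has_derivative_snd[OF field_has_derivative[OF Y NL(1)[OF q]]]])
    then have "B \<zeta> (snd (frechet_derivative Y (at q) v)) = 0"
      by (rule derivative_along_level_curve[OF \<gamma>(3) _ eventually_mono[OF \<gamma>(2) BY]])
    \<comment> \<open>The space form part of \<open>christoffel\<close> is a combination of those of
      \<open>v\<close> and \<open>Y q\<close>, where \<open>B \<zeta>\<close> vanishes, and of the
      position, where it gives \<open>k\<close> with a factor \<open>c\<close>.\<close>
    moreover have "B \<zeta> (snd (christoffel q v (Y q))) = 0"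
      using v'(2) BY[OF q] NL(2)[OF q] \<zeta>(2) by (auto simp: christoffel_def metric_simps)
    ultimately have "B \<zeta> (snd (D q v Y)) = 0" by (simp add: D metric.add_right)
    then show ?thesis using \<open>K (snd q) (snd (D q v Y)) = 0\<close> TN[OF q] by simp
  qed
  ultimately show ?thesis unfolding totally_geodesic_hypersurface_def by blast
qed

text \<open>The metric is indefinite, so definiteness is replaced by the condition that no vector of
  the set is light-like.\<close>

lemma g_orthogonal_independent:
  assumes "finite S" "\<And>v. v \<in> S \<Longrightarrow> g p v v \<noteq> 0" "\<And>v w. v \<in> S \<Longrightarrow> w \<in> S \<Longrightarrow> v \<noteq> w \<Longrightarrow> g p v w = 0"
  shows "independent S"
proof
  assume "dependent S"
  then obtain u w where u: "w \<in> S" "u w \<noteq> 0" "(\<Sum>v\<in>S. u v *\<^sub>R v) = 0"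
    using dependent_finite[OF assms(1)] by blast
  have "0 = g p (\<Sum>v\<in>S. u v *\<^sub>R v) w" by (simp add: u(3) g.zero_left)
  also have "\<dots> = (\<Sum>v\<in>S. u v * g p v w)" by (simp add: g.sum_left g.scaleR_left)
  also have "\<dots> = (\<Sum>v\<in>S. if v = w then u w * g p w w else 0)"
    using assms(3) u(1) by (intro sum.cong) auto
  also have "\<dots> = u w * g p w w" using assms(1) u(1) by simp
  finally show False using u(2) assms(2)[OF u(1)] by simp
qed

end

section \<open>Maps with vanishing differential and combinations of tangent fields\<close>

context immersed_surface
begin

lemma msmooth_continuous_on:
  assumes "open U" "msmooth_on A U F"
  shows "continuous_on U F"
  unfolding continuous_on_eq_continuous_at[OF assms(1)]
proof
  fix p assume p: "p \<in> U"
  obtain D x where ch: "chart_at A p = (D, x)" by fastforce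
  note D = chart_at[OF ch]
  have x: "continuous_on D x"
    using atlas D by (auto simp: smooth_atlas_def homeomorphism_def)
  have "continuous_on (D \<inter> U) (\<lambda>q. F (inv_into D x (x q)))"
    by (rule continuous_on_compose2[OF smooth_on_continuous_on[OF msmooth_smooth_on[OF assms(2) D(1)]]
          continuous_on_subset[OF x]]) auto
  then have "continuous_on (D \<inter> U) F"
    by (rule continuous_on_eq) (use D in auto)
  then show "isCont F p"
    using continuous_on_eq_continuous_at[OF open_Int[OF chart_open(1)[OF D(1)] assms(1)]] D p by blast
qed

text \<open>A ball in the image of a chart is convex, so a vanishing differential makes the map
  constant on it; its preimage within \<open>U\<close> is the neighbourhood
  \<open>V\<close>.\<close>

lemma locally_constant:
  assumes U: "open U" "p \<in> U" and F: "msmooth_on A U F"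
    and 0: "\<And>q X. q \<in> U \<Longrightarrow> X \<in> tangent_plane A \<phi> q \<Longrightarrow> dir q X F = 0"
  obtains V where "open V" "p \<in> V" "V \<subseteq> U" "\<And>q. q \<in> V \<Longrightarrow> F q = F p"
proof -
  obtain D x where ch: "chart_at A p = (D, x)" by fastforce
  note D = chart_at[OF ch]
  have x: "continuous_on D x"
    using atlas D by (auto simp: smooth_atlas_def homeomorphism_def)
  let ?O = "x ` (D \<inter> U)"
  have "open ?O" "x p \<in> ?O" using chart_open_image[OF D(1) U(1)] D U by auto
  then obtain r where r: "r > 0" "ball (x p) r \<subseteq> ?O" by (meson openE)
  have d: "((\<lambda>u. F (inv_into D x u)) has_derivative (\<lambda>h. 0)) (at u within ball (x p) r)" if u: "u \<in> ball (x p) r" for u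
  proof -
    obtain q where q: "q \<in> D" "q \<in> U" "u = x q" using u r by blast
    have "frechet_derivative (\<lambda>u. F (inv_into D x u)) (at (x q)) = (\<lambda>h. 0)"
    proof
      fix \<xi>
      show "frechet_derivative (\<lambda>u. F (inv_into D x u)) (at (x q)) \<xi> = 0"
        using chart_differential(3)[OF D(1) q(1) U(1) q(2) F, of \<xi>] 0[OF q(2)]
          chart_differential(2)[OF D(1) q(1)] by simp
    qed
    then show ?thesis
      using msmooth_has_derivative[OF U(1) q(2) F D(1) q(1)] q(3) by (simp add: has_derivative_at_withinI)
  qed
  have const: "F (inv_into D x u) = F p" if u: "u \<in> ball (x p) r" for u
  proof -
    have "\<exists>k. \<forall>u\<in>ball (x p) r. F (inv_into D x u) = k"
      by (rule has_derivative_zero_constant[OF convex_ball d])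
    then show ?thesis using u r(1) D by (metis centre_in_ball chart_inv)
  qed
  show ?thesis
  proof
    show "open (x -` ball (x p) r \<inter> D \<inter> U)"
      using continuous_on_open_vimage[OF chart_open(1)[OF D(1)]] x U(1) by (metis open_Int open_ball)
    show "p \<in> x -` ball (x p) r \<inter> D \<inter> U" using D U r by simp
    show "x -` ball (x p) r \<inter> D \<inter> U \<subseteq> U" by blast
    show "F q = F p" if "q \<in> x -` ball (x p) r \<inter> D \<inter> U" for q
      using that const[of "x q"] D by auto
  qed
qed

lemma tangent_field_combination:
  assumes "open U" "tangent_field_on A \<phi> U X" "tangent_field_on A \<phi> U Y" "msmooth_on A U a" "msmooth_on A U b"
  shows "tangent_field_on A \<phi> U (\<lambda>q. a q *\<^sub>R X q + b q *\<^sub>R Y q)"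
  using assms tangent_plane_subspace
  by (auto simp: tangent_field_on_def subspace_add subspace_scale
      intro!: msmooth_add[OF assms(1)] msmooth_scaleR[OF assms(1)])

lemma tangent_field_subset: "tangent_field_on A \<phi> U X \<Longrightarrow> V \<subseteq> U \<Longrightarrow> tangent_field_on A \<phi> V X"
  by (auto simp: tangent_field_on_def intro: msmooth_subset)

end

section \<open>Adapted frames\<close>

locale rw_framed_surface = rw_surface c I f D A \<phi>
  for c :: real and I :: "real set" and f :: "real \<Rightarrow> real"
    and D :: "rw_point \<Rightarrow> rw_point \<Rightarrow> (rw_point \<Rightarrow> rw_point) \<Rightarrow> rw_point"
    and A :: "('m::t2_space set \<times> ('m \<Rightarrow> real^2)) set"
    and \<phi> :: "'m \<Rightarrow> rw_point" +
  fixes U :: "'m set" and e1 e2 e3 e4 :: "'m \<Rightarrow> rw_point" and \<theta> :: "'m \<Rightarrow> real"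
  assumes open_U: "open U" and frame: "orthonormal_frame_on L g A \<phi> U e1 e2 e3 e4"
    and adapted: "p \<in> U \<Longrightarrow> ddt = sinh (\<theta> p) *\<^sub>R e1 p + cosh (\<theta> p) *\<^sub>R e3 p"
begin

abbreviation G :: "'m \<Rightarrow> rw_point \<Rightarrow> rw_point \<Rightarrow> real" where "G p \<equiv> g (\<phi> p)"

lemma frame_smooth:
  "tangent_field_on A \<phi> U e1" "tangent_field_on A \<phi> U e2"
  "msmooth_on A U e1" "msmooth_on A U e2" "msmooth_on A U e3" "msmooth_on A U e4"
  using frame by (auto simp: orthonormal_frame_on_def tangent_field_on_def)

lemma frame_tangent_plane:
  assumes "p \<in> U"
  shows "e1 p \<in> tangent_plane A \<phi> p" "e2 p \<in> tangent_plane A \<phi> p"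
  using frame_smooth assms by (auto simp: tangent_field_on_def)

lemma frame_normal:
  assumes "p \<in> U"
  shows "e3 p \<in> normal_space L g A \<phi> p" "e4 p \<in> normal_space L g A \<phi> p"
  using frame assms by (auto simp: orthonormal_frame_on_def)

lemma normal_tangent: "n \<in> normal_space L g A \<phi> p \<Longrightarrow> tangent p n"
  using tangent_space_L[OF immersed] by (auto simp: normal_space_def)

lemma normal_orthogonal:
  assumes "n \<in> normal_space L g A \<phi> p" "X \<in> tangent_plane A \<phi> p"
  shows "G p n X = 0" "G p X n = 0"
  using assms by (auto simp: normal_space_def g_commute)

lemma frame_tangent:
  assumes "p \<in> U"
  shows "tangent p (e1 p)" "tangent p (e2 p)" "tangent p (e3 p)" "tangent p (e4 p)"
  using frame_tangent_plane[OF assms] frame_normal[OF assms] tangent_plane_tangent normal_tangent by auto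

lemma frame_products:
  assumes "p \<in> U"
  shows "G p (e1 p) (e1 p) = 1" "G p (e2 p) (e2 p) = 1" "G p (e3 p) (e3 p) = -1" "G p (e4 p) (e4 p) = 1"
    "G p (e1 p) (e2 p) = 0" "G p (e2 p) (e1 p) = 0" "G p (e3 p) (e4 p) = 0" "G p (e4 p) (e3 p) = 0"
    "G p (e1 p) (e3 p) = 0" "G p (e3 p) (e1 p) = 0" "G p (e1 p) (e4 p) = 0" "G p (e4 p) (e1 p) = 0"
    "G p (e2 p) (e3 p) = 0" "G p (e3 p) (e2 p) = 0" "G p (e2 p) (e4 p) = 0" "G p (e4 p) (e2 p) = 0"
  using frame assms frame_tangent_plane[OF assms] frame_normal[OF assms] normal_orthogonal
  by (auto simp: orthonormal_frame_on_def g_commute[of "\<phi> p" "e2 p" "e1 p"] g_commute[of "\<phi> p" "e4 p" "e3 p"])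

text \<open>The time component of a vector is minus its product with \<open>ddt\<close>, and
  \<open>ddt\<close> is a combination of \<open>e1\<close> and \<open>e3\<close>. Products with
  \<open>ddt\<close> can therefore be read off from \<open>fst\<close>, which is easy to
  differentiate.\<close>

lemma frame_time:
  assumes p: "p \<in> U"
  shows "fst v = - (sinh (\<theta> p) * G p (e1 p) v + cosh (\<theta> p) * G p (e3 p) v)"
proof -
  have "fst v = - G p ddt v" by (simp add: rw_metric_def ddt_def metric.zero_left)
  then show ?thesis by (simp add: adapted[OF p] g.add_left g.scaleR_left)
qed

lemma frame_time_components:
  assumes p: "p \<in> U"
  shows "fst (e1 p) = - sinh (\<theta> p)" "fst (e2 p) = 0" "fst (e3 p) = cosh (\<theta> p)" "fst (e4 p) = 0"
  unfolding frame_time[OF p] by (simp_all add: frame_products[OF p])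

lemma frame_independent:
  assumes p: "p \<in> U"
  shows "independent {e1 p, e2 p}" "card {e1 p, e2 p} = 2"
    "independent {e1 p, e2 p, e3 p, e4 p}" "card {e1 p, e2 p, e3 p, e4 p} = 4"
proof -
  have ne: "e1 p \<noteq> e2 p" "e1 p \<noteq> e3 p" "e1 p \<noteq> e4 p" "e2 p \<noteq> e3 p" "e2 p \<noteq> e4 p" "e3 p \<noteq> e4 p"
    using frame_products[OF p] by (metis zero_neq_one zero_neq_neg_one)+
  show "independent {e1 p, e2 p, e3 p, e4 p}"
  proof (rule g_orthogonal_independent[of _ "\<phi> p"])
    fix v assume v: "v \<in> {e1 p, e2 p, e3 p, e4 p}"
    then show "G p v v \<noteq> 0" by (elim insertE emptyE) (simp_all add: frame_products[OF p])
    fix w assume "w \<in> {e1 p, e2 p, e3 p, e4 p}" "v \<noteq> w"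
    then show "G p v w = 0" using v by (elim insertE emptyE) (simp_all add: frame_products[OF p])
  qed simp
  then show "independent {e1 p, e2 p}" by (rule independent_mono) auto
  show "card {e1 p, e2 p} = 2" "card {e1 p, e2 p, e3 p, e4 p} = 4" using ne by auto
qed

lemma tangent_plane_expansion:
  assumes p: "p \<in> U" and X: "X \<in> tangent_plane A \<phi> p"
  shows "X = G p X (e1 p) *\<^sub>R e1 p + G p X (e2 p) *\<^sub>R e2 p"
proof -
  have "tangent_plane A \<phi> p \<subseteq> span {e1 p, e2 p}"
    by (rule card_ge_dim_independent)
      (use frame_independent[OF p] frame_tangent_plane[OF p] dim_tangent_plane in auto)
  then obtain a b where "X = a *\<^sub>R e1 p + b *\<^sub>R e2 p"
    using X by (auto simp: span_insert algebra_simps span_singleton)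
  then show ?thesis
    using frame_products[OF p] by (simp add: g.add_left g.scaleR_left)
qed

text \<open>The ambient space has dimension 5 and the position vector lies outside the tangent
  hyperplane. This bound makes the four frame vectors span.\<close>

lemma dim_tangent: "dim {v. tangent p v} \<le> 4"
proof -
  have "subspace {v. tangent p v}"
    by (rule subspaceI) (simp_all add: quadric_simps quadric.zero_right)
  then have "span {v. tangent p v} = {v. tangent p v}" by (rule span_eq_iff[THEN iffD2])
  moreover have "(0, snd (\<phi> p)) \<notin> {v. tangent p v}" by (simp add: position_quadric)
  then have "{v. tangent p v} \<noteq> UNIV" by blast
  ultimately have "span {v. tangent p v} \<subset> span UNIV" by (simp only: span_UNIV psubset_eq subset_UNIV simp_thms)
  then have "dim {v. tangent p v} < dim (UNIV :: rw_point set)" by (rule dim_psubset)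
  then show ?thesis by simp
qed

lemma tangent_expansion:
  assumes p: "p \<in> U" and v: "tangent p v"
  shows "v = G p v (e1 p) *\<^sub>R e1 p + G p v (e2 p) *\<^sub>R e2 p - G p v (e3 p) *\<^sub>R e3 p + G p v (e4 p) *\<^sub>R e4 p"
proof -
  have "{v. tangent p v} \<subseteq> span {e1 p, e2 p, e3 p, e4 p}"
    by (rule card_ge_dim_independent)
      (use frame_independent[OF p] frame_tangent[OF p] dim_tangent in auto)
  then have "v \<in> span {e1 p, e2 p, e3 p, e4 p}" using v by blast
  then obtain a b d e where "v = a *\<^sub>R e1 p + b *\<^sub>R e2 p + d *\<^sub>R e3 p + e *\<^sub>R e4 p"
    by (auto simp: span_insert algebra_simps span_singleton)
  then show ?thesis
    using frame_products[OF p] by (simp add: g.add_left g.scaleR_left)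
qed

lemma tangent_eq_0:
  assumes "p \<in> U" "tangent p v" "G p v (e1 p) = 0" "G p v (e2 p) = 0" "G p v (e3 p) = 0" "G p v (e4 p) = 0"
  shows "v = 0"
  using tangent_expansion[OF assms(1,2)] assms by simp

lemma tangent_plane_subset:
  assumes "X \<in> tangent_plane A \<phi> p" "Y \<in> tangent_plane A \<phi> p"
  shows "a *\<^sub>R X + b *\<^sub>R Y \<in> tangent_plane A \<phi> p"
  using assms tangent_plane_subspace by (simp add: subspace_add subspace_scale)

lemma normal_part_eq:
  assumes p: "p \<in> U" and w: "tangent p w"
  shows "normal_part L g A \<phi> p w = - G p w (e3 p) *\<^sub>R e3 p + G p w (e4 p) *\<^sub>R e4 p" (is "_ = ?n")
  unfolding normal_part_def
proof (rule the_equality)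
  have "w - ?n = G p w (e1 p) *\<^sub>R e1 p + G p w (e2 p) *\<^sub>R e2 p"
    by (subst tangent_expansion[OF p w]) (simp add: algebra_simps)
  then have "w - ?n \<in> tangent_plane A \<phi> p"
    using tangent_plane_subset[OF frame_tangent_plane[OF p]] by metis
  moreover have "?n \<in> normal_space L g A \<phi> p"
    using frame_normal[OF p] tangent_space_L[OF immersed]
    by (auto simp: normal_space_def quadric_simps g.add_left g.diff_left g.scaleR_left g.minus_left)
  ultimately show "?n \<in> normal_space L g A \<phi> p \<and> w - ?n \<in> tangent_plane A \<phi> p" by blast
  fix n assume n: "n \<in> normal_space L g A \<phi> p \<and> w - n \<in> tangent_plane A \<phi> p"
  have "w = (w - n) + n" by simp
  then have "G p w (e3 p) = G p n (e3 p)" "G p w (e4 p) = G p n (e4 p)"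
    using normal_orthogonal(2)[OF frame_normal(1)[OF p], of "w - n"]
      normal_orthogonal(2)[OF frame_normal(2)[OF p], of "w - n"] n
    by (auto simp: g.diff_left)
  moreover have "G p n (e1 p) = 0" "G p n (e2 p) = 0"
    using n normal_orthogonal frame_tangent_plane[OF p] by auto
  ultimately show "n = ?n"
    using tangent_expansion[OF p normal_tangent, of n] n by simp
qed

lemma nabla_frame_tangent:
  assumes p: "p \<in> U" and X: "X \<in> tangent_plane A \<phi> p"
  shows "tangent p (nabla p X e1)" "tangent p (nabla p X e2)" "tangent p (nabla p X e3)" "tangent p (nabla p X e4)"
  using nabla_tangent[OF open_U p _ _ X] frame_smooth frame_tangent by blast+

section \<open>Shape operators and the relative null space\<close>

lemma nabla_skew:
  assumes V: "open V" "p \<in> V" and W: "msmooth_on A V W" "tangent p (W p)" and Z: "msmooth_on A V Z" "tangent p (Z p)"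
    and k: "\<And>q. q \<in> V \<Longrightarrow> G q (W q) (Z q) = k" and X: "X \<in> tangent_plane A \<phi> p"
  shows "G p (nabla p X W) (Z p) = - G p (W p) (nabla p X Z)"
proof -
  have "dir p X (\<lambda>q. G q (W q) (Z q)) = dir p X (\<lambda>q. k)"
    by (rule dir_cong[OF V k])
  then show ?thesis
    using nabla_metric[OF V W Z X] by (simp add: dir_const)
qed

text \<open>Moves the second fundamental form onto the normal field: the right side involves
  \<open>W\<close> only through its value at \<open>p\<close>, so it does not matter how a tangent
  vector is extended.\<close>

lemma weingarten:
  assumes V: "open V" "p \<in> V" and W: "tangent_field_on A \<phi> V W"
    and n: "msmooth_on A V n" "\<And>q. q \<in> V \<Longrightarrow> n q \<in> normal_space L g A \<phi> q" and X: "X \<in> tangent_plane A \<phi> p"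
  shows "G p (nabla p X W) (n p) = - G p (W p) (nabla p X n)"
  by (rule nabla_skew[OF V, where k = 0])
    (use V W n X normal_tangent normal_orthogonal tangent_plane_tangent in \<open>auto simp: tangent_field_on_def\<close>)

lemma tangent_extension:
  assumes "p \<in> U" "X \<in> tangent_plane A \<phi> p"
  obtains X' where "tangent_field_on A \<phi> U X'" "X' p = X"
proof
  let ?X = "\<lambda>q. G p X (e1 p) *\<^sub>R e1 q + G p X (e2 p) *\<^sub>R e2 q"
  show "tangent_field_on A \<phi> U ?X"
    by (rule tangent_field_combination[OF open_U frame_smooth(1,2) msmooth_const msmooth_const])
  show "?X p = X" using tangent_plane_expansion[OF assms] by simp
qed

text \<open>The two derivatives of the extensions differ by their bracket, which is tangent and
  hence orthogonal to \<open>n\<close>; \<open>weingarten\<close> translates this to the shape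
  operator.\<close>

lemma shape_symmetric:
  assumes p: "p \<in> U" and n: "msmooth_on A U n" "\<And>q. q \<in> U \<Longrightarrow> n q \<in> normal_space L g A \<phi> q"
    and X: "X \<in> tangent_plane A \<phi> p" and Y: "Y \<in> tangent_plane A \<phi> p"
  shows "G p Y (nabla p X n) = G p X (nabla p Y n)"
proof -
  obtain X' Y' where X': "tangent_field_on A \<phi> U X'" "X' p = X" and Y': "tangent_field_on A \<phi> U Y'" "Y' p = Y"
    using tangent_extension[OF p X] tangent_extension[OF p Y] by metis
  have "nabla p X Y' - nabla p Y X' \<in> tangent_plane A \<phi> p"
    using nabla_torsion[of p X' Y'] bracket(1)[OF open_U p X'(1) Y'(1)] X' Y' by simp
  then have "G p (nabla p X Y') (n p) = G p (nabla p Y X') (n p)"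
    using normal_orthogonal(2)[OF n(2)[OF p]] by (fastforce simp: g.diff_left)
  then show ?thesis
    using weingarten[OF open_U p Y'(1) n X] weingarten[OF open_U p X'(1) n Y] X' Y' by simp
qed

text \<open>By \<open>weingarten\<close> the value is the same for every extension
  \<open>Y'\<close>, so the description is well defined. The sign of the \<open>e3\<close> term
  combines the minus of \<open>weingarten\<close> with that of the time-like
  \<open>e3\<close>.\<close>

lemma second_ff_eq:
  assumes p: "p \<in> U" and X: "X \<in> tangent_plane A \<phi> p" and Y: "Y \<in> tangent_plane A \<phi> p"
  shows "second_ff L g D A \<phi> p X Y = G p Y (nabla p X e3) *\<^sub>R e3 p - G p Y (nabla p X e4) *\<^sub>R e4 p" (is "_ = ?h")
proof -
  have h: "normal_part L g A \<phi> p (cov_deriv L D A \<phi> p X Y') = ?h"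
    if V: "open V" "p \<in> V" and Y': "tangent_field_on A \<phi> V Y'" "Y' p = Y" for V Y'
  proof -
    have VU: "open (V \<inter> U)" "p \<in> V \<inter> U" using V open_U p by auto
    have Y'VU: "tangent_field_on A \<phi> (V \<inter> U) Y'" using Y' tangent_field_subset by blast
    have sm: "msmooth_on A (V \<inter> U) Y'" "\<And>q. q \<in> V \<inter> U \<Longrightarrow> tangent q (Y' q)"
      using Y'VU tangent_plane_tangent by (auto simp: tangent_field_on_def)
    have "G p (nabla p X Y') (e3 p) = - G p Y (nabla p X e3)" "G p (nabla p X Y') (e4 p) = - G p Y (nabla p X e4)"
      using weingarten[OF VU Y'VU _ _ X, of e3] weingarten[OF VU Y'VU _ _ X, of e4] frame_normal Y'(2)
        msmooth_subset[OF frame_smooth(5), of "V \<inter> U"] msmooth_subset[OF frame_smooth(6), of "V \<inter> U"] by auto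
    then show ?thesis
      using cov_deriv_eq[OF VU sm X] normal_part_eq[OF p nabla_tangent[OF VU sm X]] by simp
  qed
  obtain Y0 where "tangent_field_on A \<phi> U Y0" "Y0 p = Y" using tangent_extension[OF p Y] .
  then show ?thesis
    unfolding second_ff_def
  proof (intro the_equality)
    show "\<exists>U Y'. open U \<and> p \<in> U \<and> tangent_field_on A \<phi> U Y' \<and> Y' p = Y \<and>
      ?h = normal_part L g A \<phi> p (cov_deriv L D A \<phi> p X Y')"
      using h[OF open_U p \<open>tangent_field_on A \<phi> U Y0\<close> \<open>Y0 p = Y\<close>] open_U p
        \<open>tangent_field_on A \<phi> U Y0\<close> \<open>Y0 p = Y\<close> by metis
  qed (use h in blast)
qed

lemma rel_null_space_eq:
  assumes p: "p \<in> U"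
  shows "X \<in> rel_null_space L g D A \<phi> p \<longleftrightarrow> X \<in> tangent_plane A \<phi> p \<and>
    (\<forall>Y\<in>tangent_plane A \<phi> p. G p Y (nabla p X e3) = 0 \<and> G p Y (nabla p X e4) = 0)"
proof -
  have "a *\<^sub>R e3 p = b *\<^sub>R e4 p \<longleftrightarrow> a = 0 \<and> b = 0" for a b
  proof
    assume eq: "a *\<^sub>R e3 p = b *\<^sub>R e4 p"
    have "G p (a *\<^sub>R e3 p) (e3 p) = - a" "G p (b *\<^sub>R e4 p) (e4 p) = b"
      "G p (a *\<^sub>R e3 p) (e4 p) = 0" "G p (b *\<^sub>R e4 p) (e3 p) = 0"
      by (simp_all add: g.scaleR_left frame_products[OF p])
    then show "a = 0 \<and> b = 0" unfolding eq by simp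
  qed simp
  then show ?thesis
    unfolding rel_null_space_def mem_Collect_eq by (simp add: second_ff_eq[OF p] cong: conj_cong)
qed

text \<open>Encodes \<open>D_X ddt = (f'/f) (X - fst X ddt)\<close>: in the warped product the
  derivative of \<open>ddt\<close> is a multiple of the part of \<open>X\<close> orthogonal to it.
  This is the source of the equations for \<open>\<theta>\<close> and of the constraint on the
  normal connection.\<close>

lemma nabla_time:
  assumes p: "p \<in> U" and V: "msmooth_on A U V" and X: "X \<in> tangent_plane A \<phi> p"
  shows "fst (nabla p X V) = dir p X (\<lambda>q. fst (V q))
    + f' (fst (\<phi> p)) / f (fst (\<phi> p)) * (G p X (V p) + fst X * fst (V p))"
proof -
  have "f (fst (\<phi> p)) \<noteq> 0" using f_neq_0[OF time_in_I] .
  then show ?thesis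
    by (simp add: nabla_def christoffel_def dir_fst[OF open_U p V] rw_metric_def power2_eq_square)
qed

text \<open>Differentiating \<open>\<langle>e\<^sub>4, \<partial>\<^sub>t\<rangle> = 0\<close> relates the normal connection to the shape operator of \<open>e\<^sub>4\<close>.\<close>
lemma normal_connection:
  assumes p: "p \<in> U" and X: "X \<in> tangent_plane A \<phi> p" and 0: "G p (e1 p) (nabla p X e4) = 0"
  shows "G p (e3 p) (nabla p X e4) = 0"
proof -
  have "dir p X (\<lambda>q. fst (e4 q)) = dir p X (\<lambda>q. 0)"
    by (rule dir_cong[OF open_U p]) (simp add: frame_time_components)
  then have "fst (nabla p X e4) = 0"
    using nabla_time[OF p frame_smooth(6) X] normal_orthogonal(2)[OF frame_normal(2)[OF p] X]
    by (simp add: dir_const frame_time_components[OF p])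
  then show ?thesis using frame_time[OF p, of "nabla p X e4"] 0 by simp
qed

lemma e4_parallel:
  assumes p: "p \<in> U" and X: "X \<in> tangent_plane A \<phi> p"
    and 0: "\<And>Y. Y \<in> tangent_plane A \<phi> p \<Longrightarrow> G p Y (nabla p X e4) = 0"
  shows "nabla p X e4 = 0"
proof (rule tangent_eq_0[OF p nabla_frame_tangent(4)[OF p X]])
  have s: "G p (nabla p X e4) (e4 p) = - G p (e4 p) (nabla p X e4)"
    by (rule nabla_skew[OF open_U p frame_smooth(6) frame_tangent(4)[OF p] frame_smooth(6) frame_tangent(4)[OF p] _ X])
      (rule frame_products)
  then show "G p (nabla p X e4) (e4 p) = 0" by (simp add: g_commute)
  show "G p (nabla p X e4) (e1 p) = 0" "G p (nabla p X e4) (e2 p) = 0"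
    using 0 frame_tangent_plane[OF p] by (simp_all add: g_commute)
  show "G p (nabla p X e4) (e3 p) = 0"
    using normal_connection[OF p X] 0 frame_tangent_plane[OF p] by (simp add: g_commute)
qed

text \<open>If \<open>e\<^sub>4\<close> is parallel, then \<open>f e\<^sub>4\<close> is a constant vector of the ambient space of the space form.\<close>
lemma parallel_normal_slice:
  assumes V: "open V" "p \<in> V" "V \<subseteq> U"
    and par: "\<And>q X. q \<in> V \<Longrightarrow> X \<in> tangent_plane A \<phi> q \<Longrightarrow> nabla q X e4 = 0"
  shows "\<exists>V N. open V \<and> V \<noteq> {} \<and> totally_geodesic_hypersurface L g D N \<and> \<phi> ` V \<subseteq> N"
proof -
  define \<zeta> where "\<zeta> q = f (fst (\<phi> q)) *\<^sub>R snd (e4 q)" for q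
  have e4: "msmooth_on A V e4" using frame_smooth(6) V(3) by (rule msmooth_subset)
  have Be4: "B (snd X) (snd (e4 q)) = 0" if "q \<in> V" "X \<in> tangent_plane A \<phi> q" for q X
    using normal_orthogonal(2)[OF frame_normal(2) that(2)] frame_time_components(4)[of q] V(3) that(1)
      f_neq_0[OF time_in_I[of q]] by (auto simp: rw_metric_def)
  have ft: "msmooth_on A V (\<lambda>q. f (fst (\<phi> q)))" by (rule msmooth_on_time[OF V(1) smooth_f])
  have \<zeta>s: "msmooth_on A V \<zeta>"
    unfolding \<zeta>_def by (rule msmooth_scaleR[OF V(1) ft msmooth_snd[OF V(1) e4]])
  have d\<zeta>: "dir q X \<zeta> = 0" if q: "q \<in> V" and X: "X \<in> tangent_plane A \<phi> q" for q X
  proof -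
    let ?t = "fst (\<phi> q)"
    have f0: "f ?t \<noteq> 0" using f_neq_0[OF time_in_I] .
    have "dir q X (\<lambda>q. f (fst (\<phi> q))) = f' ?t * dir q X (\<lambda>q. fst (\<phi> q))"
      using dir_compose[OF V(1) q msmooth_fst[OF V(1) msmooth_immersion]
          f_derivative[OF time_in_I, unfolded has_field_derivative_def]] .
    also have "\<dots> = f' ?t * fst X"
      by (simp add: dir_fst[OF V(1) q msmooth_immersion] dir_immersion[OF X])
    finally have "dir q X \<zeta> = f ?t *\<^sub>R snd (dir q X e4) + (f' ?t * fst X) *\<^sub>R snd (e4 q)"
      unfolding \<zeta>_def using dir_scaleR[OF V(1) q ft msmooth_snd[OF V(1) e4]] dir_snd[OF V(1) q e4] by simp
    \<comment> \<open>The space form part of \<open>nabla q X e4 = 0\<close>: since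
      \<open>e4\<close> has no time component and is \<open>B\<close>-orthogonal to
      \<open>X\<close>, only one term with \<open>f'/f\<close> survives in
      \<open>christoffel\<close>.\<close>
    moreover have "snd (dir q X e4) + (f' ?t / f ?t) *\<^sub>R (fst X *\<^sub>R snd (e4 q)) = 0"
      using par[OF q X] Be4[OF q X] frame_time_components(4)[of q] q V(3)
      by (auto simp: nabla_def christoffel_def prod_eq_iff)
    then have "f ?t *\<^sub>R (snd (dir q X e4) + (f' ?t / f ?t) *\<^sub>R (fst X *\<^sub>R snd (e4 q))) = 0" by simp
    ultimately show ?thesis using f0 by (simp add: scaleR_add_right)
  qed
  obtain V1 where V1: "open V1" "p \<in> V1" "V1 \<subseteq> V" "\<And>q. q \<in> V1 \<Longrightarrow> \<zeta> q = \<zeta> p"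
    using locally_constant[OF V(1,2) \<zeta>s d\<zeta>] by blast
  let ?b = "\<lambda>q. B (\<zeta> p) (snd (\<phi> q))"
  have bl: "bounded_linear (\<lambda>v. B (\<zeta> p) (snd v))"
    by (rule bounded_linear_compose[OF metric.bounded_linear_right bounded_linear_snd])
  have bs: "msmooth_on A V1 ?b" by (rule msmooth_bounded_linear[OF V1(1) bl msmooth_immersion])
  have db: "dir q X ?b = 0" if q: "q \<in> V1" and X: "X \<in> tangent_plane A \<phi> q" for q X
  proof -
    have "dir q X ?b = B (\<zeta> q) (snd X)"
      using dir_bounded_linear[OF V1(1) q msmooth_immersion bl] dir_immersion[OF X] V1(4)[OF q] by simp
    also have "\<dots> = 0"
      using Be4[OF _ X] q V1(3) by (auto simp: \<zeta>_def metric_simps metric_commute)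
    finally show ?thesis .
  qed
  obtain V2 where V2: "open V2" "p \<in> V2" "V2 \<subseteq> V1" "\<And>q. q \<in> V2 \<Longrightarrow> ?b q = ?b p"
    using locally_constant[OF V1(1,2) bs db] by blast
  have pU: "p \<in> U" using V by blast
  have K\<zeta>: "K (snd (\<phi> p)) (\<zeta> p) = 0"
    using frame_tangent(4)[OF pU] by (simp add: \<zeta>_def quadric.scaleR_right)
  have "B (\<zeta> p) (\<zeta> p) = 1"
    using frame_products(4)[OF pU] frame_time_components(4)[OF pU]
    by (simp add: \<zeta>_def metric_simps rw_metric_def power2_eq_square)
  moreover have "c * ?b p = 0"
    using c_metric_position[OF K\<zeta>] by (simp add: metric_commute)
  moreover have "fst (\<zeta> p) = 0" if "c = 0"
  proof -
    have "snd (\<phi> p) \<in> space_form c" using immersed[of p] by (simp add: mem_L)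
    then have "fst (snd (\<phi> p)) > 0" using that by (simp add: space_form_quadric)
    then show ?thesis using K\<zeta> that by (simp add: quadric_def)
  qed
  ultimately have "totally_geodesic_hypersurface L g D (slice (\<zeta> p) (?b p))"
    by (rule totally_geodesic_slice)
  moreover have "\<phi> ` V2 \<subseteq> slice (\<zeta> p) (?b p)"
    using V2(4) immersed by (auto simp: slice_def)
  ultimately show ?thesis using V2(1,2) by blast
qed

section \<open>The Codazzi equation and the null direction\<close>

lemma nabla_null_tangent:
  assumes V: "open V" "p \<in> V" "V \<subseteq> U" and X: "X \<in> rel_null_space L g D A \<phi> p" and W: "tangent_field_on A \<phi> V W"
  shows "nabla p X W \<in> tangent_plane A \<phi> p"
proof -
  have pU: "p \<in> U" using V by blast
  have Wp: "W p \<in> tangent_plane A \<phi> p" "msmooth_on A V W" using W V by (auto simp: tangent_field_on_def)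
  have null: "X \<in> tangent_plane A \<phi> p" "G p (W p) (nabla p X e3) = 0" "G p (W p) (nabla p X e4) = 0"
    using X Wp(1) rel_null_space_eq[OF pU] by blast+
  have "tangent p (nabla p X W)"
    by (rule nabla_tangent[OF V(1,2) Wp(2) _ null(1)])
      (use W tangent_plane_tangent in \<open>auto simp: tangent_field_on_def\<close>)
  moreover have "G p (nabla p X W) (e3 p) = 0" "G p (nabla p X W) (e4 p) = 0"
    using weingarten[OF V(1,2) W msmooth_subset[OF frame_smooth(5) V(3)] _ null(1)]
      weingarten[OF V(1,2) W msmooth_subset[OF frame_smooth(6) V(3)] _ null(1)]
      frame_normal V(3) null by auto
  ultimately have "nabla p X W = G p (nabla p X W) (e1 p) *\<^sub>R e1 p + G p (nabla p X W) (e2 p) *\<^sub>R e2 p"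
    using tangent_expansion[OF pU, of "nabla p X W"] by simp
  then show ?thesis
    using tangent_plane_subset[OF frame_tangent_plane[OF pU]] by metis
qed

text \<open>The Codazzi equation for \<open>(\<tilde>R(Z, Y)Z)\<^sup>\<bottom>\<close>, with a null field \<open>Z\<close> and \<open>Y\<close> orthogonal to it: the component of
  \<open>\<nabla>\<^sub>Z Z\<close> along \<open>Y\<close> is the only obstruction to \<open>Y\<close> being orthogonal to \<open>T\<close>.\<close>
lemma codazzi_null:
  assumes V: "open V" "p \<in> V" "V \<subseteq> U" and Z: "tangent_field_on A \<phi> V Z" and Y: "tangent_field_on A \<phi> V Y"
    and null: "\<And>q. q \<in> V \<Longrightarrow> Z q \<in> rel_null_space L g D A \<phi> q"
    and YZ: "\<And>q. q \<in> V \<Longrightarrow> G q (Z q) (Y q) = 0"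
    and n: "msmooth_on A U n" "\<And>q. q \<in> U \<Longrightarrow> n q \<in> normal_space L g A \<phi> q"
      "\<And>q X Y. q \<in> V \<Longrightarrow> X \<in> rel_null_space L g D A \<phi> q \<Longrightarrow> Y \<in> tangent_plane A \<phi> q \<Longrightarrow> G q Y (nabla q X n) = 0"
  shows "G p (nabla p (Z p) Z) (nabla p (Y p) n) = G p (Z p) (Z p) *
    (deriv f' (fst (\<phi> p)) / f (fst (\<phi> p)) - ((f' (fst (\<phi> p)))\<^sup>2 + c) / (f (fst (\<phi> p)))\<^sup>2) * fst (n p) * fst (Y p)"
proof -
  have tp: "Z q \<in> tangent_plane A \<phi> q" "Y q \<in> tangent_plane A \<phi> q" if "q \<in> V" for q
    using Z Y that by (auto simp: tangent_field_on_def)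
  have nV: "msmooth_on A V n" "\<And>q. q \<in> V \<Longrightarrow> n q \<in> normal_space L g A \<phi> q"
    using n(1,2) V(3) msmooth_subset by blast+
  have sm: "msmooth_on A V Z" "msmooth_on A V Y" using Z Y by (auto simp: tangent_field_on_def)
  have null_nabla: "G q (nabla q (Z q) W) (n q) = 0" if q: "q \<in> V" and W: "tangent_field_on A \<phi> V W" for q W
  proof -
    have "W q \<in> tangent_plane A \<phi> q" using W q by (simp add: tangent_field_on_def)
    then show ?thesis
      using weingarten[OF V(1) q W nV tp(1)[OF q]] n(3)[OF q null[OF q]] by simp
  qed
  have ZZ: "nabla q (Z q) W \<in> tangent_plane A \<phi> q" if "q \<in> V" "tangent_field_on A \<phi> V W" for q W
    by (rule nabla_null_tangent[OF V(1) that(1) V(3) null[OF that(1)] that(2)])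
  have f1: "tangent_field_on A \<phi> V (\<lambda>q. nabla q (Z q) Z)"
    using ZZ[OF _ Z] msmooth_nabla[OF V(1) Z sm(1)] by (simp add: tangent_field_on_def)
  note pV = V(2)
  \<comment> \<open>Moving the derivative from \<open>Z\<close> to \<open>n\<close> and using the
    symmetry of the shape operator leaves the shape operator at \<open>Z\<close>, which is
    null.\<close>
  have 3: "G p (nabla p (bracket Z Y p) Z) (n p) = 0"
  proof -
    have b: "bracket Z Y p \<in> tangent_plane A \<phi> p" by (rule bracket(1)[OF V(1,2) Z Y])
    have "G p (nabla p (bracket Z Y p) Z) (n p) = - G p (Z p) (nabla p (bracket Z Y p) n)"
      by (rule weingarten[OF V(1,2) Z nV b])
    also have "\<dots> = - G p (bracket Z Y p) (nabla p (Z p) n)"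
      using shape_symmetric[OF _ n(1,2) b tp(1)[OF pV]] V by auto
    finally show ?thesis using n(3)[OF pV null[OF pV] b] by simp
  qed
  \<comment> \<open>The derivative of \<open>Y\<close> along the null field \<open>Z\<close> and the
    bracket are tangent, so the derivative of \<open>Z\<close> along \<open>Y\<close> is a tangent
    field; a further derivative along \<open>Z\<close> has no component along
    \<open>n\<close>.\<close>
  have 1: "G p (nabla p (Z p) (\<lambda>q. nabla q (Y q) Z)) (n p) = 0"
  proof -
    have YZ': "nabla q (Y q) Z \<in> tangent_plane A \<phi> q" if "q \<in> V" for q
    proof -
      have "nabla q (Y q) Z = nabla q (Z q) Y - bracket Z Y q"
        using nabla_torsion[of q Z Y] by (simp add: algebra_simps)
      then show ?thesis
        using ZZ[OF that Y] bracket(1)[OF V(1) that Z Y] tangent_plane_subspace subspace_diff by metis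
    qed
    then have "tangent_field_on A \<phi> V (\<lambda>q. nabla q (Y q) Z)"
      using msmooth_nabla[OF V(1) Y sm(1)] by (simp add: tangent_field_on_def)
    then show ?thesis by (rule null_nabla[OF pV])
  qed
  have 2: "G p (nabla p (Y p) (\<lambda>q. nabla q (Z q) Z)) (n p) = - G p (nabla p (Z p) Z) (nabla p (Y p) n)"
    by (rule weingarten[OF V(1,2) f1 nV tp(2)[OF pV]])
  have "G p (curvature (\<phi> p) (Z p) (Y p) (Z p)) (n p) = G p (nabla p (Z p) Z) (nabla p (Y p) n)"
    unfolding nabla_curvature[OF V(1,2) Z Y sm(1), symmetric] g.diff_left 1 2 3 by simp
  then show ?thesis
    using curvature_normal[OF immersed YZ[OF pV] normal_orthogonal(2)[OF nV(2)[OF pV] tp(1)[OF pV]]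
        normal_orthogonal(2)[OF nV(2)[OF pV] tp(2)[OF pV]]] by simp
qed

end

context rw_framed_surface
begin

lemma tangent_plane_pos: "X \<in> tangent_plane A \<phi> p \<Longrightarrow> X \<noteq> 0 \<Longrightarrow> G p X X > 0"
  using spacelike unfolding spacelike_def by blast

lemma tangent_plane_orthogonal_basis:
  assumes Z: "Z \<in> tangent_plane A \<phi> p" "Z \<noteq> 0" and Y: "Y \<in> tangent_plane A \<phi> p" "Y \<noteq> 0"
    and ZY: "G p Z Y = 0" and X: "X \<in> tangent_plane A \<phi> p"
  obtains a b where "X = a *\<^sub>R Z + b *\<^sub>R Y"
proof -
  have pos: "G p Z Z > 0" "G p Y Y > 0" by (rule tangent_plane_pos; fact)+
  then have ne: "Z \<noteq> Y" using ZY by auto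
  have "independent {Z, Y}"
  proof (rule g_orthogonal_independent[of _ "\<phi> p"])
    fix v assume v: "v \<in> {Z, Y}"
    then show "G p v v \<noteq> 0" using pos by (elim insertE emptyE) simp_all
    fix w assume "w \<in> {Z, Y}" "v \<noteq> w"
    then show "G p v w = 0" using v ZY by (elim insertE emptyE) (simp_all add: g_commute)
  qed simp
  then have "tangent_plane A \<phi> p \<subseteq> span {Z, Y}"
    by (intro card_ge_dim_independent) (use Z Y ne dim_tangent_plane in auto)
  then have "X \<in> span {Z, Y}" using X by blast
  then show ?thesis using that by (auto simp: span_insert algebra_simps span_singleton)
qed

text \<open>Otherwise \<open>h\<^sup>4 = 0\<close> near a point where the null direction differs from \<open>T\<close>, by the Codazzi equation.\<close>
lemma null_direction:
  assumes V: "open V" "p \<in> V" "V \<subseteq> U" and Z: "tangent_field_on A \<phi> V Z"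
    and null: "\<And>q. q \<in> V \<Longrightarrow> Z q \<noteq> 0 \<and> rel_null_space L g D A \<phi> q = span {Z q}"
    and curv: "\<And>t. t \<in> I \<Longrightarrow> deriv f' t / f t - ((f' t)\<^sup>2 + c) / (f t)\<^sup>2 \<noteq> 0"
    and full: "\<not> (\<exists>V N. open V \<and> V \<noteq> {} \<and> totally_geodesic_hypersurface L g D N \<and> \<phi> ` V \<subseteq> N)"
    and \<theta>: "sinh (\<theta> p) \<noteq> 0"
  shows "e1 p \<in> rel_null_space L g D A \<phi> p"
proof -
  define z1 z2 where "z1 q = G q (Z q) (e1 q)" and "z2 q = G q (Z q) (e2 q)" for q
  \<comment> \<open>\<open>Z\<close> turned by a right angle in the tangent plane, with smooth
    coefficients. As \<open>e2\<close> has no time component, \<open>fst (Y q)\<close> is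
    \<open>sinh (\<theta> q)\<close> times the \<open>e2\<close> component of
    \<open>Z q\<close>.\<close>
  define Y where "Y q = (- z2 q) *\<^sub>R e1 q + z1 q *\<^sub>R e2 q" for q
  have e: "tangent_field_on A \<phi> V e1" "tangent_field_on A \<phi> V e2" "msmooth_on A V e1" "msmooth_on A V e2"
    using frame_smooth tangent_field_subset[OF _ V(3)] msmooth_subset[OF _ V(3)] by blast+
  have Zs: "msmooth_on A V Z" using Z by (simp add: tangent_field_on_def)
  have Y: "tangent_field_on A \<phi> V Y"
    unfolding Y_def z1_def z2_def
    by (intro tangent_field_combination[OF V(1)] e msmooth_minus[OF V(1)] msmooth_g[OF V(1)] Zs)
  have ZY: "G q (Z q) (Y q) = 0" for q
    by (simp add: Y_def z1_def z2_def g.add_right g.scaleR_right g.minus_right g.diff_right algebra_simps)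
  have Zn: "Z q \<in> rel_null_space L g D A \<phi> q" if "q \<in> V" for q
    using null[OF that] by (simp add: span_base)
  have tp: "Z q \<in> tangent_plane A \<phi> q" "Y q \<in> tangent_plane A \<phi> q" if "q \<in> V" for q
    using Z Y that by (auto simp: tangent_field_on_def)
  have "fst (Y p) = 0"
  proof (rule ccontr)
    assume Yp: "fst (Y p) \<noteq> 0"
    \<comment> \<open>The open set where \<open>Y\<close> is not orthogonal to \<open>T\<close>.
      \<open>parallel_normal_slice\<close> needs \<open>e4\<close> parallel on a whole
      neighbourhood, not just at \<open>p\<close>.\<close>
    define V' where "V' = (\<lambda>q. fst (Y q)) -` (- {0}) \<inter> V"
    have "continuous_on V (\<lambda>q. fst (Y q))"
      by (intro msmooth_continuous_on[OF V(1)] msmooth_fst[OF V(1)]) (use Y in \<open>simp add: tangent_field_on_def\<close>)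
    then have "open V'"
      unfolding V'_def by (rule continuous_on_open_vimage[OF V(1), THEN iffD1, rule_format]) (simp add: open_Compl)
    moreover have "nabla q X e4 = 0" if q: "q \<in> V'" and X: "X \<in> tangent_plane A \<phi> q" for q X
    proof -
      have qV: "q \<in> V" and Y0: "fst (Y q) \<noteq> 0" using q by (auto simp: V'_def)
      have qU: "q \<in> U" using qV V(3) by blast
      note tpq = tp[OF qV]
      have Zq: "Z q \<noteq> 0" using null[OF qV] by blast
      have Yq: "Y q \<noteq> 0" using Y0 by auto
      have nul: "G r W (nabla r X e3) = 0" "G r W (nabla r X e4) = 0"
        if "r \<in> V" "X \<in> rel_null_space L g D A \<phi> r" "W \<in> tangent_plane A \<phi> r" for r X W
        using that rel_null_space_eq[of r X] V(3) by blast+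
      obtain m a where W: "nabla q (Z q) Z = m *\<^sub>R Z q + a *\<^sub>R Y q"
        by (rule tangent_plane_orthogonal_basis[OF tpq(1) Zq tpq(2) Yq ZY
              nabla_null_tangent[OF V(1) qV V(3) Zn[OF qV] Z]])
      have GZ: "G q (Z q) (nabla q (Y q) e3) = 0" "G q (Z q) (nabla q (Y q) e4) = 0"
        using shape_symmetric[OF qU frame_smooth(5) frame_normal(1) tpq]
          shape_symmetric[OF qU frame_smooth(6) frame_normal(2) tpq] nul[OF qV Zn[OF qV] tpq(2)] by auto
      have "a * G q (Y q) (nabla q (Y q) e3) = G q (nabla q (Z q) Z) (nabla q (Y q) e3)"
        by (simp add: W g.add_left g.scaleR_left GZ)
      also have "\<dots> = G q (Z q) (Z q) *
          (deriv f' (fst (\<phi> q)) / f (fst (\<phi> q)) - ((f' (fst (\<phi> q)))\<^sup>2 + c) / (f (fst (\<phi> q)))\<^sup>2) * fst (e3 q) * fst (Y q)"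
        by (rule codazzi_null[OF V(1) qV V(3) Z Y Zn ZY frame_smooth(5) frame_normal(1) nul(1)])
      \<comment> \<open>All factors are nonzero: \<open>Z\<close> is space-like, the curvature
        factor is covered by \<open>curv\<close>, \<open>fst (e3 q) = cosh (\<theta> q)\<close>, and
        \<open>fst (Y q)\<close> is nonzero on \<open>V'\<close>.\<close>
      also have "\<dots> \<noteq> 0"
        using tangent_plane_pos[OF tpq(1) Zq] curv[OF time_in_I[of q]] Y0 by (simp add: frame_time_components[OF qU])
      finally have "a \<noteq> 0" by auto
      have "a * G q (Y q) (nabla q (Y q) e4) = G q (nabla q (Z q) Z) (nabla q (Y q) e4)"
        by (simp add: W g.add_left g.scaleR_left GZ)
      also have "\<dots> = G q (Z q) (Z q) *
          (deriv f' (fst (\<phi> q)) / f (fst (\<phi> q)) - ((f' (fst (\<phi> q)))\<^sup>2 + c) / (f (fst (\<phi> q)))\<^sup>2) * fst (e4 q) * fst (Y q)"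
        by (rule codazzi_null[OF V(1) qV V(3) Z Y Zn ZY frame_smooth(6) frame_normal(2) nul(2)])
      \<comment> \<open>\<open>e4\<close> has no time component, so the right side vanishes and
        \<open>a\<close> can be cancelled.\<close>
      finally have GY: "G q (Y q) (nabla q (Y q) e4) = 0"
        using \<open>a \<noteq> 0\<close> by (simp add: frame_time_components[OF qU])
      show ?thesis
      proof (rule e4_parallel[OF qU X])
        fix W assume W: "W \<in> tangent_plane A \<phi> q"
        obtain x y where x: "X = x *\<^sub>R Z q + y *\<^sub>R Y q"
          by (rule tangent_plane_orthogonal_basis[OF tpq(1) Zq tpq(2) Yq ZY X])
        obtain w v where w: "W = w *\<^sub>R Z q + v *\<^sub>R Y q"
          by (rule tangent_plane_orthogonal_basis[OF tpq(1) Zq tpq(2) Yq ZY W])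
        have "G q W (nabla q (Y q) e4) = 0" by (simp add: w g.add_left g.scaleR_left GZ GY)
        then show "G q W (nabla q X e4) = 0"
          using nul(2)[OF qV Zn[OF qV] W]
          by (simp add: x nabla_linear[OF open_U qU frame_smooth(6) tpq] g.add_right g.scaleR_right)
      qed
    qed
    moreover have "p \<in> V'" "V' \<subseteq> U" using Yp V by (auto simp: V'_def)
    ultimately show False using parallel_normal_slice[of V' p] full by blast
  qed
  moreover have pU: "p \<in> U" using V by blast
  ultimately have "z2 p = 0" using \<theta> by (simp add: Y_def frame_time_components)
  then have Zp: "Z p = z1 p *\<^sub>R e1 p"
    using tangent_plane_expansion[OF pU tp(1)[OF V(2)]] by (simp add: z1_def z2_def)
  then have "z1 p \<noteq> 0" using null[OF V(2)] by auto
  then have "e1 p = inverse (z1 p) *\<^sub>R Z p" by (simp add: Zp)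
  then have "e1 p \<in> span {Z p}" by (metis span_base span_scale singletonI)
  then show ?thesis using null[OF V(2)] by simp
qed

section \<open>The structure equations of the frame\<close>

lemma tangential_part_time:
  assumes p: "p \<in> U"
  shows "tangential_part L g A \<phi> p ddt = sinh (\<theta> p) *\<^sub>R e1 p"
proof -
  have "tangent p ddt" by (simp add: ddt_def quadric.zero_right)
  from normal_part_eq[OF p this] have "normal_part L g A \<phi> p ddt = cosh (\<theta> p) *\<^sub>R e3 p"
    by (simp add: adapted[OF p] g.add_left g.scaleR_left frame_products[OF p])
  then show ?thesis unfolding tangential_part_def by (simp add: adapted[OF p])
qed

lemma cov_deriv_frame:
  assumes p: "p \<in> U" and X: "X \<in> tangent_plane A \<phi> p"
  shows "cov_deriv L D A \<phi> p X e1 = nabla p X e1" "cov_deriv L D A \<phi> p X e2 = nabla p X e2"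
    "cov_deriv L D A \<phi> p X e3 = nabla p X e3" "cov_deriv L D A \<phi> p X e4 = nabla p X e4"
  by (rule cov_deriv_eq[OF open_U p _ _ X]; simp add: frame_smooth frame_tangent)+

text \<open>The connection coefficients are skew, and few of them survive: nullity removes those
  pairing the \<open>e1\<close>-derivative of a tangent frame field with a normal one, symmetry of
  the shape operators the normal part of the derivative of \<open>e1\<close> along
  \<open>e2\<close>, and \<open>normal_connection\<close> those of the normal bundle.\<close>

lemma null_e1_imp_equations:
  assumes null: "\<And>p. p \<in> U \<Longrightarrow> e1 p \<in> rel_null_space L g D A \<phi> p"
    and sinh: "\<And>p. p \<in> U \<Longrightarrow> sinh (\<theta> p) \<noteq> 0"
    and p: "p \<in> U"
  defines "\<omega> \<equiv> G p (nabla p (e2 p) e1) (e2 p)"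
    and "h3 \<equiv> G p (nabla p (e2 p) e2) (e3 p)" and "h4 \<equiv> G p (nabla p (e2 p) e2) (e4 p)"
  shows "nabla p (e1 p) e1 = 0" "nabla p (e2 p) e1 = \<omega> *\<^sub>R e2 p"
    "nabla p (e1 p) e2 = 0" "nabla p (e2 p) e2 = - \<omega> *\<^sub>R e1 p - h3 *\<^sub>R e3 p + h4 *\<^sub>R e4 p"
    "nabla p (e1 p) e3 = 0" "nabla p (e2 p) e3 = - h3 *\<^sub>R e2 p"
    "nabla p (e1 p) e4 = 0" "nabla p (e2 p) e4 = - h4 *\<^sub>R e2 p"
    "dir p (e1 p) \<theta> = f' (fst (\<phi> p)) / f (fst (\<phi> p)) * cosh (\<theta> p)"
    "dir p (e2 p) \<theta> = 0"
proof -
  note tp = frame_tangent_plane[OF p]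
  note pr = frame_products[OF p]
  note tm = frame_time_components[OF p]
  let ?H = "f' (fst (\<phi> p)) / f (fst (\<phi> p))"
  have skew: "G p (nabla p X W) (Z p) = - G p (W p) (nabla p X Z)"
    if "W \<in> {e1, e2, e3, e4}" "Z \<in> {e1, e2, e3, e4}" "X \<in> tangent_plane A \<phi> p" for W Z X
  proof -
    have "\<exists>k. \<forall>q\<in>U. G q (W q) (Z q) = k"
      using that(1,2) by (elim insertE emptyE) (simp_all add: frame_products)
    then obtain k where k: "\<And>q. q \<in> U \<Longrightarrow> G q (W q) (Z q) = k" by blast
    have "msmooth_on A U W" "tangent p (W p)" "msmooth_on A U Z" "tangent p (Z p)"
      using that(1,2) frame_smooth frame_tangent[OF p] by auto
    then show ?thesis using nabla_skew[OF open_U p _ _ _ _ k that(3)] by blast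
  qed
  have null': "G p Y (nabla p (e1 p) e3) = 0" "G p Y (nabla p (e1 p) e4) = 0" if "Y \<in> tangent_plane A \<phi> p" for Y
    using null[OF p] rel_null_space_eq[OF p] that by blast+
  have sym: "G p (e1 p) (nabla p (e2 p) e3) = 0" "G p (e1 p) (nabla p (e2 p) e4) = 0"
    using shape_symmetric[OF p frame_smooth(5) frame_normal(1) tp(2,1)]
      shape_symmetric[OF p frame_smooth(6) frame_normal(2) tp(2,1)] null'[OF tp(2)] by auto
  have s34: "G p (e3 p) (nabla p (e1 p) e4) = 0" "G p (e3 p) (nabla p (e2 p) e4) = 0"
    using normal_connection[OF p tp(1) null'(2)[OF tp(1)]] normal_connection[OF p tp(2) sym(2)] by auto
  have self: "G p (nabla p X W) (W p) = 0" if "W \<in> {e1, e2, e3, e4}" "X \<in> tangent_plane A \<phi> p" for X W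
    using skew[OF that(1) that(1) that(2)] g_commute[of "\<phi> p" "W p"] by simp
  have mem: "e1 \<in> {e1, e2, e3, e4}" "e2 \<in> {e1, e2, e3, e4}" "e3 \<in> {e1, e2, e3, e4}" "e4 \<in> {e1, e2, e3, e4}"
    by auto
  have t2: "fst (nabla p (e1 p) e2) = 0"
    using nabla_time[OF p frame_smooth(4) tp(1)] dir_cong[OF open_U p frame_time_components(2)]
    by (simp add: dir_const pr tm)
  \<comment> \<open>The derivative of \<open>e2\<close> along \<open>e1\<close> has time component 0
    and, by nullity, no \<open>e3\<close> component; hence \<open>sinh (\<theta> p)\<close> times
    its \<open>e1\<close> component is 0.\<close>
  have s12: "G p (e1 p) (nabla p (e1 p) e2) = 0"
    using t2 frame_time[OF p, of "nabla p (e1 p) e2"] skew[OF mem(2,3) tp(1)] null'(1)[OF tp(2)] sinh[OF p]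
    by (simp add: g_commute)
  note exp = tangent_expansion[OF p nabla_frame_tangent(1)[OF p]] tangent_expansion[OF p nabla_frame_tangent(2)[OF p]]
    tangent_expansion[OF p nabla_frame_tangent(3)[OF p]] tangent_expansion[OF p nabla_frame_tangent(4)[OF p]]
  show 11: "nabla p (e1 p) e1 = 0"
    using exp(1)[OF tp(1)] self[OF mem(1) tp(1)] skew[OF mem(1,2) tp(1)] skew[OF mem(1,3) tp(1)]
      skew[OF mem(1,4) tp(1)] s12 null'[OF tp(1)] by simp
  show 21: "nabla p (e2 p) e1 = \<omega> *\<^sub>R e2 p"
    using exp(1)[OF tp(2)] self[OF mem(1) tp(2)] skew[OF mem(1,3) tp(2)] skew[OF mem(1,4) tp(2)] sym
    by (simp add: \<omega>_def)
  show "nabla p (e1 p) e2 = 0"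
    using exp(2)[OF tp(1)] self[OF mem(2) tp(1)] skew[OF mem(2,1) tp(1)] skew[OF mem(2,3) tp(1)]
      skew[OF mem(2,4) tp(1)] null'[OF tp(2)] 11 by (simp add: g.zero_right)
  show "nabla p (e2 p) e2 = - \<omega> *\<^sub>R e1 p - h3 *\<^sub>R e3 p + h4 *\<^sub>R e4 p"
    using exp(2)[OF tp(2)] self[OF mem(2) tp(2)] skew[OF mem(1,2) tp(2)]
    by (simp add: \<omega>_def h3_def h4_def g_commute)
  show "nabla p (e1 p) e3 = 0"
    using exp(3)[OF tp(1)] self[OF mem(3) tp(1)] skew[OF mem(3,4) tp(1)] s34 null'[OF tp(1)] null'[OF tp(2)]
    by (simp add: g_commute)
  show "nabla p (e2 p) e3 = - h3 *\<^sub>R e2 p"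
    using exp(3)[OF tp(2)] self[OF mem(3) tp(2)] skew[OF mem(3,4) tp(2)] skew[OF mem(2,3) tp(2)] s34 sym
    by (simp add: h3_def g_commute)
  show "nabla p (e1 p) e4 = 0"
    using exp(4)[OF tp(1)] self[OF mem(4) tp(1)] s34 null'[OF tp(1)] null'[OF tp(2)]
    by (simp add: g_commute)
  show "nabla p (e2 p) e4 = - h4 *\<^sub>R e2 p"
    using exp(4)[OF tp(2)] self[OF mem(4) tp(2)] skew[OF mem(2,4) tp(2)] s34 sym
    by (simp add: h4_def g_commute)
  \<comment> \<open>\<open>\<theta>\<close> is only given as a function. Its derivatives come from
    applying \<open>arsinh\<close> to the smooth function
    \<open>- fst (e1 q) = sinh (\<theta> q)\<close>.\<close>
  have \<theta>: "dir p X \<theta> = - dir p X (\<lambda>q. fst (e1 q)) / cosh (\<theta> p)" for X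
  proof -
    have s: "msmooth_on A U (\<lambda>q. - fst (e1 q))"
      by (intro msmooth_minus[OF open_U] msmooth_fst[OF open_U] frame_smooth)
    have "dir p X \<theta> = dir p X (\<lambda>q. arsinh (- fst (e1 q)))"
      by (rule dir_cong[OF open_U p]) (simp add: frame_time_components arsinh_sinh_real)
    also have "\<dots> = 1 / sqrt ((- fst (e1 p))\<^sup>2 + 1) * dir p X (\<lambda>q. - fst (e1 q))"
      by (rule dir_compose[OF open_U p s arsinh_real_has_field_derivative[unfolded has_field_derivative_def]])
    also have "dir p X (\<lambda>q. - fst (e1 q)) = - dir p X (\<lambda>q. fst (e1 q))"
      by (rule dir_minus[OF open_U p msmooth_fst[OF open_U frame_smooth(3)]])
    also have "sqrt ((- fst (e1 p))\<^sup>2 + 1) = cosh (\<theta> p)"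
      by (simp add: tm cosh_square_eq[symmetric])
    finally show ?thesis by simp
  qed
  have "dir p (e1 p) (\<lambda>q. fst (e1 q)) = - (?H * (1 + (sinh (\<theta> p))\<^sup>2))"
    using nabla_time[OF p frame_smooth(3) tp(1)] by (simp add: 11 pr tm power2_eq_square)
  then have "dir p (e1 p) \<theta> = ?H * (cosh (\<theta> p))\<^sup>2 / cosh (\<theta> p)"
    by (simp add: \<theta> cosh_square_eq)
  then show "dir p (e1 p) \<theta> = ?H * cosh (\<theta> p)" by (simp add: power2_eq_square)
  have "dir p (e2 p) (\<lambda>q. fst (e1 q)) = 0"
    using nabla_time[OF p frame_smooth(3) tp(2)] by (simp add: 21 pr tm)
  then show "dir p (e2 p) \<theta> = 0" by (simp add: \<theta>)
qed

lemma equations_imp_null_e1: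
  assumes p: "p \<in> U" and "nabla p (e1 p) e3 = 0" "nabla p (e1 p) e4 = 0"
  shows "e1 p \<in> rel_null_space L g D A \<phi> p"
  using assms frame_tangent_plane[OF p] by (simp add: rel_null_space_eq[OF p] g.zero_right)

lemma e1_nonzero: "p \<in> U \<Longrightarrow> e1 p \<noteq> 0"
  using frame_products(1)[of p] by (auto simp: g.zero_left)

end

text \<open>The frames form a family whose domains cover the surface, because positive relative
  nullity concerns every point whereas the equations of one frame only reach its domain.\<close>

theorem lemma3p2:
  fixes c :: real and I :: "real set" and f :: "real \<Rightarrow> real"
    and L :: "rw_point set"
    and g :: "rw_point \<Rightarrow> rw_point \<Rightarrow> rw_point \<Rightarrow> real"
    and D :: "rw_point \<Rightarrow> rw_point \<Rightarrow>
              (rw_point \<Rightarrow> rw_point) \<Rightarrow> rw_point"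
    and A :: "('m::{second_countable_topology, t2_space} set \<times> ('m \<Rightarrow> real^2)) set"
    and \<phi> :: "'m \<Rightarrow> rw_point"
    and nab :: "'m \<Rightarrow> rw_point \<Rightarrow> ('m \<Rightarrow> rw_point) \<Rightarrow> rw_point"
    and U :: "'i \<Rightarrow> 'm set"
    and e1 e2 e3 e4 :: "'i \<Rightarrow> 'm \<Rightarrow> rw_point"
    and \<theta> :: "'i \<Rightarrow> 'm \<Rightarrow> real"
  assumes c: "c \<in> {-1, 0, 1}"
    and I: "open I" "is_interval I"
    and f: "smooth_on I f" "\<forall>t\<in>I. f t \<noteq> 0"
    and L: "L = rw_space I c"
    and g: "g = rw_metric f c"
    and D: "levi_civita L g D"
    and A: "smooth_atlas A"
    and \<phi>: "range \<phi> \<subseteq> L" "immersion A \<phi>" "spacelike g A \<phi>"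
    and nab: "nab = cov_deriv L D A \<phi>"
    and curv: "\<forall>t\<in>I. deriv (deriv f) t / f t - ((deriv f t)\<^sup>2 + c) / (f t)\<^sup>2 \<noteq> 0"
    and T: "\<forall>p. tangential_part L g A \<phi> p ddt \<noteq> 0"
    and distr: "positive_relative_nullity L g D A \<phi> \<Longrightarrow>
                smooth_line_distribution A \<phi> (rel_null_space L g D A \<phi>)"
    and conn: "connected (UNIV :: 'm set)"
    and full: "\<not> (\<exists>V N. open V \<and> V \<noteq> {} \<and> totally_geodesic_hypersurface L g D N \<and> \<phi> ` V \<subseteq> N)"
    and U: "\<forall>i. open (U i)" "(\<Union>i. U i) = UNIV"
    and frame: "\<forall>i. orthonormal_frame_on L g A \<phi> (U i) (e1 i) (e2 i) (e3 i) (e4 i)"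
    and adapted: "\<forall>i. \<forall>p\<in>U i. ddt = sinh (\<theta> i p) *\<^sub>R e1 i p + cosh (\<theta> i p) *\<^sub>R e3 i p"
  shows "positive_relative_nullity L g D A \<phi> \<longleftrightarrow>
    (\<forall>i. \<exists>\<omega> h3 h4. msmooth_on A (U i) \<omega> \<and> msmooth_on A (U i) h3 \<and> msmooth_on A (U i) h4 \<and>
      (\<forall>p\<in>U i.
        nab p (e1 i p) (e1 i) = 0 \<and> nab p (e2 i p) (e1 i) = \<omega> p *\<^sub>R e2 i p \<and>
        nab p (e1 i p) (e2 i) = 0 \<and>
        nab p (e2 i p) (e2 i) = - \<omega> p *\<^sub>R e1 i p - h3 p *\<^sub>R e3 i p + h4 p *\<^sub>R e4 i p \<and>
        nab p (e1 i p) (e3 i) = 0 \<and> nab p (e2 i p) (e3 i) = - h3 p *\<^sub>R e2 i p \<and>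
        nab p (e1 i p) (e4 i) = 0 \<and> nab p (e2 i p) (e4 i) = - h4 p *\<^sub>R e2 i p \<and>
        dir_deriv A \<phi> p (e1 i p) (\<theta> i)
          = deriv f (fst (\<phi> p)) / f (fst (\<phi> p)) * cosh (\<theta> i p) \<and>
        dir_deriv A \<phi> p (e2 i p) (\<theta> i) = 0))" (is "_ \<longleftrightarrow> (\<forall>i. ?eqs i)")
proof -
  have fr: "rw_framed_surface c I f D A \<phi> (U i) (e1 i) (e2 i) (e3 i) (e4 i) (\<theta> i)" for i
    by unfold_locales (use c I f L g D A \<phi> U frame adapted in auto)
  show ?thesis
  proof
    assume pos: "positive_relative_nullity L g D A \<phi>"
    show "\<forall>i. ?eqs i"
    proof
      fix i
      interpret F: rw_framed_surface c I f D A \<phi> "U i" "e1 i" "e2 i" "e3 i" "e4 i" "\<theta> i" by (rule fr)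
      \<comment> \<open>The tangential part of \<open>ddt\<close> is \<open>sinh \<theta>\<close>
        times \<open>e1\<close>, so assumption (ii) says that \<open>sinh \<theta>\<close> has no
        zero.\<close>
      have sinh: "sinh (\<theta> i p) \<noteq> 0" if "p \<in> U i" for p
        using T F.tangential_part_time[OF that] by (auto simp: L g)
      have null: "e1 i p \<in> rel_null_space (rw_space I c) (rw_metric f c) D A \<phi> p" if p: "p \<in> U i" for p
      proof -
        obtain V Z where V: "open V" "p \<in> V" "tangent_field_on A \<phi> V Z"
          "\<forall>q\<in>V. Z q \<noteq> 0 \<and> rel_null_space L g D A \<phi> q = span {Z q}"
          using distr[OF pos] unfolding smooth_line_distribution_def by blast
        show ?thesis
        proof (rule F.null_direction)
          show "open (V \<inter> U i)" "p \<in> V \<inter> U i" "V \<inter> U i \<subseteq> U i" using V U p by auto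
          show "tangent_field_on A \<phi> (V \<inter> U i) Z" by (rule F.tangent_field_subset[OF V(3)]) blast
        qed (use V(4) curv full sinh[OF p] in \<open>auto simp: L g\<close>)
      qed
      let ?n = "F.nabla" and ?G = "\<lambda>p. rw_metric f c (\<phi> p)"
      \<comment> \<open>The equations force the coefficients to be frame components of derivatives
        of the frame; as products of smooth fields these are smooth on \<open>U i\<close>.\<close>
      let ?\<omega> = "\<lambda>p. ?G p (?n p (e2 i p) (e1 i)) (e2 i p)"
        and ?h3 = "\<lambda>p. ?G p (?n p (e2 i p) (e2 i)) (e3 i p)"
        and ?h4 = "\<lambda>p. ?G p (?n p (e2 i p) (e2 i)) (e4 i p)"
      have sm: "msmooth_on A (U i) ?\<omega>" "msmooth_on A (U i) ?h3" "msmooth_on A (U i) ?h4"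
        by (intro F.msmooth_g F.msmooth_nabla F.open_U F.frame_smooth)+
      show "?eqs i"
        by (rule exI[of _ ?\<omega>], rule exI[of _ ?h3], rule exI[of _ ?h4], intro conjI sm ballI)
          (simp_all only: nab L F.cov_deriv_frame F.frame_tangent_plane,
            (rule F.null_e1_imp_equations[OF null sinh], assumption+)+)
    qed
  next
    assume eqs: "\<forall>i. ?eqs i"
    show "positive_relative_nullity L g D A \<phi>"
      unfolding positive_relative_nullity_def
    proof
      fix p
      obtain i where p: "p \<in> U i" using U(2) by blast
      interpret F: rw_framed_surface c I f D A \<phi> "U i" "e1 i" "e2 i" "e3 i" "e4 i" "\<theta> i" by (rule fr)
      have "nab p (e1 i p) (e3 i) = 0" "nab p (e1 i p) (e4 i) = 0" using eqs p by blast+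
      then have "e1 i p \<in> rel_null_space L g D A \<phi> p"
        using F.equations_imp_null_e1[OF p] F.cov_deriv_frame(3,4)[OF p F.frame_tangent_plane(1)[OF p]]
        by (simp add: nab L g)
      then have "\<not> rel_null_space L g D A \<phi> p \<subseteq> {0}" using F.e1_nonzero[OF p] by blast
      then show "dim (rel_null_space L g D A \<phi> p) > 0" by (metis dim_eq_0 gr0I)
    qed
  qed
qed

end
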